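(* Let $\mathbb K$ be a field and $m\ge1$ an integer. The category $\operatorname{rep}(\mathcal Z_m,\kappa)$ has enough projectives and enough injectives (every object has a projective cover and an injective envelope in $\operatorname{rep}(\mathcal Z_m,\kappa)$). For each $z\in\mathcal Z_m$ we have $P_z=I_z$, i.e. the indecomposable projective object and the indecomposable injective object at $z$ coincide (both are $\overline M_{(z,z^++2\pi]}$). Each indecomposable object of $\operatorname{rep}(\mathcal Z_m,\kappa)$ admits a unique, possibly countably infinite, composition series.
   Context: Fix a field $\mathbb K$ and an integer $m\ge 1$. Let $0=\theta_1<\theta_2<\dots<\theta_m<\theta_{m+1}=2\pi$ and let $\mathcal Z_m=\mathbb Z^{(1)}\cup\dots\cup\mathbb Z^{(m)}\subset(0,2\pi)$, where $\mathbb Z^{(i)}\subset(\theta_i,\theta_{i+1})$ is a copy of the ordered set $\mathbb Z$ accumulating exactly at $\theta_i$ and $\theta_{i+1}$. The immediate successor and predecessor of $z\in\mathcal Z_m$ are $z^+$ and $z^-$. Identify $S^1=\mathbb R/2\pi\mathbb Z$ with $[0,2\pi)$, so $\mathcal Z_m\subset S^1$; the points $\theta_1,\dots,\theta_m$ of $S^1$ are the accumulation points. Each $s\in[0,2\pi)$ is an accumulation point or lies in $[z,z^+)$ for a unique $z\in\mathcal Z_m$. Let $\gamma\colon\mathbb R\to S^1$ be the covering map. $S^1$ as a category: objects are points; for $x\ne y$, $g_{xy}\colon x\to y$ is the anticlockwise path from $x$ to $y$ (less than one turn), $g_{xx}=1_x$, $\omega_x\colon x\to x$ is one full anticlockwise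 turn; morphisms $x\to y$ are the $g_{xy}\omega_x^n=\omega_y^ng_{xy}$, $n\ge 0$. A representation of $S^1$ is a functor $S^1\to\operatorname{Vect}\mathbb K$; it is pointwise finite if all its values are finite dimensional. Morphisms are natural transformations. For a bounded nonempty interval $U\subseteq\mathbb R$, the string $\overline M_U$ is: $\overline M_U(x)$ has basis $\gamma^{-1}(x)\cap U$, and $\overline M_U(g_{xy})$ sends a basis element $b$ to the element $c\in\gamma^{-1}(y)\cap U$ with $0\le c-b<2\pi$ if it exists, and to $0$ otherwise. One has $\overline M_U\cong\overline M_{U+2n\pi}$ for all $n\in\mathbb Z$. Define $\kappa\colon\mathbb R\to\mathbb R^{>0}$, $2\pi$-periodic, by $\kappa(s)=2\pi+z^+-s$ if $s\in[z,z^+)$ with $z\in\mathcal Z_m$, and $\kappa(s)=2\pi$ if $s\in[0,2\pi)$ is an accumulation point. $\operatorname{Rep}^{\mathrm{pwf}}(S^1,\kappa)$ is the full (abelian) subcategory of pointwise finite representations of $S^1$ that are direct sums (possibly infinite) of strings $\overline M_U$ with $U\subseteq[\inf U,\inf U+\kappa(\inf U)]$. $\operatorname{rep}(\mathcal Z_m,\kappa)$ is the full subcategory (which is abelian) of those $M\in\operatorname{Rep}^{\mathrm{pwf}}(S^1,\kappa)$ such that: (1) $M(g_{xy})$ is an isomorphism whenever $z<x\le y\le z^+$ for some $z\in\mathcal Z_m$; (2) for each accumulation point $\theta$ there are $a,b\in\mathcal Z_m$ with $a<\theta<b$ in cyclic (anticlockwise) order such that $M(g_{xy})$ is an isomorphism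 whenever $a<x\le y\le b$ in cyclic order. The notations $P_z$ and $I_z$ both denote the object $\overline M_{(z,z^++2\pi]}$. Composition series: a (possibly countably infinite) chain of subobjects for which the quotient of any two consecutive elements is simple. The indecomposable objects of $\operatorname{rep}(\mathcal Z_m,\kappa)$ are, up to isomorphism, the $\overline M_U$ with $U=(u_1,u_2+2h\pi]$, $u_1,u_2\in\mathcal Z_m$, $h\in\{0,1\}$, $u_1^+\le u_2+2h\pi\le u_1^++2\pi$, and the series in question for $\overline M_U$ is $$0\subseteq\overline M_{(u_2^-,u_2]}\subseteq\overline M_{(u_2^{--},u_2]}\subseteq\cdots\subseteq\overline M_{(u_1^{++},u_2+2h\pi]}\subseteq\overline M_{(u_1^+,u_2+2h\pi]}\subseteq\overline M_{(u_1,u_2+2h\pi]}=\overline M_U.$$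
   Formalization: A composition series is also required to be unrefinable, since with only simple consecutive quotients uniqueness fails for strings crossing an accumulation point; vector spaces are taken up to isomorphism as subspaces of the functions from the reals to K. *)

theory Defs
  imports "HOL-Analysis.Analysis" "HOL-Library.Function_Algebras" "HOL-Library.Real_Mod"
begin

section \<open>The discrete set and the function \<open>\<kappa>\<close>\<close>

text \<open>\<open>Zs i\<close> is the copy of the ordered set of integers between \<open>\<theta> i\<close> and \<open>\<theta> (i + 1)\<close>.\<close>

definition accumulating_copies :: "nat \<Rightarrow> (nat \<Rightarrow> real) \<Rightarrow> (nat \<Rightarrow> real set) \<Rightarrow> bool" where
  "accumulating_copies m \<theta> Zs \<longleftrightarrow>
     \<theta> 1 = 0 \<and> \<theta> (m + 1) = 2 * pi \<and> strict_mono_on {1..m + 1} \<theta> \<and>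
     (\<forall>i\<in>{1..m}. Zs i \<subseteq> {\<theta> i<..<\<theta> (i + 1)} \<and>
                 (\<exists>f :: int \<Rightarrow> real. strict_mono f \<and> range f = Zs i) \<and>
                 {x. x islimpt Zs i} = {\<theta> i, \<theta> (i + 1)})"

definition next_pt :: "real set \<Rightarrow> real \<Rightarrow> real" where
  "next_pt Z z = (LEAST w. w \<in> Z \<and> z < w)"

text \<open>For \<open>Z\<close> the union of the copies, the points of \<open>[0, 2\<pi>)\<close> that lie in no \<open>[z, z\<^sup>+)\<close> are
  exactly \<open>\<theta> 1, \<dots>, \<theta> m\<close>; they are the \<open>else\<close> case.\<close>

definition kappa :: "real set \<Rightarrow> real \<Rightarrow> real" where
  "kappa Z s =
     (let t = s rmod (2 * pi) in
      if \<exists>z\<in>Z. z \<le> t \<and> t < next_pt Z z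
      then 2 * pi + next_pt Z (THE z. z \<in> Z \<and> z \<le> t \<and> t < next_pt Z z) - t
      else 2 * pi)"

section \<open>The circle as a category\<close>

typedef circle = "{0..<2 * pi :: real}"
  morphisms ang Circle
  by (intro exI[of _ 0]) auto

definition cov :: "real \<Rightarrow> circle" where
  "cov t = Circle (t rmod (2 * pi))"

definition ccw :: "circle \<Rightarrow> circle \<Rightarrow> real" where
  "ccw x y = (ang y - ang x) rmod (2 * pi)"

text \<open>The morphism \<open>g\<^sub>x\<^sub>y \<omega>\<^sub>x\<^sup>n\<close> is encoded by the triple \<open>x n y\<close>; it is the anticlockwise path from
  \<open>x\<close> to \<open>y\<close> of length \<open>ccw x y + 2\<pi>n\<close>.  Since \<open>g\<^sub>y\<^sub>z g\<^sub>x\<^sub>y\<close> is \<open>g\<^sub>x\<^sub>z\<close> or \<open>g\<^sub>x\<^sub>z \<omega>\<^sub>x\<close>, according to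
  whether its length is less than a full turn, the composite of \<open>x a y\<close> and \<open>y b z\<close> is
  \<open>x (a + b + carry x y z) z\<close>.\<close>

definition carry :: "circle \<Rightarrow> circle \<Rightarrow> circle \<Rightarrow> nat" where
  "carry x y z = (if ccw x y + ccw y z < 2 * pi then 0 else 1)"

section \<open>Pointwise finite representations\<close>

text \<open>Values of representations are taken to be subspaces of the space of all functions
  \<open>real \<Rightarrow> 'k\<close>.  Every finite dimensional vector space is isomorphic to such a subspace, so the
  pointwise finite representations below form a category equivalent to that of all of them.\<close>

type_synonym 'k rfun = "real \<Rightarrow> 'k"

definition rscale :: "'k::field \<Rightarrow> 'k rfun \<Rightarrow> 'k rfun" where
  "rscale c f = (\<lambda>t. c * f t)"

global_interpretation rf: vector_space "rscale :: 'k::field \<Rightarrow> 'k rfun \<Rightarrow> 'k rfun"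
  by unfold_locales (auto simp: rscale_def fun_eq_iff algebra_simps)

definition linear_between ::
  "'k::field rfun set \<Rightarrow> 'k rfun set \<Rightarrow> ('k rfun \<Rightarrow> 'k rfun) \<Rightarrow> bool" where
  "linear_between V W f \<longleftrightarrow>
     (\<forall>v\<in>V. f v \<in> W) \<and> (\<forall>v\<in>V. \<forall>w\<in>V. f (v + w) = f v + f w) \<and>
     (\<forall>c. \<forall>v\<in>V. f (rscale c v) = rscale c (f v))"

text \<open>\<open>arr M x n y\<close> is the value of \<open>M\<close> on \<open>g\<^sub>x\<^sub>y \<omega>\<^sub>x\<^sup>n\<close>; only its restriction to \<open>obj M x\<close> matters.\<close>

record 'k rep =
  obj :: "circle \<Rightarrow> 'k rfun set"
  arr :: "circle \<Rightarrow> nat \<Rightarrow> circle \<Rightarrow> 'k rfun \<Rightarrow> 'k rfun"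

definition is_rep :: "'k::field rep \<Rightarrow> bool" where
  "is_rep M \<longleftrightarrow>
     (\<forall>x. rf.subspace (obj M x)) \<and>
     (\<forall>x n y. linear_between (obj M x) (obj M y) (arr M x n y)) \<and>
     (\<forall>x. \<forall>v\<in>obj M x. arr M x 0 x v = v) \<and>
     (\<forall>x a y b z. \<forall>v\<in>obj M x. arr M y b z (arr M x a y v) = arr M x (a + b + carry x y z) z v)"

definition pointwise_finite :: "'k::field rep \<Rightarrow> bool" where
  "pointwise_finite M \<longleftrightarrow> (\<forall>x. \<exists>B. finite B \<and> obj M x = rf.span B)"

type_synonym 'k nat_trans = "circle \<Rightarrow> 'k rfun \<Rightarrow> 'k rfun"

definition rep_hom :: "'k::field rep \<Rightarrow> 'k rep \<Rightarrow> 'k nat_trans \<Rightarrow> bool" where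
  "rep_hom M N f \<longleftrightarrow>
     (\<forall>x. linear_between (obj M x) (obj N x) (f x)) \<and>
     (\<forall>x n y. \<forall>v\<in>obj M x. f y (arr M x n y v) = arr N x n y (f x v))"

definition hom_eq :: "'k rep \<Rightarrow> 'k nat_trans \<Rightarrow> 'k nat_trans \<Rightarrow> bool" where
  "hom_eq M f g \<longleftrightarrow> (\<forall>x. \<forall>v\<in>obj M x. f x v = g x v)"

definition hom_comp :: "'k nat_trans \<Rightarrow> 'k nat_trans \<Rightarrow> 'k nat_trans" where
  "hom_comp g f = (\<lambda>x. g x \<circ> f x)"

definition rep_iso :: "'k::field rep \<Rightarrow> 'k rep \<Rightarrow> bool" where
  "rep_iso M N \<longleftrightarrow> (\<exists>f. rep_hom M N f \<and> (\<forall>x. bij_betw (f x) (obj M x) (obj N x)))"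

definition zero_rep :: "'k::field rep \<Rightarrow> bool" where
  "zero_rep M \<longleftrightarrow> (\<forall>x. obj M x = {0})"

definition subrep :: "'k::field rep \<Rightarrow> (circle \<Rightarrow> 'k rfun set) \<Rightarrow> bool" where
  "subrep M N \<longleftrightarrow>
     (\<forall>x. rf.subspace (N x) \<and> N x \<subseteq> obj M x) \<and> (\<forall>x n y. \<forall>v\<in>N x. arr M x n y v \<in> N y)"

definition restrict_rep :: "'k rep \<Rightarrow> (circle \<Rightarrow> 'k rfun set) \<Rightarrow> 'k rep" where
  "restrict_rep M N = M\<lparr>obj := N\<rparr>"

text \<open>\<open>M\<close> is the (internal, possibly infinite) direct sum of the subrepresentations \<open>N i\<close>.\<close>

definition direct_sum :: "'k::field rep \<Rightarrow> 'i set \<Rightarrow> ('i \<Rightarrow> circle \<Rightarrow> 'k rfun set) \<Rightarrow> bool" where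
  "direct_sum M I N \<longleftrightarrow>
     (\<forall>i\<in>I. subrep M (N i)) \<and>
     (\<forall>x. \<forall>v\<in>obj M x. \<exists>!c.
        (\<forall>i\<in>I. c i \<in> N i x) \<and> (\<forall>i. i \<notin> I \<longrightarrow> c i = 0) \<and> finite {i. c i \<noteq> 0} \<and>
        v = (\<Sum>i | c i \<noteq> 0. c i))"

section \<open>Strings\<close>

definition basis_vec :: "real \<Rightarrow> 'k::field rfun" where
  "basis_vec b = (\<lambda>t. if t = b then 1 else 0)"

text \<open>On basis vectors the action of \<open>g\<^sub>x\<^sub>y \<omega>\<^sub>x\<^sup>n\<close> is \<open>b \<mapsto> b + ccw x y + 2\<pi>n\<close> if this point is in \<open>U\<close>, and
  \<open>b \<mapsto> 0\<close> otherwise.\<close>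

definition string :: "real set \<Rightarrow> 'k::field rep" where
  "string U =
     \<lparr>obj = (\<lambda>x. rf.span (basis_vec ` (cov -` {x} \<inter> U))),
      arr = (\<lambda>x n y v t. if t \<in> U \<and> cov t = y then v (t - (ccw x y + 2 * pi * real n)) else 0)\<rparr>"

section \<open>The categories of representations\<close>

text \<open>Since strings of nonempty intervals are nonzero, the summands of a decomposition are pairwise
  distinct subrepresentations, so that indexing by a set of subrepresentations is no restriction.\<close>

definition Rep_kappa :: "(real \<Rightarrow> real) \<Rightarrow> 'k::field rep \<Rightarrow> bool" where
  "Rep_kappa \<kappa> M \<longleftrightarrow>
     is_rep M \<and> pointwise_finite M \<and>
     (\<exists>\<N>. direct_sum M \<N> (\<lambda>N. N) \<and>
          (\<forall>N\<in>\<N>. \<exists>U. U \<noteq> {} \<and> bounded U \<and> is_interval U \<and>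
                       U \<subseteq> {Inf U..Inf U + \<kappa> (Inf U)} \<and>
                       rep_iso (restrict_rep M N) (string U)))"

definition iso_between :: "'k rep \<Rightarrow> circle \<Rightarrow> circle \<Rightarrow> bool" where
  "iso_between M x y \<longleftrightarrow> bij_betw (arr M x 0 y) (obj M x) (obj M y)"

text \<open>The cyclic order is expressed by anticlockwise distances from \<open>a\<close>.\<close>

definition rep_Z :: "nat \<Rightarrow> (nat \<Rightarrow> real) \<Rightarrow> real set \<Rightarrow> 'k::field rep \<Rightarrow> bool" where
  "rep_Z m \<theta> Z M \<longleftrightarrow>
     Rep_kappa (kappa Z) M \<and>
     (\<forall>z\<in>Z. \<forall>x y. z < ang x \<and> ang x \<le> ang y \<and> ang y \<le> next_pt Z z \<longrightarrow> iso_between M x y) \<and>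
     (\<forall>i\<in>{1..m}. \<exists>a b. ang a \<in> Z \<and> ang b \<in> Z \<and>
        0 < ccw a (cov (\<theta> i)) \<and> ccw a (cov (\<theta> i)) < ccw a b \<and>
        (\<forall>x y. 0 < ccw a x \<and> ccw a x \<le> ccw a y \<and> ccw a y \<le> ccw a b \<longrightarrow> iso_between M x y))"

section \<open>Notions relative to a full subcategory\<close>

text \<open>Below, \<open>C\<close> is the class of objects of a full subcategory.\<close>

definition epi :: "('k::field rep \<Rightarrow> bool) \<Rightarrow> 'k rep \<Rightarrow> 'k rep \<Rightarrow> 'k nat_trans \<Rightarrow> bool" where
  "epi C A B f \<longleftrightarrow>
     C A \<and> C B \<and> rep_hom A B f \<and>
     (\<forall>X g h. C X \<and> rep_hom B X g \<and> rep_hom B X h \<and> hom_eq A (hom_comp g f) (hom_comp h f)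
        \<longrightarrow> hom_eq B g h)"

definition monic :: "('k::field rep \<Rightarrow> bool) \<Rightarrow> 'k rep \<Rightarrow> 'k rep \<Rightarrow> 'k nat_trans \<Rightarrow> bool" where
  "monic C A B f \<longleftrightarrow>
     C A \<and> C B \<and> rep_hom A B f \<and>
     (\<forall>X g h. C X \<and> rep_hom X A g \<and> rep_hom X A h \<and> hom_eq X (hom_comp f g) (hom_comp f h)
        \<longrightarrow> hom_eq X g h)"

definition projective :: "('k::field rep \<Rightarrow> bool) \<Rightarrow> 'k rep \<Rightarrow> bool" where
  "projective C P \<longleftrightarrow>
     C P \<and> (\<forall>A B p f. epi C A B p \<and> rep_hom P B f
        \<longrightarrow> (\<exists>g. rep_hom P A g \<and> hom_eq P (hom_comp p g) f))"

definition injective :: "('k::field rep \<Rightarrow> bool) \<Rightarrow> 'k rep \<Rightarrow> bool" where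
  "injective C J \<longleftrightarrow>
     C J \<and> (\<forall>A B i f. monic C A B i \<and> rep_hom A J f
        \<longrightarrow> (\<exists>g. rep_hom B J g \<and> hom_eq A (hom_comp g i) f))"

definition projective_cover ::
  "('k::field rep \<Rightarrow> bool) \<Rightarrow> 'k rep \<Rightarrow> 'k rep \<Rightarrow> 'k nat_trans \<Rightarrow> bool" where
  "projective_cover C M P p \<longleftrightarrow>
     projective C P \<and> epi C P M p \<and>
     (\<forall>X g. C X \<and> rep_hom X P g \<and> epi C X M (hom_comp p g) \<longrightarrow> epi C X P g)"

definition injective_envelope ::
  "('k::field rep \<Rightarrow> bool) \<Rightarrow> 'k rep \<Rightarrow> 'k rep \<Rightarrow> 'k nat_trans \<Rightarrow> bool" where
  "injective_envelope C M J i \<longleftrightarrow>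
     injective C J \<and> monic C M J i \<and>
     (\<forall>X g. C X \<and> rep_hom J X g \<and> monic C M X (hom_comp g i) \<longrightarrow> monic C J X g)"

definition indecomposable :: "('k::field rep \<Rightarrow> bool) \<Rightarrow> 'k rep \<Rightarrow> bool" where
  "indecomposable C M \<longleftrightarrow>
     C M \<and> \<not> zero_rep M \<and>
     (\<forall>A B. direct_sum M (UNIV :: bool set) (\<lambda>b. if b then A else B) \<and>
            C (restrict_rep M A) \<and> C (restrict_rep M B)
        \<longrightarrow> zero_rep (restrict_rep M A) \<or> zero_rep (restrict_rep M B))"

definition subobject :: "('k::field rep \<Rightarrow> bool) \<Rightarrow> 'k rep \<Rightarrow> (circle \<Rightarrow> 'k rfun set) \<Rightarrow> bool" where
  "subobject C M N \<longleftrightarrow> subrep M N \<and> C (restrict_rep M N)"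

definition simple_object :: "('k::field rep \<Rightarrow> bool) \<Rightarrow> 'k rep \<Rightarrow> bool" where
  "simple_object C S \<longleftrightarrow>
     C S \<and> \<not> zero_rep S \<and> (\<forall>N. subobject C S N \<longrightarrow> N = (\<lambda>_. {0}) \<or> N = obj S)"

text \<open>\<open>Q\<close> is a quotient of the subobject \<open>N\<close> of \<open>M\<close> by the smaller subobject \<open>L\<close>.\<close>

definition is_quotient ::
  "'k::field rep \<Rightarrow> (circle \<Rightarrow> 'k rfun set) \<Rightarrow> (circle \<Rightarrow> 'k rfun set) \<Rightarrow> 'k rep \<Rightarrow> bool" where
  "is_quotient M N L Q \<longleftrightarrow>
     is_rep Q \<and>
     (\<exists>p. rep_hom (restrict_rep M N) Q p \<and>
          (\<forall>x. p x ` N x = obj Q x \<and> {v \<in> N x. p x v = 0} = L x))"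

text \<open>Chains are infinite in general, and consecutive terms having simple quotients does not prevent
  a chain from skipping subobjects: deleting from a chain of order type \<open>\<omega> + \<omega>\<^sup>*\<close> all terms of the
  \<open>\<omega>\<close> part except 0 creates no new consecutive terms.  The last clause requires that the chain
  cannot be refined, which is automatic for finite chains.\<close>

definition composition_series ::
  "('k::field rep \<Rightarrow> bool) \<Rightarrow> 'k rep \<Rightarrow> (circle \<Rightarrow> 'k rfun set) set \<Rightarrow> bool" where
  "composition_series C M \<C> \<longleftrightarrow>
     countable \<C> \<and> (\<forall>N\<in>\<C>. subobject C M N) \<and> (\<forall>N\<in>\<C>. \<forall>L\<in>\<C>. N \<le> L \<or> L \<le> N) \<and>
     (\<lambda>_. {0}) \<in> \<C> \<and> obj M \<in> \<C> \<and>
     (\<forall>L\<in>\<C>. \<forall>N\<in>\<C>. L < N \<and> (\<nexists>K. K \<in> \<C> \<and> L < K \<and> K < N)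
        \<longrightarrow> (\<exists>Q. is_quotient M N L Q \<and> simple_object C Q)) \<and>
     (\<forall>N. subobject C M N \<and> (\<forall>L\<in>\<C>. N \<le> L \<or> L \<le> N) \<longrightarrow> N \<in> \<C>)"

text \<open>The subobjects \<open>M\<^bsub>(w, e]\<^esub>\<close> of the string \<open>M\<^bsub>(u, e]\<^esub>\<close>, where \<open>w\<close> runs through the preimage of \<open>Z\<close>
  in the line.\<close>

definition string_series :: "real set \<Rightarrow> real \<Rightarrow> real \<Rightarrow> (circle \<Rightarrow> 'k::field rfun set) set" where
  "string_series Z u e =
     insert (\<lambda>_. {0}) {obj (string {w<..e}) | w. w rmod (2 * pi) \<in> Z \<and> u \<le> w \<and> w < e}"

end

theory Submission
  imports Defs
begin

text \<open>
  The covering map turns a representation of the circle into a representation of the ordered set of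
  real numbers that is periodic under full turns (\<open>ob\<close>, \<open>pth\<close>).  On the line the preimage \<open>L\<close> of
  the discrete set cuts everything except the accumulation points into cells \<open>(w, nx w]\<close>.  An object
  of the category is constant on cells and near the accumulation points, so that it can change only
  in the steps across a point of \<open>L\<close>.  Bisection of compact intervals (\<open>cell_induct\<close>) reduces
  statements about arbitrary paths to these steps, and replaces any choice of finitely many points
  outside of which nothing happens.

  A string in the category must have an interval \<open>(a, b]\<close> with \<open>a\<close> and \<open>b\<close> in \<open>L\<close>, since its interval
  is a union of cells, and the bound \<open>\<kappa>\<close> says that \<open>b\<close> is at most one full turn after \<open>nx a\<close>.  Every
  object is by definition a direct sum of such strings; constancy makes the sum finite, and shifting
  by full turns makes the intervals disjoint, so that the object becomes a space of functions on the
  line (\<open>strand\<close>, \<open>C_decompose\<close>).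

  Sufficiently long paths act by zero (\<open>nilpotent\<close>).  Hence Nakayama's lemma holds: a nonzero quotient
  has a nonzero top and a nonzero subobject a nonzero socle (\<open>nakayama_top\<close>, \<open>nakayama_socle\<close>).  Tops
  and socles are detected by the simple strings \<open>(w, nx w]\<close>, and therefore epimorphisms are the
  surjective homomorphisms and monomorphisms the injective ones (\<open>epi_surj\<close>, \<open>monic_inj\<close>).  A
  homomorphism from a string of maximal length \<open>(z, nx z + 2\<pi>]\<close> to an object is the choice of a vector
  at \<open>nx z\<close>, and a homomorphism to it is the choice of a functional at \<open>nx z + 2\<pi>\<close>, because
  the vanishing conditions on these are implied by nilpotency.  This makes the strings of maximal
  length projective and injective.  Prolonging the strings of an object to the right gives its
  projective cover, and prolonging them to the left gives its injective envelope.

  Finally, over a point of the circle such a string has at most two basis vectors, on which a full turn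
  acts as a nilpotent Jordan block; so its subobjects are the tails \<open>(w, b]\<close> and zero, which form a chain
  (\<open>strand_subrep\<close>).  A composition series contains every subobject that is comparable with all its
  terms, and so it must consist of all subobjects.  An indecomposable object is a single string, since
  otherwise one string splits off.
\<close>

section \<open>Representations of the circle as periodic representations of the line\<close>

lemma cov_eq_iff: "cov s = cov t \<longleftrightarrow> (\<exists>k::int. t = s + 2 * pi * of_int k)"
proof -
  have "cov s = cov t \<longleftrightarrow> s rmod (2 * pi) = t rmod (2 * pi)"
    unfolding cov_def by (subst Circle_inject) (auto simp: rmod_nonneg rmod_less)
  also have "\<dots> \<longleftrightarrow> [s = t] (rmod (2 * pi))"
    by (simp add: rcong_def)
  finally show ?thesis
    by (simp add: rcong_altdef mult.commute)
qed

lemma cov_shift [simp]: "cov (t + 2 * pi * of_int k) = cov t"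
  by (metis cov_eq_iff)

lemma cov_add_cong: "cov s = cov t \<Longrightarrow> cov (s + d) = cov (t + d)"
  by (auto simp: cov_eq_iff)

lemma cov_diff_cong: "cov s = cov t \<Longrightarrow> cov (s - d) = cov (t - d)"
  by (auto simp: cov_eq_iff)

lemma ang_cov: "ang (cov t) = t rmod (2 * pi)"
  unfolding cov_def by (subst Circle_inverse) (auto simp: rmod_nonneg rmod_less)

lemma cov_ang [simp]: "cov (ang x) = x"
proof -
  have "ang x \<in> {0..<2 * pi}" by (rule ang)
  then show ?thesis by (simp add: cov_def ang_inverse)
qed

lemma ccw_cov: "ccw (cov s) (cov t) = (t - s) rmod (2 * pi)"
  unfolding ccw_def ang_cov by (rule rmod_diff)

lemma cov_ang_ccw [simp]: "cov (ang x + (ccw x y + 2 * pi * real n)) = y"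
proof -
  have "ccw x y = (ang y - ang x) rmod (2 * pi)" by (simp add: ccw_def)
  then obtain k :: int where "ccw x y = (ang y - ang x) + 2 * pi * of_int k"
    by (auto simp: rmod_def intro: that[of "- \<lfloor>(ang y - ang x) / (2 * pi)\<rfloor>"])
  then have "ang x + (ccw x y + 2 * pi * real n) = ang y + 2 * pi * of_int (k + int n)"
    by (simp add: algebra_simps)
  then show ?thesis by (metis cov_shift cov_ang)
qed

lemma ccw_nonneg: "0 \<le> ccw x y"
  by (simp add: ccw_def rmod_nonneg)

lemma ccw_less: "ccw x y < 2 * pi"
  by (simp add: ccw_def rmod_less)

definition turns :: "real \<Rightarrow> real \<Rightarrow> nat" where
  "turns s t = nat \<lfloor>(t - s) / (2 * pi)\<rfloor>"

lemma ccw_turns: "s \<le> t \<Longrightarrow> ccw (cov s) (cov t) + 2 * pi * real (turns s t) = t - s"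
  by (auto simp: ccw_cov turns_def rmod_def)

lemma turns_eqI: "ccw (cov s) (cov t) + 2 * pi * real n = t - s \<Longrightarrow> turns s t = n"
proof -
  assume *: "ccw (cov s) (cov t) + 2 * pi * real n = t - s"
  then have "s \<le> t" using ccw_nonneg[of "cov s" "cov t"]
    by (smt (verit) mult_nonneg_nonneg of_nat_0_le_iff pi_ge_zero)
  from ccw_turns[OF this] * have "2 * pi * real (turns s t) = 2 * pi * real n" by linarith
  then show ?thesis by simp
qed

lemma turns_add:
  assumes "s \<le> t" "t \<le> u"
  shows "turns s t + turns t u + carry (cov s) (cov t) (cov u) = turns s u"
proof -
  let ?x = "ccw (cov s) (cov t)" and ?y = "ccw (cov t) (cov u)" and ?z = "ccw (cov s) (cov u)"
  have e: "?x + 2 * pi * real (turns s t) = t - s" "?y + 2 * pi * real (turns t u) = u - t"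
      "?z + 2 * pi * real (turns s u) = u - s"
    using assms by (auto intro!: ccw_turns)
  define k where "k = int (turns s u) - int (turns s t) - int (turns t u)"
  have k: "?x + ?y = ?z + 2 * pi * of_int k"
    using e unfolding k_def by (simp add: algebra_simps)
  have "0 \<le> ?x" "?x < 2 * pi" "0 \<le> ?y" "?y < 2 * pi" "0 \<le> ?z" "?z < 2 * pi"
    by (auto simp: ccw_nonneg ccw_less)
  then have "2 * pi * of_int k < 2 * pi * 2" "2 * pi * (-1) < 2 * pi * of_int k"
    using k by linarith+
  then have kk: "k = 0 \<or> k = 1"
    by (subst (asm) (1 2) mult_less_cancel_left_pos) auto
  have "carry (cov s) (cov t) (cov u) = nat k"
    using kk k \<open>0 \<le> ?z\<close> \<open>?z < 2 * pi\<close> by (auto simp: carry_def)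
  then show ?thesis using kk by (auto simp: k_def)
qed

abbreviation ob :: "'k rep \<Rightarrow> real \<Rightarrow> 'k rfun set" where
  "ob M s \<equiv> obj M (cov s)"

text \<open>The pullback of a representation along the covering map: \<open>pth M s t\<close> is the action of
  the path of the line from \<open>s\<close> to \<open>t\<close>.  All later arguments take place on the line, where
  composition of paths has no carry.\<close>

definition pth :: "'k rep \<Rightarrow> real \<Rightarrow> real \<Rightarrow> 'k rfun \<Rightarrow> 'k rfun" where
  "pth M s t = arr M (cov s) (turns s t) (cov t)"

lemma arr_eq_pth: "arr M x n y = pth M (ang x) (ang x + (ccw x y + 2 * pi * real n))"
proof -
  have "turns (ang x) (ang x + (ccw x y + 2 * pi * real n)) = n"
    by (rule turns_eqI) simp
  then show ?thesis by (simp add: pth_def)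
qed

lemma path_target_ge: "ang x \<le> ang x + (ccw x y + 2 * pi * real n)"
  using ccw_nonneg[of x y] by (smt (verit) mult_nonneg_nonneg of_nat_0_le_iff pi_ge_zero)

lemma turns_shift: "turns (s + d) (t + d) = turns s t"
  by (simp add: turns_def)

lemma pth_shift: "pth M (s + 2 * pi * of_int k) (t + 2 * pi * of_int k) = pth M s t"
  by (simp add: pth_def turns_shift)

lemma pth_cong: "cov s = cov s' \<Longrightarrow> t' - s' = t - s \<Longrightarrow> pth M s t = pth M s' t'"
proof -
  assume "cov s = cov s'" and d: "t' - s' = t - s"
  then obtain k :: int where k: "s' = s + 2 * pi * of_int k" by (auto simp: cov_eq_iff)
  then have "t' = t + 2 * pi * of_int k" using d by simp
  with k show ?thesis by (simp only: pth_shift)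
qed

lemma ob_zero: "is_rep M \<Longrightarrow> 0 \<in> ob M s"
  by (auto simp: is_rep_def rf.subspace_0)

lemma is_rep_subspace: "is_rep M \<Longrightarrow> rf.subspace (obj M x)"
  by (auto simp: is_rep_def)

lemma pth_linear: "is_rep M \<Longrightarrow> linear_between (ob M s) (ob M t) (pth M s t)"
  by (auto simp: is_rep_def pth_def)

lemma pth_in: "is_rep M \<Longrightarrow> v \<in> ob M s \<Longrightarrow> pth M s t v \<in> ob M t"
  using pth_linear[of M s t] by (auto simp: linear_between_def)

lemma pth_refl: "is_rep M \<Longrightarrow> v \<in> ob M s \<Longrightarrow> pth M s s v = v"
  by (auto simp: is_rep_def pth_def turns_def)

lemma pth_comp:
  "is_rep M \<Longrightarrow> s \<le> t \<Longrightarrow> t \<le> u \<Longrightarrow> v \<in> ob M s \<Longrightarrow> pth M t u (pth M s t v) = pth M s u v"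
  unfolding is_rep_def pth_def by (metis turns_add)

lemma is_repI:
  assumes "\<And>x. rf.subspace (obj M x)"
    and lin: "\<And>s t. s \<le> t \<Longrightarrow> linear_between (ob M s) (ob M t) (pth M s t)"
    and id: "\<And>s v. v \<in> ob M s \<Longrightarrow> pth M s s v = v"
    and comp: "\<And>s t u v. s \<le> t \<Longrightarrow> t \<le> u \<Longrightarrow> v \<in> ob M s \<Longrightarrow> pth M t u (pth M s t v) = pth M s u v"
  shows "is_rep M"
  unfolding is_rep_def
proof (intro conjI allI ballI)
  show "rf.subspace (obj M x)" for x by fact
  show "linear_between (obj M x) (obj M y) (arr M x n y)" for x n y
    using lin[OF path_target_ge, of x y n] by (simp add: arr_eq_pth)
  show "arr M x 0 x v = v" if "v \<in> obj M x" for x v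
    using id[of v "ang x"] that by (simp add: arr_eq_pth ccw_def)
  fix x a y b z v assume v: "v \<in> obj M x"
  define s where "s = ang x"
  define t where "t = s + (ccw x y + 2 * pi * real a)"
  define u where "u = t + (ccw y z + 2 * pi * real b)"
  have c: "cov s = x" "cov t = y" by (auto simp: s_def t_def)
  have "cov u = cov (ang y + (ccw y z + 2 * pi * real b))"
    unfolding u_def by (rule cov_add_cong) (simp add: c)
  then have cu: "cov u = z" by simp
  have st: "s \<le> t" using path_target_ge[of x y a] by (simp add: s_def t_def)
  have tu: "t \<le> u" using path_target_ge[of y z b] by (simp add: u_def)
  have n: "turns s t = a" "turns t u = b"
    by (auto intro!: turns_eqI simp: c cu) (auto simp: t_def u_def)
  have "turns s u = a + b + carry x y z"
    using turns_add[OF st tu] by (simp add: c cu n)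
  then show "arr M y b z (arr M x a y v) = arr M x (a + b + carry x y z) z v"
    using comp[OF st tu, of v] v by (simp add: pth_def c cu n)
qed

lemma rep_homI:
  assumes "\<And>s. linear_between (ob M s) (ob N s) (f (cov s))"
    and "\<And>s t v. s \<le> t \<Longrightarrow> v \<in> ob M s \<Longrightarrow> f (cov t) (pth M s t v) = pth N s t (f (cov s) v)"
  shows "rep_hom M N f"
  unfolding rep_hom_def
proof (intro conjI allI ballI)
  show "linear_between (obj M x) (obj N x) (f x)" for x
    using assms(1)[of "ang x"] by simp
  show "f y (arr M x n y v) = arr N x n y (f x v)" if "v \<in> obj M x" for x n y v
    using assms(2)[OF path_target_ge[of x y n], of v] that by (simp add: arr_eq_pth)
qed

lemma rep_hom_linear: "rep_hom M N f \<Longrightarrow> linear_between (obj M x) (obj N x) (f x)"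
  by (auto simp: rep_hom_def)

lemma rep_hom_in: "rep_hom M N f \<Longrightarrow> v \<in> obj M x \<Longrightarrow> f x v \<in> obj N x"
  by (auto simp: rep_hom_def linear_between_def)

lemma rep_hom_pth:
  "rep_hom M N f \<Longrightarrow> v \<in> ob M s \<Longrightarrow> f (cov t) (pth M s t v) = pth N s t (f (cov s) v)"
  by (auto simp: rep_hom_def pth_def)

lemma subrepI:
  assumes "\<And>x. rf.subspace (N x)" "\<And>x. N x \<subseteq> obj M x"
    and "\<And>s t v. s \<le> t \<Longrightarrow> v \<in> N (cov s) \<Longrightarrow> pth M s t v \<in> N (cov t)"
  shows "subrep M N"
  unfolding subrep_def
proof (intro conjI allI ballI)
  show "arr M x n y v \<in> N y" if "v \<in> N x" for x n y v
    using assms(3)[OF path_target_ge[of x y n], of v] that by (simp add: arr_eq_pth)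
qed (use assms in auto)

lemma subrep_pth: "subrep M N \<Longrightarrow> v \<in> N (cov s) \<Longrightarrow> pth M s t v \<in> N (cov t)"
  by (auto simp: subrep_def pth_def)

lemma subrep_subspace: "subrep M N \<Longrightarrow> rf.subspace (N x)"
  and subrep_sub: "subrep M N \<Longrightarrow> N x \<subseteq> obj M x"
  by (auto simp: subrep_def)

lemma obj_restrict [simp]: "obj (restrict_rep M N) = N"
  and arr_restrict [simp]: "arr (restrict_rep M N) = arr M"
  and pth_restrict [simp]: "pth (restrict_rep M N) = pth M"
  by (auto simp: restrict_rep_def pth_def fun_eq_iff)

lemma restrict_obj [simp]: "restrict_rep M (obj M) = M"
  by (simp add: restrict_rep_def)

section \<open>Linear algebra\<close>

text \<open>Resolution leaves zero, sums and multiples of functions in eta-expanded form.\<close>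

lemma rfun_zero_fold [simp]: "(\<lambda>t. 0) = (0 :: 'k::field rfun)"
  and rfun_plus_fold: "(\<lambda>t. v t + w t) = (v + w :: 'k::field rfun)"
  by (auto simp: fun_eq_iff)

lemma linear_betweenI:
  assumes "\<And>v. v \<in> V \<Longrightarrow> f v \<in> W" "\<And>v w. v \<in> V \<Longrightarrow> w \<in> V \<Longrightarrow> f (v + w) = f v + f w"
    "\<And>c v. v \<in> V \<Longrightarrow> f (rscale c v) = rscale c (f v)"
  shows "linear_between V W f"
  using assms by (auto simp: linear_between_def)

lemma linear_between_in: "linear_between V W f \<Longrightarrow> v \<in> V \<Longrightarrow> f v \<in> W"
  and linear_between_add: "linear_between V W f \<Longrightarrow> v \<in> V \<Longrightarrow> w \<in> V \<Longrightarrow> f (v + w) = f v + f w"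
  and linear_between_scale: "linear_between V W f \<Longrightarrow> v \<in> V \<Longrightarrow> f (rscale c v) = rscale c (f v)"
  by (auto simp: linear_between_def)

lemma rscale_apply [simp]: "rscale c f t = c * f t"
  by (simp add: rscale_def)

lemma rfun_scale_fold: "(\<lambda>t. c * v t) = rscale c v"
  by (auto simp: fun_eq_iff)

lemma sum_rfun_apply: "(\<Sum>i\<in>I. f i) t = (\<Sum>i\<in>I. f i (t::real) :: 'k::comm_monoid_add)"
  by (induction I rule: infinite_finite_induct) auto

lemma linear_between_0:
  assumes "linear_between V W f" "rf.subspace V"
  shows "f 0 = 0"
proof -
  have "f (rscale 0 0) = rscale 0 (f 0)"
    using assms rf.subspace_0 by (intro linear_between_scale) auto
  then show ?thesis by simp
qed

lemma linear_between_diff: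
  assumes "linear_between V W f" "rf.subspace V" "v \<in> V" "w \<in> V"
  shows "f (v - w) = f v - f w"
proof -
  have "f ((v - w) + w) = f (v - w) + f w"
    using assms by (intro linear_between_add[OF assms(1)]) (auto intro: rf.subspace_diff)
  then show ?thesis by (simp add: algebra_simps)
qed

lemma linear_between_sum:
  assumes "linear_between V W f" "rf.subspace V" "\<And>i. i \<in> I \<Longrightarrow> g i \<in> V"
  shows "f (\<Sum>i\<in>I. g i) = (\<Sum>i\<in>I. f (g i))"
  using assms(3)
proof (induction I rule: infinite_finite_induct)
  case (insert i I)
  then have "(\<Sum>i\<in>I. g i) \<in> V" using assms(2) by (intro rf.subspace_sum) auto
  with insert show ?case by (simp add: linear_between_add[OF assms(1)] rfun_plus_fold)
qed (use linear_between_0[OF assms(1,2)] in auto)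

lemma linear_between_inj_onI:
  assumes "linear_between V W f" "rf.subspace V" "\<And>v. v \<in> V \<Longrightarrow> f v = 0 \<Longrightarrow> v = 0"
  shows "inj_on f V"
proof (rule inj_onI)
  fix v w assume "v \<in> V" "w \<in> V" "f v = f w"
  then have "f (v - w) = 0" "v - w \<in> V"
    using linear_between_diff[OF assms(1,2)] assms(2) by (auto intro: rf.subspace_diff)
  then show "v = w" using assms(3) by fastforce
qed

lemma linear_between_image_subspace:
  assumes "linear_between V W f" "rf.subspace V"
  shows "rf.subspace (f ` V)"
proof (rule rf.subspaceI)
  show "0 \<in> f ` V"
    using linear_between_0[OF assms] rf.subspace_0[OF assms(2)] by (metis image_eqI)
  show "x + y \<in> f ` V" if "x \<in> f ` V" "y \<in> f ` V" for x y
    using that linear_between_add[OF assms(1)] rf.subspace_add[OF assms(2)]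
    by (smt (verit) image_iff)
  show "rscale c x \<in> f ` V" if "x \<in> f ` V" for c x
    using that linear_between_scale[OF assms(1)] rf.subspace_scale[OF assms(2)]
    by (smt (verit) image_iff)
qed

lemma linear_between_inv_into:
  assumes f: "linear_between V W f" and V: "rf.subspace V" and bij: "bij_betw f V W"
  shows "linear_between W V (inv_into V f)"
proof -
  have *: "\<And>w. w \<in> W \<Longrightarrow> inv_into V f w \<in> V" "\<And>w. w \<in> W \<Longrightarrow> f (inv_into V f w) = w"
    "\<And>v. v \<in> V \<Longrightarrow> inv_into V f (f v) = v"
    using bij by (auto simp: bij_betw_def f_inv_into_f inv_into_into)
  show ?thesis
  proof (rule linear_betweenI)
    fix v w assume "v \<in> W" "w \<in> W"
    then have "f (inv_into V f v + inv_into V f w) = v + w"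
        "inv_into V f v + inv_into V f w \<in> V"
      using * linear_between_add[OF f] rf.subspace_add[OF V] by auto
    then show "inv_into V f (v + w) = inv_into V f v + inv_into V f w" by (metis *(3))
  next
    fix c w assume "w \<in> W"
    then have "f (rscale c (inv_into V f w)) = rscale c w" "rscale c (inv_into V f w) \<in> V"
      using * linear_between_scale[OF f] rf.subspace_scale[OF V] by auto
    then show "inv_into V f (rscale c w) = rscale c (inv_into V f w)" by (metis *(3))
  qed (use * in auto)
qed

text \<open>A functional is required to be linear on all of \<open>real \<Rightarrow> 'k\<close>; by extension this is no
  restriction.\<close>

definition functional :: "('k::field rfun \<Rightarrow> 'k) \<Rightarrow> bool" where
  "functional \<phi> \<longleftrightarrow> (\<forall>v w. \<phi> (v + w) = \<phi> v + \<phi> w) \<and> (\<forall>c v. \<phi> (rscale c v) = c * \<phi> v)"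

lemma functional_add: "functional \<phi> \<Longrightarrow> \<phi> (v + w) = \<phi> v + \<phi> w"
  and functional_scale: "functional \<phi> \<Longrightarrow> \<phi> (rscale c v) = c * \<phi> v"
  by (auto simp: functional_def)

lemma functional_0: "functional \<phi> \<Longrightarrow> \<phi> 0 = 0"
  using functional_scale[of \<phi> 0 0] by simp

lemma vector_space_field: "vector_space ((*) :: 'k::field \<Rightarrow> 'k \<Rightarrow> 'k)"
  by unfold_locales (auto simp: algebra_simps)

lemma functional_separation:
  assumes W: "rf.subspace (W :: 'k::field rfun set)" and v: "v \<notin> W"
  obtains \<phi> where "functional \<phi>" "\<phi> v = 1" "\<And>w. w \<in> W \<Longrightarrow> \<phi> w = 0"
proof -
  interpret vector_space_pair "rscale :: 'k \<Rightarrow> 'k rfun \<Rightarrow> 'k rfun" "(*)"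
    by (intro vector_space_pair.intro rf.vector_space_axioms vector_space_field)
  obtain B where B: "B \<subseteq> W" "rf.independent B" "W \<subseteq> rf.span B"
    by (rule rf.basis_exists[of W])
  have sB: "rf.span B = W"
    using B rf.span_minimal[OF B(1) W] by auto
  have "rf.independent (insert v B)"
    using B v sB by (intro rf.independent_insertI) auto
  from linear_independent_extend[OF this, of "\<lambda>x. if x = v then 1 else 0"]
  obtain g where g: "Vector_Spaces.linear rscale (*) g" "\<forall>x\<in>insert v B. g x = (if x = v then 1 else 0)"
    by auto
  interpret g: Vector_Spaces.linear "rscale :: 'k \<Rightarrow> 'k rfun \<Rightarrow> 'k rfun" "(*)" g by fact
  have "g w = 0" if "w \<in> W" for w
  proof (rule linear_eq_0_on_span[OF g(1), of B])
    show "g x = 0" if "x \<in> B" for x using that g(2) v B(1) by auto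
    show "w \<in> rf.span B" using that sB by simp
  qed
  moreover have "functional g" by (auto simp: functional_def g.add g.scale)
  ultimately show ?thesis using g(2) that by auto
qed

lemma functional_extension:
  assumes i: "linear_between V W i" and V: "rf.subspace (V :: 'k::field rfun set)"
    and inj: "inj_on i V"
    and \<psi>: "\<And>v w. v \<in> V \<Longrightarrow> w \<in> V \<Longrightarrow> \<psi> (v + w) = \<psi> v + (\<psi> w :: 'k)"
      "\<And>c v. v \<in> V \<Longrightarrow> \<psi> (rscale c v) = c * \<psi> v"
  obtains \<phi> where "functional \<phi>" "\<And>v. v \<in> V \<Longrightarrow> \<phi> (i v) = \<psi> v"
proof -
  interpret vector_space_pair "rscale :: 'k \<Rightarrow> 'k rfun \<Rightarrow> 'k rfun" rscale
    by (intro vector_space_pair.intro rf.vector_space_axioms)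
  obtain B where B: "B \<subseteq> V" "rf.independent B" "V \<subseteq> rf.span B"
    by (rule rf.basis_exists[of V])
  have sB: "rf.span B = V"
    using B rf.span_minimal[OF B(1) V] by auto
  obtain i' where i': "Vector_Spaces.linear rscale rscale i'" "\<forall>x\<in>B. i' x = i x"
    using linear_independent_extend[OF B(2)] by blast
  interpret i': Vector_Spaces.linear "rscale :: 'k \<Rightarrow> 'k rfun \<Rightarrow> 'k rfun" rscale i' by fact
  have eq: "i' v = i v" if "v \<in> V" for v
  proof -
    have "v \<in> rf.span B" using that sB by simp
    then have "v \<in> V \<and> i' v = i v"
    proof (induction rule: rf.span_induct_alt)
      case base
      then show ?case by (simp add: linear_between_0[OF i V] i'.zero rf.subspace_0[OF V])
    next
      case (step c x y)
      then have "x \<in> V" "y \<in> V" "rscale c x \<in> V"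
        using B rf.subspace_scale[OF V] by auto
      then show ?case using step i'(2) rf.subspace_add[OF V]
        by (simp add: linear_between_add[OF i] linear_between_scale[OF i] i'.add i'.scale
            rfun_plus_fold rfun_scale_fold)
    qed
    then show ?thesis by simp
  qed
  have "inj_on i' V" using inj eq by (simp cong: inj_on_cong)
  from linear_exists_left_inverse_on[OF i'(1) V this]
  obtain g where g: "range g \<subseteq> V" "Vector_Spaces.linear rscale rscale g" "\<forall>v\<in>V. g (i' v) = v" by auto
  interpret g: Vector_Spaces.linear "rscale :: 'k \<Rightarrow> 'k rfun \<Rightarrow> 'k rfun" rscale g by fact
  have "g v \<in> V" for v using g(1) by blast
  then have "functional (\<lambda>v. \<psi> (g v))"
    using \<psi> by (simp add: functional_def g.add g.scale)
  moreover have "\<psi> (g (i v)) = \<psi> v" if "v \<in> V" for v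
    using that g(3) eq by metis
  ultimately show ?thesis using that by blast
qed

section \<open>Isomorphisms and restrictions\<close>

lemma rep_hom_comp: "rep_hom L M f \<Longrightarrow> rep_hom M N g \<Longrightarrow> rep_hom L N (hom_comp g f)"
  unfolding rep_hom_def hom_comp_def linear_between_def by auto

lemma rep_hom_id: "rep_hom M M (\<lambda>x v. v)"
  by (auto simp: rep_hom_def linear_between_def)

definition is_iso :: "'k::field rep \<Rightarrow> 'k rep \<Rightarrow> 'k nat_trans \<Rightarrow> bool" where
  "is_iso M N f \<longleftrightarrow> rep_hom M N f \<and> (\<forall>x. bij_betw (f x) (obj M x) (obj N x))"

lemma rep_iso_iff: "rep_iso M N \<longleftrightarrow> (\<exists>f. is_iso M N f)"
  by (simp add: rep_iso_def is_iso_def)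

lemma is_iso_hom: "is_iso M N f \<Longrightarrow> rep_hom M N f"
  and is_iso_bij: "is_iso M N f \<Longrightarrow> bij_betw (f x) (obj M x) (obj N x)"
  by (auto simp: is_iso_def)

lemma is_iso_id: "is_iso M M (\<lambda>x v. v)"
  by (auto simp: is_iso_def rep_hom_id bij_betw_def)

lemma is_iso_comp: "is_iso L M f \<Longrightarrow> is_iso M N g \<Longrightarrow> is_iso L N (hom_comp g f)"
  unfolding is_iso_def using rep_hom_comp[of L M f N g]
  by (auto simp: hom_comp_def intro: bij_betw_trans)

definition iso_inv :: "'k rep \<Rightarrow> 'k nat_trans \<Rightarrow> 'k nat_trans" where
  "iso_inv M f = (\<lambda>x. inv_into (obj M x) (f x))"

lemma iso_inv_right: "is_iso M N f \<Longrightarrow> v \<in> obj N x \<Longrightarrow> f x (iso_inv M f x v) = v"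
  and iso_inv_left: "is_iso M N f \<Longrightarrow> v \<in> obj M x \<Longrightarrow> iso_inv M f x (f x v) = v"
  and iso_inv_in: "is_iso M N f \<Longrightarrow> v \<in> obj N x \<Longrightarrow> iso_inv M f x v \<in> obj M x"
proof -
  assume "is_iso M N f"
  then have "bij_betw (f x) (obj M x) (obj N x)" by (auto simp: is_iso_def)
  then show "v \<in> obj N x \<Longrightarrow> f x (iso_inv M f x v) = v"
    "v \<in> obj M x \<Longrightarrow> iso_inv M f x (f x v) = v"
    "v \<in> obj N x \<Longrightarrow> iso_inv M f x v \<in> obj M x"
    by (auto simp: iso_inv_def bij_betw_def f_inv_into_f inv_into_into)
qed

lemma is_iso_inj: "is_iso M N f \<Longrightarrow> v \<in> obj M x \<Longrightarrow> w \<in> obj M x \<Longrightarrow> f x v = f x w \<Longrightarrow> v = w"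
  by (metis iso_inv_left)

lemma is_iso_inv:
  assumes f: "is_iso M N f" and M: "is_rep M"
  shows "is_iso N M (iso_inv M f)"
  unfolding is_iso_def
proof (intro conjI allI)
  show "rep_hom N M (iso_inv M f)"
  proof (rule rep_homI)
    show "linear_between (ob N s) (ob M s) (iso_inv M f (cov s))" for s
      unfolding iso_inv_def using f M
      by (intro linear_between_inv_into) (auto simp: is_iso_def is_rep_subspace rep_hom_linear)
    fix s t v assume v: "v \<in> ob N s"
    define w where "w = iso_inv M f (cov s) v"
    have w: "w \<in> ob M s" "v = f (cov s) w"
      using v f by (auto simp: w_def iso_inv_in iso_inv_right)
    then have "pth N s t v = f (cov t) (pth M s t w)"
      using rep_hom_pth[OF is_iso_hom[OF f], of w s t] by simp
    then show "iso_inv M f (cov t) (pth N s t v) = pth M s t (iso_inv M f (cov s) v)"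
      using w pth_in[OF M w(1)] by (simp add: iso_inv_left[OF f] flip: w_def)
  qed
  show "bij_betw (iso_inv M f x) (obj N x) (obj M x)" for x
    using is_iso_bij[OF f] by (auto simp: iso_inv_def intro: bij_betw_inv_into)
qed

lemma is_rep_restrict:
  assumes M: "is_rep M" and N: "subrep M N"
  shows "is_rep (restrict_rep M N)"
proof (rule is_repI)
  have sub: "\<And>x v. v \<in> N x \<Longrightarrow> v \<in> obj M x" using N by (auto simp: subrep_def)
  show "rf.subspace (obj (restrict_rep M N) x)" for x
    using N by (simp add: subrep_subspace)
  show "linear_between (ob (restrict_rep M N) s) (ob (restrict_rep M N) t) (pth (restrict_rep M N) s t)" for s t
    using pth_linear[OF M, of s t] sub subrep_pth[OF N] by (auto simp: linear_between_def)
  show "pth (restrict_rep M N) s s v = v" if "v \<in> ob (restrict_rep M N) s" for s v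
    using that sub by (auto simp: pth_refl[OF M])
  show "pth (restrict_rep M N) t u (pth (restrict_rep M N) s t v) = pth (restrict_rep M N) s u v"
    if "s \<le> t" "t \<le> u" "v \<in> ob (restrict_rep M N) s" for s t u v
    using that sub by (auto simp: pth_comp[OF M])
qed

lemma rep_hom_0: "rep_hom M N f \<Longrightarrow> is_rep M \<Longrightarrow> f x 0 = 0"
  using linear_between_0[OF rep_hom_linear is_rep_subspace] .

lemma rep_hom_diff:
  "rep_hom M N f \<Longrightarrow> is_rep M \<Longrightarrow> v \<in> obj M x \<Longrightarrow> w \<in> obj M x \<Longrightarrow> f x (v - w) = f x v - f x w"
  using linear_between_diff[OF rep_hom_linear is_rep_subspace] .

lemma pth_0: "is_rep M \<Longrightarrow> pth M s t 0 = 0"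
  using linear_between_0[OF pth_linear is_rep_subspace] .

lemma pth_add:
  "is_rep M \<Longrightarrow> v \<in> ob M s \<Longrightarrow> w \<in> ob M s \<Longrightarrow> pth M s t (v + w) = pth M s t v + pth M s t w"
  using linear_between_add[OF pth_linear] .

section \<open>Cells and accumulation points on the line\<close>

lemma rmod_small: "0 \<le> d \<Longrightarrow> d < 2 * pi \<Longrightarrow> d rmod (2 * pi) = d"
  by (rule rmod_idem) simp

lemma turns_0: "s \<le> t \<Longrightarrow> t < s + 2 * pi \<Longrightarrow> turns s t = 0"
  by (rule turns_eqI) (simp add: ccw_cov rmod_small)

definition bij_path :: "'k::field rep \<Rightarrow> real \<Rightarrow> real \<Rightarrow> bool" where
  "bij_path M s t \<longleftrightarrow> bij_betw (pth M s t) (ob M s) (ob M t)"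

lemma iso_between_path: "s \<le> t \<Longrightarrow> t < s + 2 * pi \<Longrightarrow> iso_between M (cov s) (cov t) \<longleftrightarrow> bij_path M s t"
  by (simp add: iso_between_def bij_path_def pth_def turns_0)

lemma bij_path_shift: "bij_path M (s + 2 * pi * of_int k) (t + 2 * pi * of_int k) \<longleftrightarrow> bij_path M s t"
  by (simp add: bij_path_def pth_shift)

locale circle_cells =
  fixes m :: nat and \<theta> :: "nat \<Rightarrow> real" and Zs :: "nat \<Rightarrow> real set"
  assumes m_pos: "1 \<le> m" and acc: "accumulating_copies m \<theta> Zs"
begin

definition Z :: "real set" where "Z = (\<Union>i\<in>{1..m}. Zs i)"

text \<open>\<open>L\<close> and \<open>Acc\<close> are the preimages in the line of the discrete set and of the accumulation points.\<close>

definition L :: "real set" where "L = {w. w rmod (2 * pi) \<in> Z}"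

abbreviation nx :: "real \<Rightarrow> real" where "nx \<equiv> next_pt L"

definition Acc :: "real set" where "Acc = {a. \<exists>i\<in>{1..m}. cov a = cov (\<theta> i)}"

lemma theta_less: "i \<in> {1..m + 1} \<Longrightarrow> j \<in> {1..m + 1} \<Longrightarrow> i < j \<Longrightarrow> \<theta> i < \<theta> j"
  using acc unfolding accumulating_copies_def by (meson strict_mono_onD)

lemma theta_le: "i \<in> {1..m + 1} \<Longrightarrow> j \<in> {1..m + 1} \<Longrightarrow> i \<le> j \<Longrightarrow> \<theta> i \<le> \<theta> j"
  using theta_less[of i j] by (cases "i = j") auto

lemma theta_1: "\<theta> 1 = 0" and theta_last: "\<theta> (m + 1) = 2 * pi"
  using acc unfolding accumulating_copies_def by blast+

lemma Zs_bounds: "i \<in> {1..m} \<Longrightarrow> z \<in> Zs i \<Longrightarrow> \<theta> i < z \<and> z < \<theta> (i + 1)"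
  using acc unfolding accumulating_copies_def by fastforce

lemma Zs_enum:
  assumes "i \<in> {1..m}"
  obtains f :: "int \<Rightarrow> real" where "strict_mono f" "range f = Zs i"
  using acc assms unfolding accumulating_copies_def by blast

lemma Zs_islimpt: "i \<in> {1..m} \<Longrightarrow> x islimpt Zs i \<longleftrightarrow> x = \<theta> i \<or> x = \<theta> (i + 1)"
proof -
  assume "i \<in> {1..m}"
  then have "{x. x islimpt Zs i} = {\<theta> i, \<theta> (i + 1)}"
    using acc unfolding accumulating_copies_def by blast
  then have "x \<in> {x. x islimpt Zs i} \<longleftrightarrow> x \<in> {\<theta> i, \<theta> (i + 1)}" by (rule arg_cong)
  then show ?thesis by simp
qed

lemma Z_memI: "i \<in> {1..m} \<Longrightarrow> z \<in> Zs i \<Longrightarrow> z \<in> Z"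
  by (auto simp: Z_def)

lemma range_in_Z: "i \<in> {1..m} \<Longrightarrow> range f = Zs i \<Longrightarrow> f n \<in> Z"
  using Z_memI[of i "f n"] by auto

lemma Z_bounds: "z \<in> Z \<Longrightarrow> 0 < z \<and> z < 2 * pi"
proof -
  assume "z \<in> Z"
  then obtain i where i: "i \<in> {1..m}" "z \<in> Zs i" by (auto simp: Z_def)
  then have "\<theta> 1 \<le> \<theta> i" "\<theta> (i + 1) \<le> \<theta> (m + 1)" by (auto intro!: theta_le)
  then show ?thesis using Zs_bounds[OF i] theta_1 theta_last by linarith
qed

lemma L_shift: "w + 2 * pi * of_int k \<in> L \<longleftrightarrow> w \<in> L"
proof -
  have "(w + 2 * pi * of_int k) rmod (2 * pi) = w rmod (2 * pi)"
    using ang_cov[of "w + 2 * pi * of_int k"] ang_cov[of w] by simp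
  then show ?thesis by (simp add: L_def)
qed

lemma L_cong: "cov w = cov w' \<Longrightarrow> w \<in> L \<longleftrightarrow> w' \<in> L"
  by (metis L_shift cov_eq_iff)

lemma Z_in_L: "z \<in> Z \<Longrightarrow> z \<in> L"
  using Z_bounds[of z] by (simp add: L_def)

lemma LE:
  assumes "w \<in> L"
  obtains k :: int and z where "z \<in> Z" "w = z + 2 * pi * of_int k"
proof -
  have "cov (w rmod (2 * pi)) = cov w" by (metis ang_cov cov_ang)
  then obtain k :: int where k: "w = w rmod (2 * pi) + 2 * pi * of_int k"
    using cov_eq_iff by blast
  show ?thesis by (rule that[OF _ k]) (use assms in \<open>simp add: L_def\<close>)
qed

text \<open>Both bounds follow from the position of the limit points: a supremum or infimum of the
  enumeration inside \<open>(\<theta> i, \<theta> (i + 1))\<close> would be a further one.\<close>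

lemma Zs_gap:
  fixes f :: "int \<Rightarrow> real"
  assumes i: "i \<in> {1..m}" and f: "strict_mono f" "range f = Zs i"
    and t: "\<theta> i < t" "t < \<theta> (i + 1)"
  obtains n :: int where "f n < t" "t \<le> f (n + 1)"
proof -
  have fb: "\<theta> i < f n" "f n < \<theta> (i + 1)" for n using Zs_bounds[OF i, of "f n"] f(2) by auto
  have up: "\<exists>n. t \<le> f n"
  proof (rule ccontr)
    assume "\<not> ?thesis"
    then have lt: "f n < t" for n by (auto simp: not_le)
    define s where "s = Sup (range f)"
    have bdd: "bdd_above (range f)" using lt by (intro bdd_aboveI[of _ t]) (auto intro: less_imp_le)
    have le: "f n \<le> s" for n unfolding s_def by (rule cSup_upper[OF _ bdd]) simp
    have less: "f n < s" for n using le[of "n + 1"] strict_monoD[OF f(1), of n "n + 1"] by simp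
    have "s \<le> t" unfolding s_def using lt by (intro cSup_least) (auto intro: less_imp_le)
    have "s islimpt Zs i"
      unfolding islimpt_approachable
    proof (intro allI impI)
      fix e :: real assume "0 < e"
      then obtain n where "s - e < f n"
        using less_cSup_iff[OF _ bdd, of "s - e"] unfolding s_def by auto
      then show "\<exists>x'\<in>Zs i. x' \<noteq> s \<and> dist x' s < e"
        using less[of n] f(2) by (intro bexI[of _ "f n"]) (auto simp: dist_real_def)
    qed
    then have "s = \<theta> i \<or> s = \<theta> (i + 1)" using Zs_islimpt[OF i] by simp
    then show False using fb(1)[of 0] less[of 0] \<open>s \<le> t\<close> t by linarith
  qed
  have down: "\<exists>n. f n < t"
  proof (rule ccontr)
    assume "\<not> ?thesis"
    then have lt: "t \<le> f n" for n by (auto simp: not_less)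
    define s where "s = Inf (range f)"
    have bdd: "bdd_below (range f)" using lt by (intro bdd_belowI[of _ t]) auto
    have le: "s \<le> f n" for n unfolding s_def by (rule cInf_lower[OF _ bdd]) simp
    have less: "s < f n" for n using le[of "n - 1"] strict_monoD[OF f(1), of "n - 1" n] by simp
    have "t \<le> s" unfolding s_def using lt by (intro cInf_greatest) auto
    have "s islimpt Zs i"
      unfolding islimpt_approachable
    proof (intro allI impI)
      fix e :: real assume "0 < e"
      then obtain n where "f n < s + e"
        using cInf_less_iff[OF _ bdd, of "s + e"] unfolding s_def by auto
      then show "\<exists>x'\<in>Zs i. x' \<noteq> s \<and> dist x' s < e"
        using less[of n] f(2) by (intro bexI[of _ "f n"]) (auto simp: dist_real_def)
    qed
    then have "s = \<theta> i \<or> s = \<theta> (i + 1)" using Zs_islimpt[OF i] by simp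
    then show False using fb(2)[of 0] less[of 0] \<open>t \<le> s\<close> t by linarith
  qed
  obtain p q where pq: "f p < t" "t \<le> f q" using up down by auto
  show ?thesis
  proof (rule ccontr)
    assume no: "\<not> ?thesis"
    have step: "f (n + 1) < t" if "f n < t" for n
    proof (rule ccontr)
      assume "\<not> f (n + 1) < t"
      then have "t \<le> f (n + 1)" by simp
      then show False using \<open>f n < t\<close> \<open>\<And>n. f n < t \<Longrightarrow> t \<le> f (n + 1) \<Longrightarrow> thesis\<close> no by blast
    qed
    have lt: "f (p + int k) < t" for k
    proof (induction k)
      case (Suc k)
      have "p + int (Suc k) = p + int k + 1" by simp
      then show ?case using step[OF Suc] by (simp only:)
    qed (use pq in simp)
    have "f p < f q" using pq by linarith
    then have "p < q" by (simp add: strict_mono_less[OF f(1)])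
    then have "q = p + int (nat (q - p))" by simp
    then show False using lt[of "nat (q - p)"] pq(2) by (simp only:)
  qed
qed

lemma theta_interval:
  assumes "0 \<le> t" "t < 2 * pi"
  obtains i where "i \<in> {1..m}" "\<theta> i \<le> t" "t < \<theta> (i + 1)"
proof -
  define i where "i = Max {i \<in> {1..m}. \<theta> i \<le> t}"
  have "1 \<in> {i \<in> {1..m}. \<theta> i \<le> t}" using assms m_pos theta_1 by auto
  then have i: "i \<in> {i \<in> {1..m}. \<theta> i \<le> t}" unfolding i_def by (intro Max_in) auto
  have "t < \<theta> (i + 1)"
  proof (cases "i = m")
    case True
    then show ?thesis using assms theta_last by simp
  next
    case False
    have "\<not> \<theta> (i + 1) \<le> t"
    proof
      assume "\<theta> (i + 1) \<le> t"
      then have "i + 1 \<in> {i \<in> {1..m}. \<theta> i \<le> t}" using i False by auto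
      then have "i + 1 \<le> Max {i \<in> {1..m}. \<theta> i \<le> t}" by (intro Max_ge) auto
      then show False using i_def by linarith
    qed
    then show ?thesis by simp
  qed
  then show ?thesis using i that by auto
qed

lemma next_ptI: "w' \<in> S \<Longrightarrow> w < w' \<Longrightarrow> (\<And>y. y \<in> S \<Longrightarrow> w < y \<Longrightarrow> w' \<le> y) \<Longrightarrow> next_pt S w = w'"
  unfolding next_pt_def by (rule Least_equality) auto

lemma enum_next:
  fixes f :: "int \<Rightarrow> real"
  assumes i: "i \<in> {1..m}" and f: "strict_mono f" "range f = Zs i"
  shows enum_next_Z: "z \<in> Z \<Longrightarrow> f n < z \<Longrightarrow> f (n + 1) \<le> z"
    and enum_next_L: "y \<in> L \<Longrightarrow> f n + 2 * pi * of_int k < y \<Longrightarrow> f (n + 1) + 2 * pi * of_int k \<le> y"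
proof -
  have fZ: "f n \<in> Z" for n using range_in_Z[OF i f(2)] .
  show no: "f (n + 1) \<le> z" if "z \<in> Z" "f n < z" for z
  proof (rule ccontr)
    assume "\<not> f (n + 1) \<le> z"
    then have z: "f n < z" "z < f (n + 1)" using that by auto
    obtain j where j: "j \<in> {1..m}" "z \<in> Zs j" using \<open>z \<in> Z\<close> by (auto simp: Z_def)
    have b: "\<theta> i < f n" "f (n + 1) < \<theta> (i + 1)" "\<theta> j < z" "z < \<theta> (j + 1)"
      using Zs_bounds[OF i, of "f n"] Zs_bounds[OF i, of "f (n + 1)"] Zs_bounds[OF j] f(2) by auto
    have "\<not> i + 1 \<le> j" using theta_le[of "i + 1" j] i j b z by auto
    moreover have "\<not> j + 1 \<le> i" using theta_le[of "j + 1" i] i j b z by auto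
    ultimately have "i = j" by simp
    then obtain p where "z = f p" using j f by auto
    then have "n < p" "p < n + 1" using z strict_mono_less[OF f(1)] by auto
    then show False by simp
  qed
  assume y: "y \<in> L" "f n + 2 * pi * of_int k < y"
  obtain z and l :: int where z: "z \<in> Z" "y = z + 2 * pi * of_int l" using LE[OF y(1)] by metis
  have "0 < z" "z < 2 * pi" "0 < f n" "f (n + 1) < 2 * pi"
    using Z_bounds fZ z by auto
  consider "l < k" | "l = k" | "k + 1 \<le> l" by linarith
  then show "f (n + 1) + 2 * pi * of_int k \<le> y"
  proof cases
    case 1
    then have "2 * pi * (of_int (l + 1) :: real) \<le> 2 * pi * of_int k"
      by (intro mult_left_mono) auto
    then show ?thesis using z y \<open>z < 2 * pi\<close> \<open>0 < f n\<close> by (simp add: algebra_simps)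
  next
    case 2
    then show ?thesis using no z y by auto
  next
    case 3
    then have "2 * pi * (of_int (k + 1) :: real) \<le> 2 * pi * of_int l"
      by (intro mult_left_mono) auto
    then show ?thesis using z \<open>0 < z\<close> \<open>f (n + 1) < 2 * pi\<close> by (simp add: algebra_simps)
  qed
qed

lemma nx_enum:
  fixes f :: "int \<Rightarrow> real"
  assumes i: "i \<in> {1..m}" and f: "strict_mono f" "range f = Zs i"
  shows "nx (f n + 2 * pi * of_int k) = f (n + 1) + 2 * pi * of_int k"
    and "next_pt Z (f n) = f (n + 1)"
proof -
  have fZ: "f n \<in> Z" for n using range_in_Z[OF i f(2)] .
  have inc: "f n < f (n + 1)" using strict_monoD[OF f(1), of n "n + 1"] by simp
  show "next_pt Z (f n) = f (n + 1)"
    by (rule next_ptI) (use fZ enum_next_Z[OF assms] inc in auto)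
  show "nx (f n + 2 * pi * of_int k) = f (n + 1) + 2 * pi * of_int k"
    by (rule next_ptI) (use fZ Z_in_L L_shift inc enum_next_L[OF assms] in auto)
qed

lemma L_enumE:
  assumes "w \<in> L"
  obtains i f n k where "i \<in> {1..m}" "strict_mono f" "range f = Zs i" "w = f (n::int) + 2 * pi * of_int (k::int)"
proof -
  obtain z and k :: int where z: "z \<in> Z" "w = z + 2 * pi * of_int k" using LE[OF assms] by metis
  obtain i where i: "i \<in> {1..m}" "z \<in> Zs i" using z by (auto simp: Z_def)
  obtain f :: "int \<Rightarrow> real" where f: "strict_mono f" "range f = Zs i" using Zs_enum[OF i(1)] .
  obtain n where "z = f n" using i f by auto
  then show ?thesis using that[OF i(1) f] z by blast
qed

lemma nx_Z: "z \<in> Z \<Longrightarrow> next_pt Z z = nx z"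
proof -
  assume "z \<in> Z"
  then obtain i where i: "i \<in> {1..m}" "z \<in> Zs i" by (auto simp: Z_def)
  obtain f :: "int \<Rightarrow> real" where f: "strict_mono f" "range f = Zs i" using Zs_enum[OF i(1)] .
  obtain n where "z = f n" using i f by auto
  then show ?thesis using nx_enum[OF i(1) f, of n] nx_enum(1)[OF i(1) f, of n 0] by simp
qed

lemma nx_Z_in: "z \<in> Z \<Longrightarrow> nx z \<in> Z"
proof -
  assume "z \<in> Z"
  then obtain i where i: "i \<in> {1..m}" "z \<in> Zs i" by (auto simp: Z_def)
  obtain f :: "int \<Rightarrow> real" where f: "strict_mono f" "range f = Zs i" using Zs_enum[OF i(1)] .
  obtain n where "z = f n" using i f by auto
  then show ?thesis using nx_enum(1)[OF i(1) f, of n 0] range_in_Z[OF i(1) f(2)] by simp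
qed

lemma nx_shift: "w \<in> L \<Longrightarrow> nx (w + 2 * pi * of_int k) = nx w + 2 * pi * of_int k"
proof -
  assume "w \<in> L"
  then obtain i f n l where *: "i \<in> {1..m}" "strict_mono f" "range f = Zs i"
      "w = f (n::int) + 2 * pi * of_int (l::int)" by (rule L_enumE)
  have e: "w + 2 * pi * of_int k = f n + 2 * pi * of_int (l + k)" using * by (simp add: algebra_simps)
  have "nx (w + 2 * pi * of_int k) = f (n + 1) + 2 * pi * of_int (l + k)"
    "nx w = f (n + 1) + 2 * pi * of_int l"
    unfolding e unfolding *(4) by (rule nx_enum(1)[OF *(1-3)])+
  then show ?thesis by (simp add: algebra_simps)
qed

lemma nx_cong: "w \<in> L \<Longrightarrow> cov w = cov w' \<Longrightarrow> nx w' = nx w + (w' - w)"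
  using nx_shift by (auto simp: cov_eq_iff)

lemma nx_props: 
  assumes "w \<in> L"
  shows nx_in: "nx w \<in> L" and nx_gt: "w < nx w" and nx_lt: "nx w < w + 2 * pi"
proof -
  obtain i f n l where *: "i \<in> {1..m}" "strict_mono f" "range f = Zs i"
      "w = f (n::int) + 2 * pi * of_int (l::int)" using L_enumE[OF assms] .
  have nx: "nx w = f (n + 1) + 2 * pi * of_int l" using nx_enum(1)[OF *(1-3)] *(4) by simp
  have Z: "f k \<in> Z" for k using range_in_Z[OF *(1,3)] .
  show "nx w \<in> L" using nx Z Z_in_L L_shift by simp
  show "w < nx w" using nx * strict_monoD[OF *(2), of n "n + 1"] by simp
  show "nx w < w + 2 * pi" using nx * Z_bounds[OF Z[of n]] Z_bounds[OF Z[of "n + 1"]] by simp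
qed

lemma nx_le: "w \<in> L \<Longrightarrow> y \<in> L \<Longrightarrow> w < y \<Longrightarrow> nx w \<le> y"
proof -
  assume a: "w \<in> L" "y \<in> L" "w < y"
  obtain i f n l where *: "i \<in> {1..m}" "strict_mono f" "range f = Zs i"
      "w = f (n::int) + 2 * pi * of_int (l::int)" using L_enumE[OF a(1)] .
  show "nx w \<le> y" using enum_next_L[OF *(1-3), of y n l] nx_enum(1)[OF *(1-3)] *(4) a by simp
qed

lemma nx_mono: "w \<in> L \<Longrightarrow> y \<in> L \<Longrightarrow> w \<le> y \<Longrightarrow> nx w \<le> nx y"
  using nx_le[of w y] nx_gt[of y] by (cases "w = y") auto

lemma predecessor:
  assumes "b \<in> L"
  obtains w where "w \<in> L" "nx w = b"
proof -
  obtain i f n l where *: "i \<in> {1..m}" "strict_mono f" "range f = Zs i"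
      "b = f (n::int) + 2 * pi * of_int (l::int)" using L_enumE[OF assms] .
  have "f (n - 1) \<in> Z" using range_in_Z[OF *(1,3)] .
  then have "f (n - 1) + 2 * pi * of_int l \<in> L" using Z_in_L L_shift by simp
  moreover have "nx (f (n - 1) + 2 * pi * of_int l) = b" using nx_enum(1)[OF *(1-3)] * by simp
  ultimately show ?thesis using that by blast
qed

definition pr :: "real \<Rightarrow> real" where "pr b = (SOME w. w \<in> L \<and> nx w = b)"

lemma assumes "b \<in> L"
  shows pr_in: "pr b \<in> L" and nx_pr: "nx (pr b) = b"
proof -
  obtain w where "w \<in> L \<and> nx w = b" using predecessor[OF assms] by blast
  then have "pr b \<in> L \<and> nx (pr b) = b" unfolding pr_def by (rule someI)
  then show "pr b \<in> L" "nx (pr b) = b" by auto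
qed

lemma nx_inj: "w \<in> L \<Longrightarrow> w' \<in> L \<Longrightarrow> nx w = nx w' \<Longrightarrow> w = w'"
  using nx_le[of w w'] nx_le[of w' w] nx_gt[of w] nx_gt[of w'] by linarith

lemma pr_nx: "w \<in> L \<Longrightarrow> pr (nx w) = w"
  by (rule nx_inj) (auto intro: pr_in nx_in nx_pr)

lemma countable_L: "countable L"
proof -
  have "countable (Zs i)" if i: "i \<in> {1..m}" for i
      proof -
    obtain f :: "int \<Rightarrow> real" where "range f = Zs i" using Zs_enum[OF i] by blast
    then show ?thesis using countable_image[of "UNIV :: int set" f] by simp
  qed
  then have "countable Z" unfolding Z_def by auto
  then have "countable (\<Union>z\<in>Z. range (\<lambda>k::int. z + 2 * pi * of_int k))" by auto
  moreover have "L \<subseteq> (\<Union>z\<in>Z. range (\<lambda>k::int. z + 2 * pi * of_int k))" by (auto elim!: LE)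
  ultimately show ?thesis by (rule countable_subset[rotated])
qed

lemma AccI: "i \<in> {1..m} \<Longrightarrow> cov a = cov (\<theta> i) \<Longrightarrow> a \<in> Acc"
  unfolding Acc_def by blast

lemma cell_cases:
  obtains "t \<in> Acc" | w where "w \<in> L" "w < t" "t \<le> nx w"
proof -
  define s where "s = t rmod (2 * pi)"
  have "cov s = cov t" by (metis ang_cov cov_ang s_def)
  then obtain k :: int where k: "t = s + 2 * pi * of_int k" by (auto simp: cov_eq_iff)
  have "0 \<le> s" "s < 2 * pi" by (auto simp: s_def rmod_nonneg rmod_less)
  then obtain i where i: "i \<in> {1..m}" "\<theta> i \<le> s" "s < \<theta> (i + 1)" by (rule theta_interval)
  show ?thesis
  proof (cases "s = \<theta> i")
    case True
    then have "t \<in> Acc" using i(1) \<open>cov s = cov t\<close> by (intro AccI[of i]) auto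
    then show ?thesis by (rule that(1))
  next
    case False
    obtain f :: "int \<Rightarrow> real" where f: "strict_mono f" "range f = Zs i" using Zs_enum[OF i(1)] .
    have "\<theta> i < s" using False i by simp
    obtain n where n: "f n < s" "s \<le> f (n + 1)" using Zs_gap[OF i(1) f \<open>\<theta> i < s\<close> i(3)] .
    have "f n \<in> Z" using range_in_Z[OF i(1) f(2)] .
    show ?thesis
    proof (rule that(2))
      show "f n + 2 * pi * of_int k \<in> L" using \<open>f n \<in> Z\<close> Z_in_L L_shift by simp
      show "t \<le> nx (f n + 2 * pi * of_int k)" using nx_enum(1)[OF i(1) f] n k by simp
    qed (use n k in simp)
  qed
qed

lemma AccE:
  assumes "a \<in> Acc"
  obtains i k where "i \<in> {1..m}" "a = \<theta> i + 2 * pi * of_int (k::int)"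
proof -
  obtain i where i: "i \<in> {1..m}" "cov (\<theta> i) = cov a" using assms by (auto simp: Acc_def)
  then show ?thesis using that by (auto simp: cov_eq_iff)
qed

lemma Acc_right:
  assumes "a \<in> Acc" "0 < e"
  obtains w where "w \<in> L" "a < w" "w < a + e"
proof -
  obtain i and k :: int where i: "i \<in> {1..m}" "a = \<theta> i + 2 * pi * of_int k" using AccE[OF assms(1)] .
  have "\<theta> i islimpt Zs i" using Zs_islimpt i by auto
  then obtain z where "z \<in> Zs i" "dist z (\<theta> i) < e"
    using assms(2) unfolding islimpt_approachable by blast
  moreover from this have "\<theta> i < z" using Zs_bounds i by auto
  moreover have "z \<in> L" using Z_in_L Z_memI[OF i(1) \<open>z \<in> Zs i\<close>] by simp
  ultimately show ?thesis using that[of "z + 2 * pi * of_int k"] i L_shift by (auto simp: dist_real_def)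
qed

lemma Acc_left:
  assumes "a \<in> Acc" "0 < e"
  obtains w where "w \<in> L" "a - e < w" "w < a"
proof -
  obtain i and k :: int where i: "i \<in> {1..m}" "a = \<theta> i + 2 * pi * of_int k" using AccE[OF assms(1)] .
  obtain j and l :: int where j: "j \<in> {1..m}" "a = \<theta> (j + 1) + 2 * pi * of_int l"
  proof (cases "i = 1")
    case True
    then show ?thesis using that[of m "k - 1"] theta_1 theta_last m_pos i by (simp add: algebra_simps)
  next
    case False
    then have "i - 1 \<in> {1..m}" "i - 1 + 1 = i" using i(1) by auto
    then show ?thesis using that[of "i - 1" k] i(2) by simp
  qed
  have "\<theta> (j + 1) islimpt Zs j" using Zs_islimpt j by auto
  then obtain z where "z \<in> Zs j" "dist z (\<theta> (j + 1)) < e"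
    using assms(2) unfolding islimpt_approachable by blast
  moreover from this have "z < \<theta> (j + 1)" using Zs_bounds j by auto
  moreover have "z \<in> L" using Z_in_L Z_memI[OF j(1) \<open>z \<in> Zs j\<close>] by simp
  ultimately show ?thesis using that[of "z + 2 * pi * of_int l"] j L_shift by (auto simp: dist_real_def)
qed

text \<open>Bisection turns a transitive relation that holds locally into one that holds globally.
  On each side of a point only the cell containing that side matters; the step from a point of
  \<open>L\<close> into the next cell is the only place where a representation can change.\<close>

lemma cell_induct [consumes 1, case_names trans cell cross acc]:
  assumes st: "s \<le> t"
    and trans: "\<And>r s t. R r s \<Longrightarrow> R s t \<Longrightarrow> r \<le> s \<Longrightarrow> s \<le> t \<Longrightarrow> R r t"
    and cell: "\<And>w s t. w \<in> L \<Longrightarrow> w < s \<Longrightarrow> s \<le> t \<Longrightarrow> t \<le> nx w \<Longrightarrow> R s t"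
    and cross: "\<And>w t. w \<in> L \<Longrightarrow> w < t \<Longrightarrow> t \<le> nx w \<Longrightarrow> R w t"
    and acc: "\<And>a. a \<in> Acc \<Longrightarrow> \<exists>e>0. \<forall>s t. a - e < s \<and> s \<le> t \<and> t < a + e \<longrightarrow> R s t"
  shows "R s t"
  using st
proof (induction rule: Bolzano)
  case (trans a b c)
  then show ?case by (rule assms(2))
next
  case (local x)
  consider "x \<in> Acc" | w where "w \<in> L" "w < x" "x < nx w" | w where "w \<in> L" "x = nx w"
  proof (cases x rule: cell_cases)
    case (2 w)
    then show ?thesis using that(2,3) by (cases "x = nx w") auto
  qed (use that(1) in auto)
  then show ?case
  proof cases
    case 1
    then obtain e where "0 < e" "\<forall>s t. x - e < s \<and> s \<le> t \<and> t < x + e \<longrightarrow> R s t" using acc by blast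
    then show ?thesis by (intro exI[of _ e]) auto
  next
    case (2 w)
    then show ?thesis using cell[of w] by (intro exI[of _ "min (x - w) (nx w - x)"]) auto
  next
    case (3 w)
    have x: "x \<in> L" "w < x" using 3 nx_in nx_gt by auto
    have "R a b" if "a \<le> x" "x \<le> b" "b - a < min (x - w) (nx x - x)" for a b
    proof -
      have ax: "R a x" using cell[of w a x] that 3 by auto
      show ?thesis
      proof (cases "x = b")
        case False
        then have "R x b" using cross[of x b] that x by auto
        with ax show ?thesis using assms(2) that by blast
      qed (use ax in simp)
    qed
    then show ?thesis using x nx_gt[of x] by (intro exI[of _ "min (x - w) (nx x - x)"]) auto
  qed
qed

text \<open>The ends of \<open>U\<close> can lie neither inside a cell nor at an accumulation point, because \<open>U\<close> would
  then contain points beyond them.\<close>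

lemma saturated_interval:
  assumes U: "U \<noteq> {}" "bounded U" "is_interval U"
    and cell: "\<And>w s t. w \<in> L \<Longrightarrow> w < s \<Longrightarrow> s \<le> t \<Longrightarrow> t \<le> nx w \<Longrightarrow> s \<in> U \<longleftrightarrow> t \<in> U"
    and acc: "\<And>a. a \<in> Acc \<Longrightarrow> \<exists>e>0. \<forall>s t. a - e < s \<and> s \<le> t \<and> t < a + e \<longrightarrow> (s \<in> U \<longleftrightarrow> t \<in> U)"
  obtains u e where "u \<in> L" "e \<in> L" "u < e" "U = {u<..e}"
proof -
  have bdd: "bdd_below U" "bdd_above U"
    using bounded_imp_bdd_below[OF U(2)] bounded_imp_bdd_above[OF U(2)] .
  define u where "u = Inf U"
  define e where "e = Sup U"
  have lo: "u \<le> x" if "x \<in> U" for x unfolding u_def by (rule cInf_lower[OF that bdd(1)])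
  have hi: "x \<le> e" if "x \<in> U" for x unfolding e_def by (rule cSup_upper[OF that bdd(2)])
  have ex_lo: "\<exists>x\<in>U. x < d" if "u < d" for d
    using that cInf_less_iff[OF U(1) bdd(1), of d] unfolding u_def by blast
  have ex_hi: "\<exists>x\<in>U. d < x" if "d < e" for d
    using that less_cSup_iff[OF U(1) bdd(2), of d] unfolding e_def by blast
  have u: "u \<in> L \<and> u \<notin> U"
  proof (cases u rule: cell_cases)
    case 1
    then obtain d where d: "0 < d" "\<forall>s t. u - d < s \<and> s \<le> t \<and> t < u + d \<longrightarrow> (s \<in> U \<longleftrightarrow> t \<in> U)"
      using acc by blast
    obtain x where x: "x \<in> U" "x < u + d" using ex_lo[of "u + d"] d by auto
    have "u - d < u - d / 2" "u - d / 2 \<le> x" using lo[of x] x d by auto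
    then have "u - d / 2 \<in> U" using d(2)[rule_format, of "u - d / 2" x] x by simp
    then have "u \<le> u - d / 2" by (rule lo)
    then show ?thesis using d(1) by simp
  next
    case (2 w)
    have "u = nx w"
    proof (rule ccontr)
      assume "u \<noteq> nx w"
      then have "u < nx w" using 2 by simp
      then obtain x where x: "x \<in> U" "x < nx w" using ex_lo[of "nx w"] by auto
      then have "(w + u) / 2 \<in> U" using cell[of w "(w + u) / 2" x] 2 lo[of x] by auto
      then have "u \<le> (w + u) / 2" by (rule lo)
      then show False using 2 by simp
    qed
    moreover have "u \<notin> U"
    proof
      assume "u \<in> U"
      then have "(w + u) / 2 \<in> U" using cell[of w "(w + u) / 2" u] 2 by auto
      then have "u \<le> (w + u) / 2" by (rule lo)
      then show False using 2 by simp
    qed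
    ultimately show ?thesis using 2 nx_in by auto
  qed
  have e: "e \<in> L \<and> e \<in> U"
  proof (cases e rule: cell_cases)
    case 1
    then obtain d where d: "0 < d" "\<forall>s t. e - d < s \<and> s \<le> t \<and> t < e + d \<longrightarrow> (s \<in> U \<longleftrightarrow> t \<in> U)"
      using acc by blast
    obtain x where x: "x \<in> U" "e - d < x" using ex_hi[of "e - d"] d by auto
    have "x \<le> e + d / 2" "e + d / 2 < e + d" using hi[of x] x d by auto
    then have "e + d / 2 \<in> U" using d(2)[rule_format, of x "e + d / 2"] x by simp
    then have "e + d / 2 \<le> e" by (rule hi)
    then show ?thesis using d(1) by simp
  next
    case (2 w)
    obtain x where x: "x \<in> U" "w < x" using ex_hi[of w] 2 by auto
    then have "nx w \<in> U" using cell[of w x "nx w"] 2 hi[of x] by auto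
    then have "e = nx w" using hi[of "nx w"] 2 by simp
    then show ?thesis using \<open>nx w \<in> U\<close> 2 nx_in by auto
  qed
  have "U = {u<..e}"
  proof
    show "U \<subseteq> {u<..e}"
    proof
      fix x assume "x \<in> U"
      then show "x \<in> {u<..e}" using lo[of x] hi[of x] u by (cases "x = u") auto
    qed
    show "{u<..e} \<subseteq> U"
    proof
      fix x assume "x \<in> {u<..e}"
      then obtain y where "y \<in> U" "y < x" using ex_lo[of x] by auto
      then show "x \<in> U" using U(3) e \<open>x \<in> {u<..e}\<close> unfolding is_interval_1
        by (metis greaterThanAtMost_iff less_imp_le)
    qed
  qed
  moreover have "u < e" using u e lo[of e] by (cases "u = e") auto
  ultimately show ?thesis using u e by (intro that[of u e]) auto
qed

section \<open>Cellwise constant representations\<close>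

text \<open>The two isomorphism conditions on the objects of the category, expressed on the line: cyclic windows
  around accumulation points have become symmetric neighbourhoods.\<close>

definition cellwise :: "'k::field rep \<Rightarrow> bool" where
  "cellwise M \<longleftrightarrow>
     (\<forall>w\<in>L. \<forall>s t. w < s \<and> s \<le> t \<and> t \<le> nx w \<longrightarrow> bij_path M s t) \<and>
     (\<forall>a\<in>Acc. \<exists>e>0. \<forall>s t. a - e < s \<and> s \<le> t \<and> t < a + e \<longrightarrow> bij_path M s t)"

lemma iso_cells_iff:
  "(\<forall>z\<in>Z. \<forall>x y. z < ang x \<and> ang x \<le> ang y \<and> ang y \<le> next_pt Z z \<longrightarrow> iso_between M x y) \<longleftrightarrow>
   (\<forall>w\<in>L. \<forall>s t. w < s \<and> s \<le> t \<and> t \<le> nx w \<longrightarrow> bij_path M s t)" (is "?l = ?r")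
proof
  assume l: ?l
  show ?r
  proof (intro ballI allI impI)
    fix w s t assume w: "w \<in> L" and st: "w < s \<and> s \<le> t \<and> t \<le> nx w"
    obtain k :: int and z where z: "z \<in> Z" "w = z + 2 * pi * of_int k" using LE[OF w] by metis
    define s' t' where "s' = s - 2 * pi * of_int k" and "t' = t - 2 * pi * of_int k"
    have nz: "nx w = nx z + 2 * pi * of_int k" using nx_shift[OF Z_in_L[OF z(1)]] z by simp
    have lt: "z < s'" "s' \<le> t'" "t' \<le> nx z" using st z nz by (auto simp: s'_def t'_def)
    have b: "0 < z" "nx z < 2 * pi" using Z_bounds[OF z(1)] nx_Z_in[OF z(1)] Z_bounds by auto
    have "ang (cov s') = s'" "ang (cov t') = t'" using lt b by (auto simp: ang_cov)
    then have "iso_between M (cov s') (cov t')" using l z(1) lt by (auto simp: nx_Z)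
    then have "bij_path M s' t'" using lt b by (simp add: iso_between_path)
    then show "bij_path M s t" using bij_path_shift[of M s' k t'] by (simp add: s'_def t'_def)
  qed
next
  assume r: ?r
  show ?l
  proof (intro ballI allI impI)
    fix z x y assume z: "z \<in> Z" "z < ang x \<and> ang x \<le> ang y \<and> ang y \<le> next_pt Z z"
    have "ang x \<in> {0..<2 * pi}" "ang y \<in> {0..<2 * pi}" by (rule ang)+
    then show "iso_between M x y"
      using r[rule_format, OF Z_in_L[OF z(1)], of "ang x" "ang y"] z
        iso_between_path[of "ang x" "ang y" M] by (auto simp: nx_Z)
  qed
qed

lemma iso_windows_iff:
  "(\<forall>i\<in>{1..m}. \<exists>a b. ang a \<in> Z \<and> ang b \<in> Z \<and>
        0 < ccw a (cov (\<theta> i)) \<and> ccw a (cov (\<theta> i)) < ccw a b \<and>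
        (\<forall>x y. 0 < ccw a x \<and> ccw a x \<le> ccw a y \<and> ccw a y \<le> ccw a b \<longrightarrow> iso_between M x y)) \<longleftrightarrow>
   (\<forall>a\<in>Acc. \<exists>e>0. \<forall>s t. a - e < s \<and> s \<le> t \<and> t < a + e \<longrightarrow> bij_path M s t)" (is "?l = ?r")
proof
  assume l: ?l
  show ?r
  proof
    fix \<alpha> assume "\<alpha> \<in> Acc"
    then obtain i where i: "i \<in> {1..m}" "cov \<alpha> = cov (\<theta> i)" by (auto simp: Acc_def)
    then obtain a b where ab: "0 < ccw a (cov \<alpha>)" "ccw a (cov \<alpha>) < ccw a b"
      "\<And>x y. 0 < ccw a x \<Longrightarrow> ccw a x \<le> ccw a y \<Longrightarrow> ccw a y \<le> ccw a b \<Longrightarrow> iso_between M x y"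
      using l by metis
    define p where "p = \<alpha> - ccw a (cov \<alpha>)"
    have "cov (ang a + ccw a (cov \<alpha>)) = cov \<alpha>" using cov_ang_ccw[of a "cov \<alpha>" 0] by simp
    then have cp: "cov p = a" using cov_diff_cong[of "ang a + ccw a (cov \<alpha>)" \<alpha> "ccw a (cov \<alpha>)"]
      by (simp add: p_def)
    have dist: "ccw a (cov s) = s - p" if "p \<le> s" "s < p + 2 * pi" for s
      using that ccw_cov[of p s] cp by (simp add: rmod_small)
    have "ccw a b < 2 * pi" by (rule ccw_less)
    let ?e = "min (\<alpha> - p) (p + ccw a b - \<alpha>)"
    have "bij_path M s t" if "\<alpha> - ?e < s" "s \<le> t" "t < \<alpha> + ?e" for s t
    proof -
      have "p < s" "t < p + ccw a b" using that by (auto simp: min_def split: if_splits)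
      then have "iso_between M (cov s) (cov t)"
        using that \<open>ccw a b < 2 * pi\<close> by (intro ab(3)) (auto simp: dist)
      then show ?thesis using \<open>p < s\<close> \<open>t < p + ccw a b\<close> \<open>ccw a b < 2 * pi\<close> that
        by (simp add: iso_between_path)
    qed
    moreover have "0 < ?e" using ab by (auto simp: p_def)
    ultimately show "\<exists>e>0. \<forall>s t. \<alpha> - e < s \<and> s \<le> t \<and> t < \<alpha> + e \<longrightarrow> bij_path M s t" by blast
  qed
next
  assume r: ?r
  show ?l
  proof
    fix i assume i: "i \<in> {1..m}"
    then have A: "\<theta> i \<in> Acc" by (auto simp: Acc_def)
    then obtain e where e: "0 < e" "\<And>s t. \<theta> i - e < s \<Longrightarrow> s \<le> t \<Longrightarrow> t < \<theta> i + e \<Longrightarrow> bij_path M s t"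
      using r by metis
    define d where "d = min e pi"
    have d: "0 < d" "d \<le> e" "d \<le> pi" using e by (auto simp: d_def)
    obtain w1 where w1: "w1 \<in> L" "\<theta> i - d < w1" "w1 < \<theta> i" using Acc_left[OF A d(1)] .
    obtain w2 where w2: "w2 \<in> L" "\<theta> i < w2" "w2 < \<theta> i + d" using Acc_right[OF A d(1)] .
    have dist: "ccw (cov w1) (cov s) = s - w1" if "w1 \<le> s" "s < w1 + 2 * pi" for s
      using that ccw_cov[of w1 s] by (simp add: rmod_small)
    have d2: "ccw (cov w1) (cov w2) = w2 - w1" "ccw (cov w1) (cov (\<theta> i)) = \<theta> i - w1"
      using w1 w2 d by (auto intro!: dist)
    have "iso_between M x y"
      if xy: "0 < ccw (cov w1) x" "ccw (cov w1) x \<le> ccw (cov w1) y" "ccw (cov w1) y \<le> ccw (cov w1) (cov w2)"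
      for x y
    proof -
      define s t where "s = w1 + ccw (cov w1) x" and "t = w1 + ccw (cov w1) y"
      have "cov (w1 + ccw (cov w1) x) = x" for x
        using cov_ang_ccw[of "cov w1" x 0] cov_add_cong[of "ang (cov w1)" w1 "ccw (cov w1) x"] by simp
      then have c: "cov s = x" "cov t = y" by (auto simp: s_def t_def)
      have "bij_path M s t" using xy d2 w1 w2 d by (intro e(2)) (auto simp: s_def t_def)
      moreover have "s \<le> t" "t < s + 2 * pi" using xy d2 w1 w2 d by (auto simp: s_def t_def)
      ultimately show ?thesis using c iso_between_path[of s t M] by simp
    qed
    moreover have "ang (cov w1) \<in> Z" "ang (cov w2) \<in> Z" using w1 w2 by (auto simp: ang_cov L_def)
    moreover have "0 < \<theta> i - w1" "\<theta> i - w1 < w2 - w1" using w1 w2 by auto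
    ultimately show "\<exists>a b. ang a \<in> Z \<and> ang b \<in> Z \<and>
        0 < ccw a (cov (\<theta> i)) \<and> ccw a (cov (\<theta> i)) < ccw a b \<and>
        (\<forall>x y. 0 < ccw a x \<and> ccw a x \<le> ccw a y \<and> ccw a y \<le> ccw a b \<longrightarrow> iso_between M x y)"
      using d2 by metis
  qed
qed

abbreviation C :: "'k::field rep \<Rightarrow> bool" where "C \<equiv> rep_Z m \<theta> Z"

lemma C_iff: "C M \<longleftrightarrow> Rep_kappa (kappa Z) M \<and> cellwise M"
  unfolding rep_Z_def cellwise_def iso_cells_iff iso_windows_iff by simp

lemma kappa_L:
  assumes "w \<in> L"
  shows "w + kappa Z w = nx w + 2 * pi"
proof -
  obtain k :: int and z where z: "z \<in> Z" "w = z + 2 * pi * of_int k" using LE[OF assms] by metis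
  have zt: "w rmod (2 * pi) = z"
    using ang_cov[of w] ang_cov[of z] Z_bounds[OF z(1)] z(2) by simp
  have P: "z \<le> z \<and> z < next_pt Z z" using z nx_gt Z_in_L by (auto simp: nx_Z)
  have "(THE y. y \<in> Z \<and> y \<le> z \<and> z < next_pt Z y) = z"
  proof (rule the_equality)
    fix y assume y: "y \<in> Z \<and> y \<le> z \<and> z < next_pt Z y"
    then show "y = z" using nx_le[of y z] Z_in_L z(1) by (cases "y = z") (auto simp: nx_Z)
  qed (use z P in auto)
  moreover have "\<exists>y\<in>Z. y \<le> z \<and> z < next_pt Z y" using z(1) P by blast
  ultimately have "kappa Z w = 2 * pi + nx z - z"
    unfolding kappa_def Let_def zt using nx_Z[OF z(1)] by simp
  moreover have "nx w = nx z + 2 * pi * of_int k" using nx_shift[OF Z_in_L[OF z(1)]] z by simp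
  ultimately show ?thesis using z by simp
qed

end

section \<open>Direct sums of strings\<close>

definition tot :: "(real \<times> real) set \<Rightarrow> real set" where
  "tot F = (\<Union>p\<in>F. {fst p<..snd p})"

text \<open>The direct sum of the strings of the intervals \<open>(a, b]\<close>, for \<open>(a, b)\<close> in \<open>F\<close>.  Since strings
  may be shifted by full turns, disjoint intervals suffice, and then the sum lives on functions on
  the line again.  The last conjunct of the action is vacuous if \<open>F\<close> is a singleton, so that
  the sum is then equal to the string, not just isomorphic to it.\<close>

definition strand :: "(real \<times> real) set \<Rightarrow> 'k::field rep" where
  "strand F =
     \<lparr>obj = (\<lambda>x. {v. \<forall>t. v t \<noteq> 0 \<longrightarrow> cov t = x \<and> t \<in> tot F}),
      arr = (\<lambda>x n y v t.
        if cov t = y \<and> (\<exists>p\<in>F. t \<in> {fst p<..snd p} \<and>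
             (\<forall>q\<in>F. t - (ccw x y + 2 * pi * real n) \<in> {fst q<..snd q} \<longrightarrow> q = p))
        then v (t - (ccw x y + 2 * pi * real n)) else 0)\<rparr>"

text \<open>The gap \<open>d\<close> leaves room for prolonging the intervals.\<close>

definition separated :: "real \<Rightarrow> (real \<times> real) set \<Rightarrow> bool" where
  "separated d F \<longleftrightarrow> finite F \<and> (\<forall>p\<in>F. fst p < snd p) \<and>
     (\<forall>p\<in>F. \<forall>q\<in>F. p \<noteq> q \<longrightarrow> snd p + d \<le> fst q \<or> snd q + d \<le> fst p)"

lemma separated_finite: "separated d F \<Longrightarrow> finite F"
  and separated_less: "separated d F \<Longrightarrow> p \<in> F \<Longrightarrow> fst p < snd p"
  by (auto simp: separated_def)

lemma separated_mono: "separated d F \<Longrightarrow> d' \<le> d \<Longrightarrow> separated d' F"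
  unfolding separated_def by (meson add_left_mono order_trans)

lemma separated_subset: "separated d F \<Longrightarrow> G \<subseteq> F \<Longrightarrow> separated d G"
  unfolding separated_def by (meson finite_subset subsetD)

lemma separated_single: "a < b \<Longrightarrow> separated d {(a, b)}"
  by (simp add: separated_def)

lemma separated_unique:
  assumes "separated 0 F" "p \<in> F" "q \<in> F" "fst p < t" "t \<le> snd p" "fst q < t" "t \<le> snd q"
  shows "p = q"
proof (rule ccontr)
  assume "p \<noteq> q"
  then have "snd p + 0 \<le> fst q \<or> snd q + 0 \<le> fst p"
    using assms(1-3) unfolding separated_def by blast
  then show False using assms(4-) by linarith
qed

definition same :: "(real \<times> real) set \<Rightarrow> real \<Rightarrow> real \<Rightarrow> bool" where
  "same F s t \<longleftrightarrow> (\<exists>p\<in>F. fst p < s \<and> t \<le> snd p)"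

lemma tot_iff_same: "t \<in> tot F \<longleftrightarrow> same F t t"
  by (auto simp: tot_def same_def)

lemma totE:
  assumes "t \<in> tot F"
  obtains p where "p \<in> F" "fst p < t" "t \<le> snd p"
  using assms by (auto simp: tot_def)

lemma totI: "p \<in> F \<Longrightarrow> fst p < t \<Longrightarrow> t \<le> snd p \<Longrightarrow> t \<in> tot F"
  by (auto simp: tot_def)

lemma same_trans:
  assumes "separated 0 F" "same F r s" "same F s t" "r \<le> s" "s \<le> t"
  shows "same F r t"
proof -
  obtain p q where p: "p \<in> F" "fst p < r" "s \<le> snd p" and q: "q \<in> F" "fst q < s" "t \<le> snd q"
    using assms unfolding same_def by blast
  have "p = q" by (rule separated_unique[OF assms(1) p(1) q(1), of s]) (use p q assms(4,5) in auto)
  then show ?thesis using p q unfolding same_def by blast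
qed

lemma same_sub: "same F r t \<Longrightarrow> r \<le> r' \<Longrightarrow> t' \<le> t \<Longrightarrow> same F r' t'"
  unfolding same_def by force

lemma obj_strand: "v \<in> obj (strand F) x \<longleftrightarrow> (\<forall>t. v t \<noteq> 0 \<longrightarrow> cov t = x \<and> t \<in> tot F)"
  by (simp add: strand_def)

lemma strand_supp: "v \<in> obj (strand F) x \<Longrightarrow> v t \<noteq> 0 \<Longrightarrow> cov t = x \<and> t \<in> tot F"
  by (simp add: obj_strand)

lemma pth_strand:
  assumes F: "separated 0 F" and v: "v \<in> ob (strand F) s" and st: "s \<le> t"
  shows "pth (strand F) s t v u =
    (if cov u = cov t \<and> same F (u - (t - s)) u then v (u - (t - s)) else 0)"
proof (cases "v (u - (t - s)) = 0")
  case True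
  then show ?thesis by (simp add: pth_def strand_def ccw_turns[OF st])
next
  case False
  then have "u - (t - s) \<in> tot F" using v by (simp add: obj_strand)
  then obtain q where q: "q \<in> F" "fst q < u - (t - s)" "u - (t - s) \<le> snd q" by (rule totE)
  have uniq: "q' = q" if "q' \<in> F" "fst q' < u - (t - s)" "u - (t - s) \<le> snd q'" for q'
    using separated_unique[OF F that(1) q(1)] that q by blast
  have "(\<exists>p\<in>F. u \<in> {fst p<..snd p} \<and> (\<forall>q\<in>F. u - (t - s) \<in> {fst q<..snd q} \<longrightarrow> q = p)) \<longleftrightarrow>
      same F (u - (t - s)) u" (is "?l \<longleftrightarrow> ?r")
  proof
    assume ?l
    then obtain p where "p \<in> F" "fst p < u" "u \<le> snd p" "q = p"
      using q by force
    then show ?r using q unfolding same_def by blast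
  next
    assume ?r
    then obtain p where p: "p \<in> F" "fst p < u - (t - s)" "u \<le> snd p" unfolding same_def by blast
    then have "p = q" using uniq[of p] st by simp
    have all: "\<forall>q'\<in>F. u - (t - s) \<in> {fst q'<..snd q'} \<longrightarrow> q' = p"
    proof (intro ballI impI)
      fix q' assume "q' \<in> F" "u - (t - s) \<in> {fst q'<..snd q'}"
      then show "q' = p" using uniq[of q'] \<open>p = q\<close> by simp
    qed
    have "u \<in> {fst p<..snd p}" using p st by simp
    then show ?l using p(1) all by blast
  qed
  then show ?thesis by (simp add: pth_def strand_def ccw_turns[OF st])
qed

lemma subspace_strand: "rf.subspace (obj (strand F) x)"
proof (rule rf.subspaceI)
  fix v w :: "'a rfun" assume v: "v \<in> obj (strand F) x" and w: "w \<in> obj (strand F) x"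
  show "v + w \<in> obj (strand F) x"
    unfolding obj_strand
  proof (intro allI impI)
    fix t assume "(v + w) t \<noteq> 0"
    then have "v t \<noteq> 0 \<or> w t \<noteq> 0" by auto
    then show "cov t = x \<and> t \<in> tot F" using v w by (auto simp: obj_strand)
  qed
next
  fix v :: "'a rfun" and c assume "v \<in> obj (strand F) x"
  then show "rscale c v \<in> obj (strand F) x" unfolding obj_strand by simp
qed (simp add: obj_strand)

lemma pth_strand_in:
  assumes F: "separated 0 F" and v: "v \<in> ob (strand F) s" and st: "s \<le> t"
  shows "pth (strand F) s t v \<in> ob (strand F) t"
  unfolding obj_strand
proof (intro allI impI)
  fix u assume "pth (strand F) s t v u \<noteq> 0"
  then have "cov u = cov t" "same F (u - (t - s)) u"
    unfolding pth_strand[OF assms] by (auto split: if_splits)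
  then show "cov u = cov t \<and> u \<in> tot F"
    unfolding tot_iff_same using st by (simp add: same_sub[of F "u - (t - s)" u])
qed

lemma is_rep_strand:
  assumes F: "separated 0 F"
  shows "is_rep (strand F :: 'k::field rep)"
proof -
  have 1: "rf.subspace (obj (strand F :: 'k rep) x)" for x by (rule subspace_strand)
  have 2: "linear_between (ob (strand F) s) (ob (strand F) t) (pth (strand F :: 'k rep) s t)" if "s \<le> t" for s t
  proof (rule linear_betweenI)
    fix v w :: "'k rfun" and c :: 'k assume v: "v \<in> ob (strand F) s" and w: "w \<in> ob (strand F) s"
    then have vw: "v + w \<in> ob (strand F) s" using rf.subspace_add[OF subspace_strand] by blast
    show "pth (strand F) s t (v + w) = pth (strand F) s t v + pth (strand F) s t w"
      by (rule ext) (simp add: pth_strand[OF F vw that] pth_strand[OF F v that] pth_strand[OF F w that])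
  next
    fix v :: "'k rfun" and c :: 'k assume v: "v \<in> ob (strand F) s"
    then have cv: "rscale c v \<in> ob (strand F) s" using rf.subspace_scale[OF subspace_strand] by blast
    show "pth (strand F) s t (rscale c v) = rscale c (pth (strand F) s t v)"
      by (rule ext) (simp add: pth_strand[OF F v that] pth_strand[OF F cv that])
  qed (rule pth_strand_in[OF F _ that])
  have 3: "pth (strand F) s s v = v" if v: "v \<in> ob (strand F) s" for s and v :: "'k rfun"
  proof (rule ext)
    fix t
    show "pth (strand F) s s v t = v t"
      using pth_strand[OF F v, of s t] strand_supp[OF v, of t] by (auto simp: tot_iff_same)
  qed
  have 4: "pth (strand F) t u (pth (strand F) s t v) = pth (strand F) s u v"
    if le: "s \<le> t" "t \<le> u" and v: "v \<in> ob (strand F) s" for s t u and v :: "'k rfun"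
  proof (rule ext)
    fix r
    have v': "pth (strand F) s t v \<in> ob (strand F) t" by (rule pth_strand_in[OF F v le(1)])
    have d: "r - (u - t) - (t - s) = r - (u - s)" by simp
    have c: "cov (r - (u - t)) = cov t" if "cov r = cov u"
      using cov_diff_cong[OF that, of "u - t"] by simp
    have iff: "same F (r - (u - s)) r \<longleftrightarrow> same F (r - (u - s)) (r - (u - t)) \<and> same F (r - (u - t)) r"
    proof
      assume "same F (r - (u - s)) r"
      then show "same F (r - (u - s)) (r - (u - t)) \<and> same F (r - (u - t)) r"
        using le by (auto intro: same_sub)
    next
      assume "same F (r - (u - s)) (r - (u - t)) \<and> same F (r - (u - t)) r"
      then show "same F (r - (u - s)) r" using le same_trans[OF F, of "r - (u - s)" "r - (u - t)" r] by simp
    qed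
    have key: "(if A \<and> S2 then if B \<and> S1 then x else 0 else 0) = (if A \<and> S3 then x else 0)"
      if "A \<longrightarrow> B" "S3 \<longleftrightarrow> S1 \<and> S2" for A B S1 S2 S3 and x :: 'k
      using that by simp
    show "pth (strand F) t u (pth (strand F) s t v) r = pth (strand F) s u v r"
      unfolding pth_strand[OF F v' le(2)] pth_strand[OF F v le(1)]
        pth_strand[OF F v order.trans[OF le]] d by (rule key[OF _ iff]) (use c in blast)
  qed
  show ?thesis using 1 2 3 4 by (rule is_repI)
qed

lemma finite_fibre: "finite {t. cov t = x \<and> a < t \<and> t \<le> b}"
proof (rule finite_subset)
  let ?K = "{\<lfloor>(a - ang x) / (2 * pi)\<rfloor>..\<lceil>(b - ang x) / (2 * pi)\<rceil>}"
  show "{t. cov t = x \<and> a < t \<and> t \<le> b} \<subseteq> (\<lambda>k. ang x + 2 * pi * of_int k) ` ?K"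
  proof
    fix t assume t: "t \<in> {t. cov t = x \<and> a < t \<and> t \<le> b}"
    then have "cov (ang x) = cov t" by simp
    then obtain k :: int where k: "t = ang x + 2 * pi * of_int k" unfolding cov_eq_iff by blast
    have "a - ang x \<le> of_int k * (2 * pi)" "of_int k * (2 * pi) \<le> b - ang x"
      using t unfolding k by (simp_all add: mult.commute)
    then have "(a - ang x) / (2 * pi) \<le> of_int k" "of_int k \<le> (b - ang x) / (2 * pi)"
      by (simp_all only: pos_divide_le_eq pos_le_divide_eq pi_gt_zero mult_pos_pos zero_less_numeral)
    from floor_mono[OF this(1)] ceiling_mono[OF this(2)] have "k \<in> ?K" by simp
    then show "t \<in> (\<lambda>k. ang x + 2 * pi * of_int k) ` ?K" using k by blast
  qed
qed auto

definition pts :: "(real \<times> real) set \<Rightarrow> circle \<Rightarrow> real set" where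
  "pts F x = {t. cov t = x \<and> t \<in> tot F}"

lemma finite_pts: "finite F \<Longrightarrow> finite (pts F x)"
proof -
  assume "finite F"
  moreover have "pts F x = (\<Union>p\<in>F. {t. cov t = x \<and> fst p < t \<and> t \<le> snd p})"
    by (auto simp: pts_def tot_def)
  ultimately show ?thesis by (simp add: finite_fibre)
qed

lemma basis_vec_apply: "basis_vec b t = (if t = b then 1 else 0)"
  by (simp add: basis_vec_def)

lemma expand_finite:
  assumes "finite S" "\<And>t. v t \<noteq> 0 \<Longrightarrow> t \<in> S"
  shows "v = (\<Sum>t\<in>S. rscale (v t) (basis_vec t))"
proof (rule ext)
  fix u
  have "(\<Sum>t\<in>S. rscale (v t) (basis_vec t)) u = (\<Sum>t\<in>S. if t = u then v t else 0)"
    unfolding sum_rfun_apply by (intro sum.cong) (auto simp: basis_vec_apply)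
  also have "\<dots> = v u" using assms by (auto simp: sum.delta)
  finally show "v u = (\<Sum>t\<in>S. rscale (v t) (basis_vec t)) u" by simp
qed

lemma span_supp: "v \<in> rf.span (basis_vec ` S) \<Longrightarrow> v t \<noteq> 0 \<Longrightarrow> t \<in> S"
proof -
  assume "v \<in> rf.span (basis_vec ` S)" and nz: "v t \<noteq> 0"
  then have "t \<notin> S \<longrightarrow> v t = 0"
    by (induction rule: rf.span_induct_alt) (auto simp: basis_vec_apply split: if_splits)
  then show ?thesis using nz by blast
qed

lemma span_basis_vec: "finite S \<Longrightarrow> rf.span (basis_vec ` S) = {v. \<forall>t. v t \<noteq> 0 \<longrightarrow> t \<in> S}"
proof (intro equalityI subsetI)
  fix v :: "'a rfun" assume "finite S" "v \<in> {v. \<forall>t. v t \<noteq> 0 \<longrightarrow> t \<in> S}"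
  then have "v = (\<Sum>t\<in>S. rscale (v t) (basis_vec t))" by (intro expand_finite) auto
  also have "\<dots> \<in> rf.span (basis_vec ` S)"
    by (intro rf.span_sum rf.span_scale rf.span_base) auto
  finally show "v \<in> rf.span (basis_vec ` S)" .
qed (auto dest: span_supp)

lemma string_eq_strand: "string {a<..b} = strand {(a, b)}"
proof -
  have "finite (cov -` {x} \<inter> {a<..b})" for x
    using finite_fibre[of x a b] by (rule finite_subset[rotated]) auto
  then have "rf.span (basis_vec ` (cov -` {x} \<inter> {a<..b})) =
      {v :: 'a rfun. \<forall>t. v t \<noteq> 0 \<longrightarrow> cov t = x \<and> t \<in> tot {(a, b)}}" for x
    by (subst span_basis_vec) (auto simp: tot_def)
  then show ?thesis by (auto simp: string_def strand_def fun_eq_iff)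
qed

lemma basis_vec_in_strand: "t \<in> tot F \<Longrightarrow> basis_vec t \<in> ob (strand F) t"
  by (auto simp: obj_strand basis_vec_apply)

lemma pth_basis_vec:
  assumes F: "separated 0 F" and s: "s \<in> tot F" and st: "s \<le> t"
  shows "pth (strand F) s t (basis_vec s) = (if same F s t then basis_vec t else 0)"
proof (rule ext)
  fix u
  have eq: "u - (t - s) = s \<longleftrightarrow> u = t" by linarith
  show "pth (strand F) s t (basis_vec s) u = (if same F s t then basis_vec t else 0) u"
    unfolding pth_strand[OF F basis_vec_in_strand[OF s] st] basis_vec_apply eq
    by (cases "u = t") (simp_all add: basis_vec_apply)
qed

lemma bij_path_strand:
  assumes F: "separated 0 F" and st: "s \<le> t"
    and eq: "\<And>r p. cov r = cov s \<Longrightarrow> p \<in> F \<Longrightarrow>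
      fst p < r \<and> r \<le> snd p \<longleftrightarrow> fst p < r + (t - s) \<and> r + (t - s) \<le> snd p"
  shows "bij_path (strand F :: 'k::field rep) s t"
proof -
  have same: "same F r (r + (t - s)) \<longleftrightarrow> r \<in> tot F" "r + (t - s) \<in> tot F \<longleftrightarrow> r \<in> tot F"
    if "cov r = cov s" for r
  proof -
    show "same F r (r + (t - s)) \<longleftrightarrow> r \<in> tot F"
    proof
      assume "same F r (r + (t - s))"
      then obtain p where "p \<in> F" "fst p < r" "r + (t - s) \<le> snd p" unfolding same_def by blast
      then show "r \<in> tot F" using st by (intro totI[of p]) auto
    next
      assume "r \<in> tot F"
      then obtain p where "p \<in> F" "fst p < r" "r \<le> snd p" by (rule totE)
      then show "same F r (r + (t - s))" using eq[OF that, of p] unfolding same_def by blast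
    qed
    show "r + (t - s) \<in> tot F \<longleftrightarrow> r \<in> tot F"
    proof
      assume "r + (t - s) \<in> tot F"
      then obtain p where "p \<in> F" "fst p < r + (t - s)" "r + (t - s) \<le> snd p" by (rule totE)
      then show "r \<in> tot F" using eq[OF that, of p] by (intro totI[of p]) auto
    next
      assume "r \<in> tot F"
      then obtain p where "p \<in> F" "fst p < r" "r \<le> snd p" by (rule totE)
      then show "r + (t - s) \<in> tot F" using eq[OF that, of p] by (intro totI[of p]) auto
    qed
  qed
  have cov: "cov (r + (t - s)) = cov t \<longleftrightarrow> cov r = cov s" for r
  proof
    assume "cov (r + (t - s)) = cov t"
    from cov_diff_cong[OF this, of "t - s"] show "cov r = cov s" by simp
  next
    assume "cov r = cov s"
    from cov_add_cong[OF this, of "t - s"] show "cov (r + (t - s)) = cov t" by simp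
  qed
  let ?g = "\<lambda>(w :: 'k rfun) r. w (r + (t - s))"
  have ap: "pth (strand F) s t v (r + (t - s)) = v r" if v: "v \<in> ob (strand F) s"
    for v :: "'k rfun" and r
  proof (cases "v r = 0")
    case False
    then have "cov r = cov s" "r \<in> tot F" using strand_supp[OF v] by auto
    then show ?thesis using pth_strand[OF F v st, of "r + (t - s)"] same(1) cov[of r] by simp
  qed (simp add: pth_strand[OF F v st])
  show ?thesis
    unfolding bij_path_def
  proof (rule bij_betw_byWitness[where f' = ?g])
    show "\<forall>v\<in>ob (strand F) s. ?g (pth (strand F) s t v) = v" 
      using ap by (intro ballI ext) simp
    have in_s: "?g w \<in> ob (strand F) s" if w: "w \<in> ob (strand F) t" for w
      unfolding obj_strand
    proof (intro allI impI)
      fix r assume "?g w r \<noteq> 0"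
      then have *: "cov (r + (t - s)) = cov t" "r + (t - s) \<in> tot F" using strand_supp[OF w] by auto
      then show "cov r = cov s \<and> r \<in> tot F" using same cov by blast
    qed
    show "\<forall>w\<in>ob (strand F) t. pth (strand F) s t (?g w) = w"
    proof (intro ballI ext)
      fix w :: "'k rfun" and u assume w: "w \<in> ob (strand F) t"
      show "pth (strand F) s t (?g w) u = w u" using ap[OF in_s[OF w], of "u - (t - s)"] by simp
    qed
    show "pth (strand F) s t ` ob (strand F) s \<subseteq> ob (strand F :: 'k rep) t"
      using pth_strand_in[OF F _ st] by blast
    show "?g ` ob (strand F) t \<subseteq> ob (strand F) s" using in_s by blast
  qed
qed

text \<open>A string depends on its interval only up to full turns.  This is what allows the intervals of a
  direct sum to be chosen disjoint, and as far apart as needed.\<close>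

lemma strand_shift:
  assumes "a < b"
  shows "is_iso (strand {(a, b)} :: 'k::field rep) (strand {(a + 2 * pi * of_int k, b + 2 * pi * of_int k)})
    (\<lambda>x v t. v (t - 2 * pi * of_int k))" (is "is_iso (strand ?F) (strand ?G) ?f")
  unfolding is_iso_def
proof (intro conjI allI)
  have F: "separated 0 ?F" "separated 0 ?G" using assms by (auto intro: separated_single)
  have cov: "cov (t - 2 * pi * of_int k) = cov t" for t
    using cov_shift[of "t - 2 * pi * of_int k" k] by simp
  have into: "?f x v \<in> obj (strand ?G) x" if "v \<in> obj (strand ?F) x" for x v
    using that unfolding obj_strand by (auto simp: tot_def cov)
  have unshift: "(\<lambda>t. w (t + 2 * pi * of_int k)) \<in> obj (strand ?F) x" if "w \<in> obj (strand ?G) x" for x w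
    using that unfolding obj_strand by (auto simp: tot_def)
  show "bij_betw (?f x) (obj (strand ?F) x) (obj (strand ?G) x)" for x
    by (rule bij_betw_byWitness[where f' = "\<lambda>w t. w (t + 2 * pi * of_int k)"]) (use into unshift in auto)
  show "rep_hom (strand ?F) (strand ?G) ?f"
  proof (rule rep_homI)
    show "linear_between (ob (strand ?F) s) (ob (strand ?G) s) (?f (cov s))" for s
      using into by (intro linear_betweenI) (auto simp: fun_eq_iff)
    fix s t and v :: "'k rfun" assume st: "s \<le> t" and v: "v \<in> ob (strand ?F) s"
    show "?f (cov t) (pth (strand ?F) s t v) = pth (strand ?G) s t (?f (cov s) v)"
    proof (rule ext)
      fix u
      have e: "u - 2 * pi * of_int k - (t - s) = u - (t - s) - 2 * pi * of_int k" by simp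
      show "?f (cov t) (pth (strand ?F) s t v) u = pth (strand ?G) s t (?f (cov s) v) u"
        unfolding pth_strand[OF F(1) v st] pth_strand[OF F(2) into[OF v] st] cov e
        by (auto simp: same_def)
    qed
  qed
qed

text \<open>Enlarging the intervals to the left gives a larger direct sum of strings, with the old one as a
  subrepresentation; enlarging them to the right gives one with the old one as a quotient.\<close>

lemma strand_inclusion:
  assumes J: "separated 0 J" and F: "separated 0 F"
    and FJ: "\<And>p. p \<in> F \<Longrightarrow> \<exists>q\<in>J. snd q = snd p \<and> fst q \<le> fst p"
  shows "rep_hom (strand F) (strand J) (\<lambda>x (v :: 'k::field rfun). v)"
proof (rule rep_homI)
  have sub: "v \<in> obj (strand J) x" if "v \<in> obj (strand F) x" for v :: "'k rfun" and x
  proof -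
    have "tot F \<subseteq> tot J"
    proof
      fix t assume "t \<in> tot F"
      then obtain p where p: "p \<in> F" "fst p < t" "t \<le> snd p" by (rule totE)
      obtain q where q: "q \<in> J" "snd q = snd p" "fst q \<le> fst p" using FJ[OF p(1)] by blast
      show "t \<in> tot J" by (rule totI[OF q(1)]) (use p q in auto)
    qed
    then show ?thesis using that unfolding obj_strand by blast
  qed
  show "linear_between (ob (strand F) s) (ob (strand J) s) (\<lambda>v :: 'k rfun. v)" for s
    using sub by (intro linear_betweenI) auto
  fix s t and v :: "'k rfun" assume st: "s \<le> t" and v: "v \<in> ob (strand F) s"
  show "pth (strand F) s t v = pth (strand J) s t v"
  proof (rule ext)
    fix u
    define s' where "s' = u - (t - s)"
    have le: "s' \<le> u" using st by (simp add: s'_def)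
    have "same F s' u \<longleftrightarrow> same J s' u" if nz: "v s' \<noteq> 0"
    proof
      assume "same F s' u"
      then obtain p where p: "p \<in> F" "fst p < s'" "u \<le> snd p" unfolding same_def by blast
      obtain q where q: "q \<in> J" "snd q = snd p" "fst q \<le> fst p" using FJ[OF p(1)] by blast
      show "same J s' u" using p q unfolding same_def by (intro bexI[of _ q]) auto
    next
      assume "same J s' u"
      then obtain q where q: "q \<in> J" "fst q < s'" "u \<le> snd q" unfolding same_def by blast
      have "s' \<in> tot F" using strand_supp[OF v nz] by blast
      then obtain p where p: "p \<in> F" "fst p < s'" "s' \<le> snd p" by (rule totE)
      obtain q' where q': "q' \<in> J" "snd q' = snd p" "fst q' \<le> fst p" using FJ[OF p(1)] by blast
      have "q = q'" by (rule separated_unique[OF J q(1) q'(1), of s']) (use q q' p le in auto)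
      then show "same F s' u" using p q q' unfolding same_def by (intro bexI[of _ p]) auto
    qed
    then show "pth (strand F) s t v u = pth (strand J) s t v u"
      unfolding pth_strand[OF F v st] pth_strand[OF J sub[OF v] st] s'_def[symmetric] by auto
  qed
qed

lemma strand_restriction:
  assumes P: "separated 0 P" and F: "separated 0 F"
    and FP: "\<And>p. p \<in> F \<Longrightarrow> \<exists>q\<in>P. fst q = fst p \<and> snd p \<le> snd q"
  shows "rep_hom (strand P) (strand F) (\<lambda>x (v :: 'k::field rfun) t. if t \<in> tot F then v t else 0)"
    (is "rep_hom _ _ ?r")
proof (rule rep_homI)
  have rin: "?r x v \<in> obj (strand F) x" if "v \<in> obj (strand P) x" for x v
    using that unfolding obj_strand by auto
  show "linear_between (ob (strand P) s) (ob (strand F) s) (?r (cov s))" for s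
    using rin by (intro linear_betweenI) (auto simp: fun_eq_iff)
  fix s t and v :: "'k rfun" assume st: "s \<le> t" and v: "v \<in> ob (strand P) s"
  show "?r (cov t) (pth (strand P) s t v) = pth (strand F) s t (?r (cov s) v)"
  proof (rule ext)
    fix u
    define s' where "s' = u - (t - s)"
    have le: "s' \<le> u" using st by (simp add: s'_def)
    have "u \<in> tot F \<and> same P s' u \<longleftrightarrow> same F s' u \<and> s' \<in> tot F"
    proof
      assume a: "u \<in> tot F \<and> same P s' u"
      then obtain p where p: "p \<in> F" "fst p < u" "u \<le> snd p" by (auto elim: totE)
      obtain q where q: "q \<in> P" "fst q < s'" "u \<le> snd q" using a unfolding same_def by blast
      obtain q' where q': "q' \<in> P" "fst q' = fst p" "snd p \<le> snd q'" using FP[OF p(1)] by blast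
      have "q = q'" by (rule separated_unique[OF P q(1) q'(1), of u]) (use q q' p le in auto)
      then have "fst p < s'" using q q' by simp
      then show "same F s' u \<and> s' \<in> tot F" using p le by (auto simp: same_def intro: totI)
    next
      assume "same F s' u \<and> s' \<in> tot F"
      then obtain p where p: "p \<in> F" "fst p < s'" "u \<le> snd p" unfolding same_def by blast
      obtain q' where q': "q' \<in> P" "fst q' = fst p" "snd p \<le> snd q'" using FP[OF p(1)] by blast
      have "u \<in> tot F" using p le by (intro totI[of p]) auto
      moreover have "same P s' u" using p q' unfolding same_def by (intro bexI[of _ q']) auto
      ultimately show "u \<in> tot F \<and> same P s' u" by blast
    qed
    then show "?r (cov t) (pth (strand P) s t v) u = pth (strand F) s t (?r (cov s) v) u"
      unfolding pth_strand[OF F rin[OF v] st] pth_strand[OF P v st] s'_def[symmetric]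
      by auto
  qed
qed

lemma subset_inclusion:
  "separated 0 F \<Longrightarrow> G \<subseteq> F \<Longrightarrow> rep_hom (strand G) (strand F) (\<lambda>x (v :: 'k::field rfun). v)"
  by (rule strand_inclusion[OF _ separated_subset]) auto

lemma pth_strand_subset:
  assumes F: "separated 0 F" and G: "G \<subseteq> F" and v: "v \<in> ob (strand G) s"
  shows "pth (strand F) s t v = pth (strand G) s t v"
  using rep_hom_pth[OF subset_inclusion[OF F G] v, of t] by simp

section \<open>Splitting a representation along its strings\<close>

lemma rep_hom_sum:
  "rep_hom M N f \<Longrightarrow> is_rep M \<Longrightarrow> (\<And>i. i \<in> I \<Longrightarrow> g i \<in> obj M x) \<Longrightarrow>
   f x (\<Sum>i\<in>I. g i) = (\<Sum>i\<in>I. f x (g i))"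
  by (rule linear_between_sum[OF rep_hom_linear is_rep_subspace])

text \<open>The preimage in \<open>M\<close> of the subrepresentation \<open>strand G\<close> of \<open>strand F\<close>, where \<open>f\<close> is an isomorphism
  from \<open>M\<close> to \<open>strand F\<close>.\<close>

definition part :: "'k::field rep \<Rightarrow> 'k nat_trans \<Rightarrow> (real \<times> real) set \<Rightarrow> circle \<Rightarrow> 'k rfun set" where
  "part M f G x = {v \<in> obj M x. f x v \<in> obj (strand G) x}"

lemma obj_strand_mono: "G \<subseteq> F \<Longrightarrow> v \<in> obj (strand G) x \<Longrightarrow> v \<in> obj (strand F) x"
  unfolding obj_strand tot_def by blast

lemma part_subrep:
  assumes M: "is_rep (M :: 'k::field rep)" and incl: "rep_hom (strand G) (strand F) (\<lambda>x (v :: 'k rfun). v)" and f: "is_iso M (strand F) f"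
    and G: "separated 0 G"
  shows "subrep M (part M f G)"
proof (rule subrepI)
  show "rf.subspace (part M f G x)" for x
  proof (rule rf.subspaceI)
    note sM = is_rep_subspace[OF M, of x] and sG = subspace_strand[of G x]
      and lin = rep_hom_linear[OF is_iso_hom[OF f], of x]
    show "0 \<in> part M f G x"
      using rf.subspace_0[OF sM] rf.subspace_0[OF sG] rep_hom_0[OF is_iso_hom[OF f] M, of x]
      by (simp add: part_def)
    show "v + w \<in> part M f G x" if "v \<in> part M f G x" "w \<in> part M f G x" for v w
      using that rf.subspace_add[OF sM, of v w] rf.subspace_add[OF sG, of "f x v" "f x w"]
        linear_between_add[OF lin, of v w] unfolding part_def by simp
    show "rscale c v \<in> part M f G x" if "v \<in> part M f G x" for c v
      using that rf.subspace_scale[OF sM, of v c] rf.subspace_scale[OF sG, of "f x v" c]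
        linear_between_scale[OF lin, of v c] unfolding part_def by simp
  qed
  show "part M f G x \<subseteq> obj M x" for x by (auto simp: part_def)
  show "pth M s t v \<in> part M f G (cov t)" if "s \<le> t" "v \<in> part M f G (cov s)" for s t v
  proof -
    have v: "v \<in> ob M s" "f (cov s) v \<in> ob (strand G) s" using that by (auto simp: part_def)
    have "f (cov t) (pth M s t v) = pth (strand G) s t (f (cov s) v)"
      using rep_hom_pth[OF is_iso_hom[OF f] v(1)] rep_hom_pth[OF incl v(2), of t] by simp
    then show ?thesis
      using pth_in[OF M v(1)] pth_strand_in[OF G v(2) that(1)] by (simp add: part_def)
  qed
qed

lemma part_iso:
  assumes incl: "rep_hom (strand G) (strand F) (\<lambda>x (v :: 'k::field rfun). v)"
    and f: "is_iso (M :: 'k rep) (strand F) f"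
  shows "is_iso (restrict_rep M (part M f G)) (strand G) f"
  unfolding is_iso_def
proof (intro conjI allI)
  show "rep_hom (restrict_rep M (part M f G)) (strand G) f"
  proof (rule rep_homI)
    show "linear_between (ob (restrict_rep M (part M f G)) s) (ob (strand G) s) (f (cov s))" for s
      using rep_hom_linear[OF is_iso_hom[OF f], of "cov s"]
      by (auto simp: part_def linear_between_def)
    fix s t and v :: "'k rfun" assume "s \<le> t" "v \<in> ob (restrict_rep M (part M f G)) s"
    then show "f (cov t) (pth (restrict_rep M (part M f G)) s t v) = pth (strand G) s t (f (cov s) v)"
      using rep_hom_pth[OF is_iso_hom[OF f], of v s t] rep_hom_pth[OF incl, of "f (cov s) v" s t]
      by (auto simp: part_def)
  qed
  fix x
  have sub: "v \<in> obj (strand F) x" if "v \<in> obj (strand G) x" for v :: "'k rfun"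
    using rep_hom_in[OF incl that] .
  show "bij_betw (f x) (obj (restrict_rep M (part M f G)) x) (obj (strand G) x)"
    using is_iso_inj[OF f] iso_inv_in[OF f sub] iso_inv_right[OF f sub]
    by (intro bij_betw_byWitness[where f' = "iso_inv M f x"])
      (auto simp: part_def iso_inv_left[OF f])
qed

lemma part_subrep_subset:
  "is_rep M \<Longrightarrow> separated 0 F \<Longrightarrow> G \<subseteq> F \<Longrightarrow> is_iso M (strand F) f \<Longrightarrow> subrep M (part M f G)"
  by (rule part_subrep[OF _ subset_inclusion _ separated_subset])

lemma part_iso_subset:
  "separated 0 F \<Longrightarrow> G \<subseteq> F \<Longrightarrow> is_iso M (strand F) f \<Longrightarrow>
   is_iso (restrict_rep M (part M f G)) (strand G) f"
  by (rule part_iso[OF subset_inclusion])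

lemma part_direct_sum:
  assumes M: "is_rep M" and F: "separated 0 F" and f: "is_iso M (strand F) f"
    and I: "finite I" and N: "\<And>i. i \<in> I \<Longrightarrow> N i = part M f (G i)" and G: "\<And>i. i \<in> I \<Longrightarrow> G i \<subseteq> F"
    and disj: "\<And>i j. i \<in> I \<Longrightarrow> j \<in> I \<Longrightarrow> i \<noteq> j \<Longrightarrow> G i \<inter> G j = {}"
    and cover: "F \<subseteq> (\<Union>i\<in>I. G i)"
  shows "direct_sum M I N"
  unfolding direct_sum_def
proof (intro conjI ballI allI)
  show "subrep M (N i)" if "i \<in> I" for i using part_subrep_subset[OF M F G f] N that by simp
  fix x v assume v: "v \<in> obj M x"
  have tdisj: "t \<notin> tot (G j)" if ti: "t \<in> tot (G i)" "i \<in> I" "j \<in> I" "i \<noteq> j" for t i j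
  proof
    assume "t \<in> tot (G j)"
    then obtain q where q: "q \<in> G j" "fst q < t" "t \<le> snd q" by (rule totE)
    obtain p where p: "p \<in> G i" "fst p < t" "t \<le> snd p" using ti(1) by (rule totE)
    have "p = q" using separated_unique[OF F, of p q t] p q G ti by blast
    then show False using disj[OF ti(2-4)] p q by blast
  qed
  define c where "c i = (if i \<in> I then iso_inv M f x (\<lambda>t. if t \<in> tot (G i) then f x v t else 0) else 0)" for i
  let ?P = "\<lambda>c. (\<forall>i\<in>I. c i \<in> N i x) \<and> (\<forall>i. i \<notin> I \<longrightarrow> c i = 0) \<and> finite {i. c i \<noteq> 0} \<and>
      v = (\<Sum>i | c i \<noteq> 0. c i)"
  have fv: "f x v \<in> obj (strand F) x" using rep_hom_in[OF is_iso_hom[OF f] v] .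
  have rin: "(\<lambda>t. if t \<in> tot (G i) then f x v t else 0) \<in> obj (strand (G i)) x" if "i \<in> I" for i
    using fv that by (auto simp: obj_strand)
  have fc: "f x (c i) = (\<lambda>t. if t \<in> tot (G i) then f x v t else 0)" if "i \<in> I" for i
    unfolding c_def using iso_inv_right[OF f obj_strand_mono[OF G[OF that] rin[OF that]]] that by simp
  have cin: "c i \<in> N i x" if "i \<in> I" for i
    using iso_inv_in[OF f obj_strand_mono[OF G[OF that] rin[OF that]]] rin[OF that] fc[OF that] that N
    by (simp add: part_def c_def)
  have csum: "(\<Sum>i | d i \<noteq> 0. d i) = (\<Sum>i\<in>I. d i)" if "\<forall>i. i \<notin> I \<longrightarrow> d i = 0" for d :: "'b \<Rightarrow> 'a rfun"
    using that I by (intro sum.mono_neutral_left) auto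
  show "\<exists>!c. ?P c"
  proof (rule ex1I)
    have c0: "\<forall>i. i \<notin> I \<longrightarrow> c i = 0" by (simp add: c_def)
    have "{i. c i \<noteq> 0} \<subseteq> I" using c0 by blast
    then have fin: "finite {i. c i \<noteq> 0}" using I by (rule finite_subset)
    have cM: "c i \<in> obj M x" if "i \<in> I" for i using cin[OF that] N[OF that] by (simp add: part_def)
    have "f x (\<Sum>i\<in>I. c i) = f x v"
    proof (rule ext)
      fix t
      have "f x (\<Sum>i\<in>I. c i) t = (\<Sum>i\<in>I. if t \<in> tot (G i) then f x v t else 0)"
        using rep_hom_sum[OF is_iso_hom[OF f] M, of I c x] cM fc by (simp add: sum_rfun_apply)
      also have "\<dots> = f x v t"
      proof (cases "f x v t = 0")
        case False
        then have "t \<in> tot F" using strand_supp[OF fv] by blast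
        then obtain p where p: "p \<in> F" "fst p < t" "t \<le> snd p" by (rule totE)
        then obtain i where i: "i \<in> I" "p \<in> G i" using cover by blast
        then have i: "i \<in> I" "t \<in> tot (G i)" using totI p by blast+
        have "(\<Sum>i\<in>I. if t \<in> tot (G i) then f x v t else 0) = (\<Sum>j\<in>I. if j = i then f x v t else 0)"
          using tdisj i by (intro sum.cong) auto
        then show ?thesis using i I by simp
      next
        case True
        then show ?thesis by (intro trans[OF sum.neutral]) auto
      qed
      finally show "f x (\<Sum>i\<in>I. c i) t = f x v t" .
    qed
    then have "v = (\<Sum>i\<in>I. c i)"
      by (intro is_iso_inj[OF f v]) (use cM rf.subspace_sum[OF is_rep_subspace[OF M]] in auto)
    then show "?P c" using cin c0 fin csum[OF c0] by simp
  next
    fix d assume d: "?P d"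
    have dM: "d i \<in> obj M x" "f x (d i) \<in> obj (strand (G i)) x" if "i \<in> I" for i
      using d N that by (auto simp: part_def)
    have vd: "v = (\<Sum>i\<in>I. d i)" using csum[of d] d by simp
    have fd: "f x v t = (\<Sum>i\<in>I. f x (d i) t)" for t
      unfolding vd using rep_hom_sum[OF is_iso_hom[OF f] M, of I d x] dM(1) by (simp add: sum_rfun_apply)
    show "d = c"
    proof (rule ext)
      fix i
      show "d i = c i"
      proof (cases "i \<in> I")
        case True
        have "f x (d i) = f x (c i)"
        proof (rule ext)
          fix t
          show "f x (d i) t = f x (c i) t"
          proof (cases "t \<in> tot (G i)")
            case t: True
            have "(\<Sum>j\<in>I. f x (d j) t) = (\<Sum>j\<in>I. if j = i then f x (d i) t else 0)"
              using tdisj[OF t True] dM(2) by (intro sum.cong) (auto simp: obj_strand)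
            then show ?thesis using fd[of t] fc[OF True] t True I by simp
          next
            case False
            then show ?thesis using fc[OF True] dM(2)[OF True] by (auto simp: obj_strand)
          qed
        qed
        moreover have "c i \<in> obj M x" using cin[OF True] N[OF True] by (simp add: part_def)
        ultimately show ?thesis using is_iso_inj[OF f dM(1)[OF True]] by blast
      next
        case False
        then show ?thesis using d by (simp add: c_def)
      qed
    qed
  qed
qed

section \<open>Components of a direct sum\<close>

definition decomposition ::
  "'i set \<Rightarrow> ('i \<Rightarrow> circle \<Rightarrow> 'k::field rfun set) \<Rightarrow> circle \<Rightarrow> 'k rfun \<Rightarrow> ('i \<Rightarrow> 'k rfun) \<Rightarrow> bool" where
  "decomposition I N x v c \<longleftrightarrow>
     (\<forall>i\<in>I. c i \<in> N i x) \<and> (\<forall>i. i \<notin> I \<longrightarrow> c i = 0) \<and> finite {i. c i \<noteq> 0} \<and>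
     v = (\<Sum>i | c i \<noteq> 0. c i)"

definition component ::
  "'i set \<Rightarrow> ('i \<Rightarrow> circle \<Rightarrow> 'k::field rfun set) \<Rightarrow> 'i \<Rightarrow> circle \<Rightarrow> 'k rfun \<Rightarrow> 'k rfun" where
  "component I N i x v = (THE c. decomposition I N x v c) i"

lemma sum_support: "finite S \<Longrightarrow> (\<And>i. c i \<noteq> 0 \<Longrightarrow> i \<in> S) \<Longrightarrow> (\<Sum>i | c i \<noteq> 0. c i) = (\<Sum>i\<in>S. c i)"
  by (intro sum.mono_neutral_left) auto

lemma decompositionI:
  assumes "\<And>i. i \<in> I \<Longrightarrow> c i \<in> N i x" "\<And>i. i \<notin> I \<Longrightarrow> c i = 0" "finite S"
    "\<And>i. c i \<noteq> 0 \<Longrightarrow> i \<in> S" "v = (\<Sum>i\<in>S. c i)"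
  shows "decomposition I N x v c"
  unfolding decomposition_def
proof (intro conjI)
  show "finite {i. c i \<noteq> 0}" by (rule finite_subset[OF _ assms(3)]) (use assms(4) in blast)
  show "v = (\<Sum>i | c i \<noteq> 0. c i)" using sum_support[of S c] assms(3-5) by simp
qed (use assms(1,2) in auto)

locale direct_sum_rep =
  fixes M :: "'k::field rep" and I :: "'i set" and N :: "'i \<Rightarrow> circle \<Rightarrow> 'k rfun set"
  assumes rep: "is_rep M" and sum: "direct_sum M I N"
begin

lemma summand_subrep: "i \<in> I \<Longrightarrow> subrep M (N i)"
  using sum by (simp add: direct_sum_def)

lemma summand_subspace: "i \<in> I \<Longrightarrow> rf.subspace (N i x)"
  using subrep_subspace[OF summand_subrep] .

lemma summand_sub: "i \<in> I \<Longrightarrow> v \<in> N i x \<Longrightarrow> v \<in> obj M x"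
  using subrep_sub[OF summand_subrep] by blast

lemma decomposition_ex1: "v \<in> obj M x \<Longrightarrow> \<exists>!c. decomposition I N x v c"
  using sum unfolding direct_sum_def decomposition_def by blast

lemma decomposition_component:
  "v \<in> obj M x \<Longrightarrow> decomposition I N x v (\<lambda>i. component I N i x v)"
  unfolding component_def by (rule theI'[OF decomposition_ex1])

lemma component_unique:
  "v \<in> obj M x \<Longrightarrow> decomposition I N x v c \<Longrightarrow> component I N i x v = c i"
  unfolding component_def using the1_equality[OF decomposition_ex1] by metis

lemma component_in: "v \<in> obj M x \<Longrightarrow> i \<in> I \<Longrightarrow> component I N i x v \<in> N i x"
  using decomposition_component unfolding decomposition_def by blast

lemma component_finite: "v \<in> obj M x \<Longrightarrow> finite {i. component I N i x v \<noteq> 0}"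
  using decomposition_component unfolding decomposition_def by blast

lemma component_outside: "v \<in> obj M x \<Longrightarrow> component I N i x v \<noteq> 0 \<Longrightarrow> i \<in> I"
  using decomposition_component[of v x] unfolding decomposition_def by blast

lemma component_sum: "v \<in> obj M x \<Longrightarrow> v = (\<Sum>i | component I N i x v \<noteq> 0. component I N i x v)"
  using decomposition_component unfolding decomposition_def by blast

lemma component_self: "i \<in> I \<Longrightarrow> v \<in> N i x \<Longrightarrow> component I N i x v = v"
proof -
  assume i: "i \<in> I" and v: "v \<in> N i x"
  have "decomposition I N x v (\<lambda>j. if j = i then v else 0)"
    by (rule decompositionI[of _ _ _ _ "{i}"])
      (use i v rf.subspace_0[OF summand_subspace] in \<open>auto split: if_splits\<close>)
  from component_unique[OF summand_sub[OF i v] this, of i] show ?thesis by simp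
qed

lemma component_linear:
  assumes i: "i \<in> I"
  shows "linear_between (obj M x) (N i x) (component I N i x)"
proof (rule linear_betweenI)
  fix v w assume v: "v \<in> obj M x" and w: "w \<in> obj M x"
  let ?S = "{j. component I N j x v \<noteq> 0} \<union> {j. component I N j x w \<noteq> 0}"
  have S: "finite ?S" using component_finite v w by blast
  have "decomposition I N x (v + w) (\<lambda>j. component I N j x v + component I N j x w)"
  proof (rule decompositionI[OF _ _ S])
    show "v + w = (\<Sum>j\<in>?S. component I N j x v + component I N j x w)"
      using component_sum[OF v] component_sum[OF w]
        sum_support[OF S, of "\<lambda>j. component I N j x v"] sum_support[OF S, of "\<lambda>j. component I N j x w"]
      by (simp add: sum.distrib)
    show "component I N j x v + component I N j x w \<in> N j x" if "j \<in> I" for j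
      using rf.subspace_add[OF summand_subspace[OF that]] component_in v w that by blast
    show "component I N j x v + component I N j x w = 0" if "j \<notin> I" for j
      using component_outside[OF v, of j] component_outside[OF w, of j] that by force
    show "j \<in> ?S" if "component I N j x v + component I N j x w \<noteq> 0" for j
    proof (rule ccontr)
      assume "j \<notin> ?S"
      then have "component I N j x v = 0" "component I N j x w = 0" by auto
      then show False using that by simp
    qed
  qed
  with v w show "component I N i x (v + w) = component I N i x v + component I N i x w"
    by (intro component_unique rf.subspace_add[OF is_rep_subspace[OF rep]])
next
  fix v c assume v: "v \<in> obj M x"
  let ?S = "{j. component I N j x v \<noteq> 0}"
  have "decomposition I N x (rscale c v) (\<lambda>j. rscale c (component I N j x v))"
  proof (rule decompositionI[OF _ _ component_finite[OF v]])
    have "rscale c v = rscale c (\<Sum>j\<in>?S. component I N j x v)" using component_sum[OF v] by simp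
    then show "rscale c v = (\<Sum>j\<in>?S. rscale c (component I N j x v))"
      by (simp only: rf.scale_sum_right)
    show "rscale c (component I N j x v) \<in> N j x" if "j \<in> I" for j
      using rf.subspace_scale[OF summand_subspace[OF that]] component_in v that by blast
    show "rscale c (component I N j x v) = 0" if "j \<notin> I" for j
      using component_outside[OF v, of j] that rf.scale_zero_right by metis
    show "j \<in> ?S" if "rscale c (component I N j x v) \<noteq> 0" for j
      using that rf.scale_zero_right by force
  qed
  with v show "component I N i x (rscale c v) = rscale c (component I N i x v)"
    by (intro component_unique rf.subspace_scale[OF is_rep_subspace[OF rep]])
qed (use component_in i in blast)

lemma component_pth:
  assumes i: "i \<in> I" and v: "v \<in> ob M s"
  shows "component I N i (cov t) (pth M s t v) = pth M s t (component I N i (cov s) v)"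
proof -
  let ?S = "{j. component I N j (cov s) v \<noteq> 0}"
  have fin: "finite ?S" by (rule component_finite[OF v])
  have cI: "component I N j (cov s) v \<in> ob M s" if "j \<in> ?S" for j
    using component_outside[OF v] component_in[OF v] summand_sub that by blast
  have "decomposition I N (cov t) (pth M s t v) (\<lambda>j. pth M s t (component I N j (cov s) v))"
  proof (rule decompositionI[OF _ _ fin])
    have "pth M s t v = pth M s t (\<Sum>j\<in>?S. component I N j (cov s) v)"
      using component_sum[OF v] by simp
    also have "\<dots> = (\<Sum>j\<in>?S. pth M s t (component I N j (cov s) v))"
      by (rule linear_between_sum[OF pth_linear[OF rep] is_rep_subspace[OF rep] cI])
    finally show "pth M s t v = (\<Sum>j\<in>?S. pth M s t (component I N j (cov s) v))" .
    show "pth M s t (component I N j (cov s) v) \<in> N j (cov t)" if "j \<in> I" for j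
      using subrep_pth[OF summand_subrep[OF that] component_in[OF v that]] .
    show "pth M s t (component I N j (cov s) v) = 0" if "j \<notin> I" for j
    proof -
      have "component I N j (cov s) v = 0" using component_outside[OF v, of j] that by blast
      then show ?thesis using pth_0[OF rep] by simp
    qed
    show "j \<in> ?S" if "pth M s t (component I N j (cov s) v) \<noteq> 0" for j
      using that pth_0[OF rep, of s t] by force
  qed
  from component_unique[OF pth_in[OF rep v] this] show ?thesis .
qed

lemma summand_bij_path:
  assumes i: "i \<in> I" and bij: "bij_path M s t"
  shows "bij_path (restrict_rep M (N i)) s t"
  unfolding bij_path_def bij_betw_def
proof
  show "inj_on (pth (restrict_rep M (N i)) s t) (ob (restrict_rep M (N i)) s)"
    using bij subrep_sub[OF summand_subrep[OF i]]
    by (auto simp: bij_path_def bij_betw_def intro: inj_on_subset)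
  show "pth (restrict_rep M (N i)) s t ` ob (restrict_rep M (N i)) s = ob (restrict_rep M (N i)) t"
  proof (intro equalityI subsetI)
    fix v assume "v \<in> ob (restrict_rep M (N i)) t"
    then have v: "v \<in> N i (cov t)" "v \<in> ob M t" using summand_sub[OF i] by auto
    then obtain u where u: "u \<in> ob M s" "v = pth M s t u"
      using bij unfolding bij_path_def bij_betw_def by blast
    have "v = pth M s t (component I N i (cov s) u)"
      using component_self[OF i v(1)] component_pth[OF i u(1), of t] u(2) by simp
    then show "v \<in> pth (restrict_rep M (N i)) s t ` ob (restrict_rep M (N i)) s"
      using component_in[OF u(1) i] by auto
  qed (use subrep_pth[OF summand_subrep[OF i]] in auto)
qed

text \<open>A choice of nonzero vectors, one from each of the nonzero summands, is linearly independent.\<close>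

lemma finite_nonzero_summands:
  assumes B: "finite B" "obj M x = rf.span B"
  shows "finite {i \<in> I. N i x \<noteq> {0}}"
proof -
  let ?S = "{i \<in> I. N i x \<noteq> {0}}"
  have "\<forall>i\<in>?S. \<exists>v. v \<in> N i x \<and> v \<noteq> 0"
    using rf.subspace_0[OF summand_subspace[of _ x]] by blast
  from bchoice[OF this] obtain v where "\<forall>i\<in>?S. v i \<in> N i x \<and> v i \<noteq> 0" by blast
  then have v: "\<And>i. i \<in> ?S \<Longrightarrow> v i \<in> N i x" "\<And>i. i \<in> ?S \<Longrightarrow> v i \<noteq> 0" by blast+
  have inj: "inj_on v ?S"
  proof (rule inj_onI)
    fix i j assume ij: "i \<in> ?S" "j \<in> ?S" "v i = v j"
    have "decomposition I N x (v j) (\<lambda>l. if l = j then v j else 0)"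
      by (rule decompositionI[of _ _ _ _ "{j}"])
        (use ij v rf.subspace_0[OF summand_subspace] in \<open>auto split: if_splits\<close>)
    moreover have "v j \<in> obj M x" using summand_sub v ij by blast
    ultimately have c: "component I N i x (v j) = (if i = j then v j else 0)"
      by (rule component_unique[rotated])
    have "v i = component I N i x (v i)"
      by (rule component_self[symmetric]) (use ij(1) v(1)[OF ij(1)] in blast)+
    also have "\<dots> = (if i = j then v j else 0)" using c by (simp only: ij(3))
    finally have "v i = (if i = j then v j else 0)" .
    then show "i = j" using v(2)[OF ij(1)] by (cases "i = j") auto
  qed
  have "rf.independent (v ` ?S)"
    unfolding rf.dependent_explicit
  proof (rule notI, elim exE conjE)
    fix t u assume t: "finite t" "t \<subseteq> v ` ?S" "(\<Sum>w\<in>t. rscale (u w) w) = 0" "\<exists>w\<in>t. u w \<noteq> 0"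
    obtain T where sub: "T \<subseteq> ?S" "t = v ` T" using t(2) by (rule subset_imageE)
    note vT = sub(2)[symmetric] inj_on_subset[OF inj sub(1)] sub(1)
    have finT: "finite T" using t(1) vT(1,2) by (metis finite_imageD)
    define c where "c i = (if i \<in> T then rscale (u (v i)) (v i) else 0)" for i
    have "decomposition I N x 0 c"
    proof (rule decompositionI[OF _ _ finT])
      have "(\<Sum>i\<in>T. c i) = (\<Sum>i\<in>T. rscale (u (v i)) (v i))" by (intro sum.cong) (auto simp: c_def)
      also have "\<dots> = (\<Sum>w\<in>v ` T. rscale (u w) w)" using sum.reindex[OF vT(2), of "\<lambda>w. rscale (u w) w"] by simp
      finally show "0 = (\<Sum>i\<in>T. c i)" using t(3) vT(1) by simp
      show "c i \<in> N i x" if "i \<in> I" for i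
      proof (cases "i \<in> T")
        case True
        then have "v i \<in> N i x" using v(1) vT(3) by blast
        then show ?thesis
          using True rf.subspace_scale[OF summand_subspace[OF that]] by (simp add: c_def)
      qed (simp add: c_def rf.subspace_0[OF summand_subspace[OF that]])
    qed (use vT(3) in \<open>auto simp: c_def split: if_splits\<close>)
    moreover have "decomposition I N x 0 (\<lambda>i. 0)"
      by (rule decompositionI[of _ _ _ _ "{}"]) (auto simp: rf.subspace_0[OF summand_subspace])
    moreover have "0 \<in> obj M x" using rf.subspace_0[OF is_rep_subspace[OF rep]] .
    ultimately have "c i = 0" for i using component_unique by metis
    moreover obtain i where i: "i \<in> T" "u (v i) \<noteq> 0" using t(4) vT(1) by blast
    ultimately have z: "rscale (u (v i)) (v i) = 0" unfolding c_def by metis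
    have "v i \<noteq> 0" by (rule v(2)[OF subsetD[OF vT(3) i(1)]])
    then show False using rf.scale_eq_0_iff[THEN iffD1, OF z] i(2) by blast
  qed
  moreover have "v ` ?S \<subseteq> rf.span B" using v(1) summand_sub B(2) by blast
  ultimately have "finite (v ` ?S)" using rf.independent_span_bound[OF B(1), of "v ` ?S"] by simp
  from finite_imageD[OF this inj] show ?thesis .
qed

end

section \<open>The objects of the category are finite direct sums of strings\<close>

lemma bij_path_iso:
  assumes f: "is_iso M N f" and M: "is_rep M"
  shows "bij_path M s t \<longleftrightarrow> bij_path N s t"
proof
  have b: "bij_betw (f (cov r)) (ob M r) (ob N r)" for r by (rule is_iso_bij[OF f])
  have bi: "bij_betw (iso_inv M f (cov r)) (ob N r) (ob M r)" for r
    by (rule is_iso_bij[OF is_iso_inv[OF f M]])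
  have p: "pth N s t (f (cov s) v) = f (cov t) (pth M s t v)" if "v \<in> ob M s" for v
    using rep_hom_pth[OF is_iso_hom[OF f] that] by simp
  show "bij_path N s t" if "bij_path M s t"
  proof -
    have "bij_betw (f (cov t) \<circ> (pth M s t \<circ> iso_inv M f (cov s))) (ob N s) (ob N t)"
      using that b[of t] bi[of s] by (auto simp: bij_path_def intro: bij_betw_trans)
    moreover have "(f (cov t) \<circ> (pth M s t \<circ> iso_inv M f (cov s))) w = pth N s t w" if "w \<in> ob N s" for w
      using p[OF iso_inv_in[OF f that]] iso_inv_right[OF f that] by simp
    ultimately show ?thesis unfolding bij_path_def using bij_betw_cong by blast
  qed
  show "bij_path M s t" if "bij_path N s t"
  proof -
    have "bij_betw (iso_inv M f (cov t) \<circ> (pth N s t \<circ> f (cov s))) (ob M s) (ob M t)"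
      using that bi[of t] b[of s] by (auto simp: bij_path_def intro: bij_betw_trans)
    moreover have "(iso_inv M f (cov t) \<circ> (pth N s t \<circ> f (cov s))) v = pth M s t v" if "v \<in> ob M s" for v
      using p[OF that] iso_inv_left[OF f pth_in[OF M that]] by simp
    ultimately show ?thesis unfolding bij_path_def using bij_betw_cong by blast
  qed
qed

lemma string_basis_vec: "t \<in> U \<Longrightarrow> basis_vec t \<in> ob (string U) t"
  unfolding string_def by (auto intro!: rf.span_base)

text \<open>If just one of \<open>s\<close> and \<open>t\<close> lies in \<open>U\<close>, then its basis vector is killed, or not reached, by the path.\<close>

lemma bij_path_string:
  assumes bij: "bij_path (string U :: 'k::field rep) s t" and st: "s \<le> t"
  shows "s \<in> U \<longleftrightarrow> t \<in> U"
proof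
  have ap: "pth (string U) s t v u = (if u \<in> U \<and> cov u = cov t then v (u - (t - s)) else 0)"
    for v :: "'k rfun" and u
    by (simp add: pth_def string_def ccw_turns[OF st])
  assume s: "s \<in> U"
  show "t \<in> U"
  proof (rule ccontr)
    assume t: "t \<notin> U"
    have "pth (string U) s t (basis_vec s :: 'k rfun) u = 0" for u
      unfolding ap using t by (auto simp: basis_vec_apply)
    moreover have "pth (string U) s t (0 :: 'k rfun) u = 0" for u
      unfolding ap by simp
    ultimately have "pth (string U) s t (basis_vec s :: 'k rfun) = pth (string U) s t 0"
      by (intro ext) simp
    moreover have "(0 :: 'k rfun) \<in> ob (string U) s" by (simp add: string_def rf.span_zero)
    ultimately have "(basis_vec s :: 'k rfun) = 0"
      using bij string_basis_vec[OF s] unfolding bij_path_def bij_betw_def by (blast dest: inj_onD)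
    then have "(basis_vec s :: 'k rfun) s = 0" by (simp only: zero_fun_apply)
    then show False by (simp add: basis_vec_apply)
  qed
next
  have ap: "pth (string U) s t v u = (if u \<in> U \<and> cov u = cov t then v (u - (t - s)) else 0)"
    for v :: "'k rfun" and u
    by (simp add: pth_def string_def ccw_turns[OF st])
  assume t: "t \<in> U"
  then obtain v :: "'k rfun" where v: "v \<in> ob (string U) s" "basis_vec t = pth (string U) s t v"
    using bij string_basis_vec[OF t] unfolding bij_path_def bij_betw_def by blast
  have "v s = basis_vec t t" unfolding v(2) ap using t by simp
  then have "v s \<noteq> 0" by (simp add: basis_vec_apply)
  moreover have "v \<in> rf.span (basis_vec ` (cov -` {cov s} \<inter> U))" using v(1) by (simp add: string_def)
  ultimately show "s \<in> U" using span_supp by blast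
qed

lemma strand_single_nonzero:
  assumes "a < b"
  shows "(basis_vec b :: 'k::field rfun) \<in> ob (strand {(a, b)}) b" "(basis_vec b :: 'k rfun) \<noteq> 0"
proof -
  show "(basis_vec b :: 'k rfun) \<in> ob (strand {(a, b)}) b"
    using assms by (intro basis_vec_in_strand) (simp add: tot_def)
  have "(basis_vec b :: 'k rfun) b \<noteq> 0 b" by (simp add: basis_vec_apply)
  then show "(basis_vec b :: 'k rfun) \<noteq> 0" by metis
qed

context circle_cells
begin

lemma cellwise_iso: "is_iso M N f \<Longrightarrow> is_rep M \<Longrightarrow> cellwise M \<longleftrightarrow> cellwise N"
  unfolding cellwise_def by (simp only: bij_path_iso[of M N f])

definition good :: "(real \<times> real) set \<Rightarrow> bool" where
  "good F \<longleftrightarrow> separated 0 F \<and> (\<forall>p\<in>F. fst p \<in> L \<and> snd p \<in> L \<and> snd p \<le> nx (fst p) + 2 * pi)"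

lemma good_separated: "good F \<Longrightarrow> separated 0 F"
  by (simp add: good_def)

lemma goodD: "good F \<Longrightarrow> p \<in> F \<Longrightarrow> fst p \<in> L \<and> snd p \<in> L \<and> snd p \<le> nx (fst p) + 2 * pi"
  by (simp add: good_def)

lemma good_subset: "good F \<Longrightarrow> G \<subseteq> F \<Longrightarrow> good G"
  unfolding good_def using separated_subset by blast

lemma good_single: "a \<in> L \<Longrightarrow> b \<in> L \<Longrightarrow> a < b \<Longrightarrow> b \<le> nx a + 2 * pi \<Longrightarrow> good {(a, b)}"
  by (simp add: good_def separated_single)

lemma L_not_Acc: "w \<in> L \<Longrightarrow> w \<notin> Acc"
proof
  assume w: "w \<in> L" "w \<in> Acc"
  then obtain i where i: "i \<in> {1..m}" "cov w = cov (\<theta> i)" by (auto simp: Acc_def)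
  have "\<theta> 1 \<le> \<theta> i" "\<theta> i < \<theta> (m + 1)" using i by (auto intro!: theta_le theta_less)
  then have "\<theta> i rmod (2 * pi) = \<theta> i" using theta_1 theta_last by (intro rmod_small) auto
  moreover have "\<theta> i \<in> L" using L_cong[OF i(2)] w(1) by simp
  ultimately have "\<theta> i \<in> Z" by (simp add: L_def)
  then obtain j where j: "j \<in> {1..m}" "\<theta> i \<in> Zs j" by (auto simp: Z_def)
  have b: "\<theta> j < \<theta> i" "\<theta> i < \<theta> (j + 1)" using Zs_bounds[OF j] by auto
  have "\<not> i \<le> j" using theta_le[of i j] i j b(1) by auto
  moreover have "\<not> j + 1 \<le> i" using theta_le[of "j + 1" i] i j b(2) by auto
  ultimately show False by simp
qed

text \<open>The shifts of \<open>c\<close> by full turns form a discrete set that does not contain \<open>a\<close>.\<close>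

lemma Acc_isolated_from:
  assumes a: "a \<in> Acc" and c: "c \<in> L"
  obtains e where "0 < e" "\<And>r. cov r = cov c \<Longrightarrow> e \<le> \<bar>r - a\<bar>"
proof -
  define d where "d = (c - a) rmod (2 * pi)"
  have d: "0 \<le> d" "d < 2 * pi" by (auto simp: d_def rmod_nonneg rmod_less)
  have "d = ccw (cov a) (cov c)" by (simp add: d_def ccw_cov)
  then have cad: "cov (a + d) = cov c"
    using cov_add_cong[of "ang (cov a)" a d] cov_ang_ccw[of "cov a" "cov c" 0] by simp
  have "d \<noteq> 0"
  proof
    assume "d = 0"
    then have "a \<in> L" using cad L_cong[of a c] c by simp
    then show False using L_not_Acc a by blast
  qed
  show ?thesis
  proof (rule that[of "min d (2 * pi - d)"])
    show "0 < min d (2 * pi - d)" using d \<open>d \<noteq> 0\<close> by simp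
    fix r assume "cov r = cov c"
    then obtain k :: int where k: "r = a + d + 2 * pi * of_int k" using cad cov_eq_iff by metis
    show "min d (2 * pi - d) \<le> \<bar>r - a\<bar>"
    proof (cases "0 \<le> k")
      case True
      then have "0 \<le> 2 * pi * (of_int k :: real)" by simp
      then show ?thesis using k d by simp
    next
      case False
      then have "2 * pi * (of_int (k + 1) :: real) \<le> 0" by (intro mult_nonneg_nonpos) auto
      then have "2 * pi * (of_int k :: real) \<le> - (2 * pi)" by (simp add: algebra_simps)
      then show ?thesis using k d by simp
    qed
  qed
qed

text \<open>A cell lies completely inside or completely outside of an interval with ends in \<open>L\<close>, and an
  accumulation point keeps a positive distance from the shifts of the finitely many ends.\<close>

lemma cellwise_strand:
  assumes F: "good F"
  shows "cellwise (strand F)"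
  unfolding cellwise_def
proof (intro conjI ballI allI impI)
  fix w s t assume w: "w \<in> L" and st: "w < s \<and> s \<le> t \<and> t \<le> nx w"
  show "bij_path (strand F) s t"
  proof (rule bij_path_strand[OF good_separated[OF F]])
    show "s \<le> t" using st by simp
    fix r p assume "cov r = cov s" and p: "p \<in> F"
    then obtain k :: int where "s = r + 2 * pi * of_int k" using cov_eq_iff by blast
    then have r: "r = s + 2 * pi * of_int (- k)" by simp
    define w' where "w' = w + 2 * pi * of_int (- k)"
    have w': "w' \<in> L" "nx w' = nx w + 2 * pi * of_int (- k)"
      using w L_shift nx_shift unfolding w'_def by blast+
    have rw: "w' < r" "r \<le> r + (t - s)" "r + (t - s) \<le> nx w'" using st r w' by (auto simp: w'_def)
    have dich: "c \<le> w' \<or> nx w' \<le> c" if "c \<in> L" for c using nx_le[OF w'(1) that] by linarith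
    show "fst p < r \<and> r \<le> snd p \<longleftrightarrow> fst p < r + (t - s) \<and> r + (t - s) \<le> snd p"
      using dich[of "fst p"] dich[of "snd p"] goodD[OF F p] rw by linarith
  qed
next
  fix a assume a: "a \<in> Acc"
  let ?E = "fst ` F \<union> snd ` F"
  have finE: "finite ?E" using separated_finite[OF good_separated[OF F]] by simp
  have EL: "?E \<subseteq> L" using goodD[OF F] by blast
  have "\<exists>e>0. \<forall>c\<in>E. \<forall>r. cov r = cov c \<longrightarrow> e \<le> \<bar>r - a\<bar>" if "finite E" "E \<subseteq> L" for E
    using that
  proof (induction E)
    case empty
    show ?case by (intro exI[of _ 1]) simp
  next
    case (insert c E)
    then obtain e where e: "0 < e" "\<forall>c\<in>E. \<forall>r. cov r = cov c \<longrightarrow> e \<le> \<bar>r - a\<bar>" by auto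
    obtain e' where e': "0 < e'" "\<And>r. cov r = cov c \<Longrightarrow> e' \<le> \<bar>r - a\<bar>"
      using Acc_isolated_from[OF a, of c] insert.prems by blast
    show ?case
    proof (intro exI[of _ "min e e'"] conjI ballI allI impI)
      fix c' r assume "c' \<in> insert c E" "cov r = cov c'"
      then have "e \<le> \<bar>r - a\<bar> \<or> e' \<le> \<bar>r - a\<bar>" using e e' by blast
      then show "min e e' \<le> \<bar>r - a\<bar>" by linarith
    qed (use e e' in simp)
  qed
  from this[OF finE EL] obtain e where e: "0 < e" "\<And>c r. c \<in> ?E \<Longrightarrow> cov r = cov c \<Longrightarrow> e \<le> \<bar>r - a\<bar>"
    by blast
  show "\<exists>e>0. \<forall>s t. a - e < s \<and> s \<le> t \<and> t < a + e \<longrightarrow> bij_path (strand F) s t"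
  proof (intro exI[of _ e] conjI allI impI)
    fix s t assume st: "a - e < s \<and> s \<le> t \<and> t < a + e"
    show "bij_path (strand F) s t"
    proof (rule bij_path_strand[OF good_separated[OF F]])
      fix r p assume "cov r = cov s" and p: "p \<in> F"
      then obtain k :: int where k: "s = r + 2 * pi * of_int k" using cov_eq_iff by blast
      have dich: "c + 2 * pi * of_int k \<le> a - e \<or> a + e \<le> c + 2 * pi * of_int k" if "c \<in> ?E" for c
        using e(2)[OF that, of "c + 2 * pi * of_int k"] by (simp add: abs_le_iff) linarith
      have "fst p \<in> ?E" "snd p \<in> ?E" using p by auto
      then show "fst p < r \<and> r \<le> snd p \<longleftrightarrow> fst p < r + (t - s) \<and> r + (t - s) \<le> snd p"
        using dich[of "fst p"] dich[of "snd p"] st k by linarith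
    qed (use st in simp)
  qed (rule e(1))
qed

text \<open>Objects of \<open>C\<close> are killed by the paths of the line that start at a point of \<open>L\<close> and end one
  cell and one full turn later: a string on which such a path acts nontrivially would start before
  that point and be longer than \<open>\<kappa>\<close> permits.  This is the form in which the bound \<open>\<kappa>\<close> is used.\<close>

definition nilpotent :: "'k::field rep \<Rightarrow> bool" where
  "nilpotent M \<longleftrightarrow> (\<forall>a\<in>L. \<forall>v\<in>ob M a. pth M a (nx a + 2 * pi) v = 0)"

lemma nilpotent_strand:
  assumes F: "good F" and M: "is_rep M" and f: "is_iso M (strand F) f"
  shows "nilpotent M"
  unfolding nilpotent_def
proof (intro ballI)
  fix a v assume a: "a \<in> L" and v: "v \<in> ob M a"
  let ?t = "nx a + 2 * pi"
  have at: "a \<le> ?t" using nx_gt[OF a] pi_gt_zero by linarith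
  have fv: "f (cov a) v \<in> ob (strand F) a" by (rule rep_hom_in[OF is_iso_hom[OF f] v])
  have "f (cov ?t) (pth M a ?t v) u = 0" for u
  proof -
    have "\<not> (cov u = cov ?t \<and> same F (u - (?t - a)) u)" if "f (cov a) v (u - (?t - a)) \<noteq> 0"
    proof
      assume u: "cov u = cov ?t \<and> same F (u - (?t - a)) u"
      then obtain p where p: "p \<in> F" "fst p < u - (?t - a)" "u \<le> snd p" unfolding same_def by blast
      define a' where "a' = u - (?t - a)"
      have "cov a' = cov a" using u cov_diff_cong[of u ?t "?t - a"] by (simp add: a'_def)
      then have a': "a' \<in> L" "nx a' + 2 * pi = u"
        using L_cong[of a' a] nx_cong[of a a'] a by (auto simp: a'_def)
      have "nx (fst p) \<le> a'" using nx_le[of "fst p" a'] goodD[OF F p(1)] a' p(2) by (simp add: a'_def)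
      then show False using goodD[OF F p(1)] p(3) a' nx_gt[OF a'(1)] by linarith
    qed
    then show ?thesis
      using rep_hom_pth[OF is_iso_hom[OF f] v, of ?t] pth_strand[OF good_separated[OF F] fv at, of u] by auto
  qed
  then have "f (cov ?t) (pth M a ?t v) = f (cov ?t) 0"
    using rep_hom_0[OF is_iso_hom[OF f] M] by (intro ext) simp
  then show "pth M a ?t v = 0" by (rule is_iso_inj[OF f pth_in[OF M v] ob_zero[OF M]])
qed

text \<open>The summands of \<open>M\<close> are the preimages of the single strings of \<open>F\<close>, which are pairwise distinct
  because each contains the basis vector at the end of its own interval only.\<close>

lemma C_intro:
  assumes M: "is_rep M" and f: "is_iso M (strand F) f" and F: "good F"
  shows "C (M :: 'k::field rep)"
  unfolding C_iff Rep_kappa_def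
proof (intro conjI)
  have F0: "separated 0 F" by (rule good_separated[OF F])
  show "is_rep M" by (rule M)
  show "cellwise M" using cellwise_iso[OF f M] cellwise_strand[OF F] by simp
  show "pointwise_finite M"
    unfolding pointwise_finite_def
  proof (intro allI exI conjI)
    fix x
    let ?B = "(\<lambda>t. iso_inv M f x (basis_vec t)) ` pts F x"
    have fin: "finite (pts F x)" by (rule finite_pts[OF separated_finite[OF F0]])
    have bv: "basis_vec t \<in> obj (strand F) x" if "t \<in> pts F x" for t
      using that basis_vec_in_strand[of t F] by (auto simp: pts_def)
    show "finite ?B" using fin by simp
    show "obj M x = rf.span ?B"
    proof (intro equalityI subsetI)
      fix v assume v: "v \<in> obj M x"
      have fv: "f x v \<in> obj (strand F) x" by (rule rep_hom_in[OF is_iso_hom[OF f] v])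
      have g: "rep_hom (strand F) M (iso_inv M f)" by (rule is_iso_hom[OF is_iso_inv[OF f M]])
      have "f x v = (\<Sum>t\<in>pts F x. rscale (f x v t) (basis_vec t))"
        using strand_supp[OF fv] by (intro expand_finite[OF fin]) (auto simp: pts_def)
      then have "iso_inv M f x (f x v) = iso_inv M f x (\<Sum>t\<in>pts F x. rscale (f x v t) (basis_vec t))"
        by simp
      also have "\<dots> = (\<Sum>t\<in>pts F x. iso_inv M f x (rscale (f x v t) (basis_vec t)))"
        using bv rf.subspace_scale[OF subspace_strand] by (intro rep_hom_sum[OF g is_rep_strand[OF F0]]) blast
      also have "\<dots> = (\<Sum>t\<in>pts F x. rscale (f x v t) (iso_inv M f x (basis_vec t)))"
        by (intro sum.cong refl linear_between_scale[OF rep_hom_linear[OF g] bv])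
      also have "\<dots> \<in> rf.span ?B" by (intro rf.span_sum rf.span_scale rf.span_base) auto
      finally show "v \<in> rf.span ?B" using iso_inv_left[OF f v] by simp
    next
      fix v assume "v \<in> rf.span ?B"
      moreover have "rf.span ?B \<subseteq> obj M x"
        using iso_inv_in[OF f bv] by (intro rf.span_minimal is_rep_subspace[OF M]) auto
      ultimately show "v \<in> obj M x" by blast
    qed
  qed
  define P where "P p = part M f {p}" for p
  have inj: "inj_on P F"
  proof (rule inj_onI)
    fix p q assume pq: "p \<in> F" "q \<in> F" "P p = P q"
    let ?b = "snd p" let ?e = "basis_vec (snd p) :: 'k rfun"
    have lt: "fst p < ?b" by (rule separated_less[OF F0 pq(1)])
    have e: "?e \<in> ob (strand F) ?b" "?e \<in> ob (strand {p}) ?b"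
      using lt pq by (auto intro!: basis_vec_in_strand simp: tot_def)
    have "iso_inv M f (cov ?b) ?e \<in> P p (cov ?b)"
      using iso_inv_in[OF f e(1)] iso_inv_right[OF f e(1)] e(2) by (simp add: P_def part_def)
    then have "iso_inv M f (cov ?b) ?e \<in> P q (cov ?b)" by (simp only: pq(3))
    then have "?e \<in> ob (strand {q}) ?b"
      using iso_inv_right[OF f e(1)] by (simp add: P_def part_def)
    then have "?b \<in> tot {q}" using strand_supp[of ?e "{q}" "cov ?b" ?b] by (simp add: basis_vec_apply)
    then have "fst q < ?b" "?b \<le> snd q" by (auto simp: tot_def)
    then show "p = q" by (intro separated_unique[OF F0 pq(1,2), of ?b]) (use lt in auto)
  qed
  define G where "G X = {inv_into F P X}" for X
  have G: "inv_into F P X \<in> F" "P (inv_into F P X) = X" if "X \<in> P ` F" for X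
    using that by (auto simp: inv_into_into f_inv_into_f)
  show "\<exists>\<N>. direct_sum M \<N> (\<lambda>N. N) \<and> (\<forall>N\<in>\<N>. \<exists>U. U \<noteq> {} \<and> bounded U \<and> is_interval U \<and>
      U \<subseteq> {Inf U..Inf U + kappa Z (Inf U)} \<and> rep_iso (restrict_rep M N) (string U))"
  proof (intro exI[of _ "P ` F"] conjI ballI)
    show "direct_sum M (P ` F) (\<lambda>N. N)"
    proof (rule part_direct_sum[OF M F0 f, where G = G])
      show "finite (P ` F)" using separated_finite[OF F0] by simp
      show "X = part M f (G X)" if "X \<in> P ` F" for X using G(2)[OF that] by (simp add: P_def G_def)
      show "G X \<subseteq> F" if "X \<in> P ` F" for X using G(1)[OF that] by (simp add: G_def)
      show "G X \<inter> G Y = {}" if "X \<in> P ` F" "Y \<in> P ` F" "X \<noteq> Y" for X Y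
        using G(2)[OF that(1)] G(2)[OF that(2)] that(3) by (auto simp: G_def)
      show "F \<subseteq> (\<Union>X\<in>P ` F. G X)" using inv_into_f_f[OF inj] by (auto simp: G_def)
    qed
    fix X assume "X \<in> P ` F"
    then obtain p where p: "p \<in> F" "X = part M f {p}" by (auto simp: P_def)
    let ?U = "{fst p<..snd p}"
    have lt: "fst p < snd p" by (rule separated_less[OF F0 p(1)])
    have "is_iso (restrict_rep M X) (strand {p}) f" unfolding p(2) by (rule part_iso_subset[OF F0 _ f]) (use p in simp)
    then have "rep_iso (restrict_rep M X) (string ?U)"
      unfolding rep_iso_iff string_eq_strand by auto
    moreover have "Inf ?U = fst p" using lt by simp
    moreover have "fst p + kappa Z (fst p) = nx (fst p) + 2 * pi" using kappa_L goodD[OF F p(1)] by blast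
    ultimately show "\<exists>U. U \<noteq> {} \<and> bounded U \<and> is_interval U \<and>
      U \<subseteq> {Inf U..Inf U + kappa Z (Inf U)} \<and> rep_iso (restrict_rep M X) (string U)"
      using lt goodD[OF F p(1)] by (intro exI[of _ ?U] conjI) (auto simp: is_interval_1)
  qed
qed

lemma C_strand: "good F \<Longrightarrow> C (strand F)"
  by (rule C_intro[OF is_rep_strand is_iso_id]) (auto intro: good_separated)

text \<open>The summand inherits constancy, so that its interval is a union of cells.\<close>

lemma summand_string:
  assumes iso: "rep_iso R (string U)" and R: "is_rep (R :: 'k::field rep)" "cellwise R"
    and U: "U \<noteq> {}" "bounded U" "is_interval U" "U \<subseteq> {Inf U..Inf U + kappa Z (Inf U)}"
  obtains u e g where "u \<in> L" "e \<in> L" "u < e" "e \<le> nx u + 2 * pi" "is_iso R (strand {(u, e)}) g"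
proof -
  obtain g where g: "is_iso R (string U) g" using iso rep_iso_iff by blast
  have cw: "cellwise (string U :: 'k rep)" using cellwise_iso[OF g R(1)] R(2) by simp
  obtain u e where ue: "u \<in> L" "e \<in> L" "u < e" "U = {u<..e}"
  proof (rule saturated_interval[OF U(1-3)])
    show "s \<in> U \<longleftrightarrow> t \<in> U" if "w \<in> L" "w < s" "s \<le> t" "t \<le> nx w" for w s t
      using cw that unfolding cellwise_def by (intro bij_path_string) auto
    show "\<exists>d>0. \<forall>s t. a - d < s \<and> s \<le> t \<and> t < a + d \<longrightarrow> (s \<in> U \<longleftrightarrow> t \<in> U)" if "a \<in> Acc" for a
    proof -
      have "\<exists>d>0. \<forall>s t. a - d < s \<and> s \<le> t \<and> t < a + d \<longrightarrow> bij_path (string U :: 'k rep) s t"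
        using cw that unfolding cellwise_def by blast
      then obtain d where d: "0 < d"
        "\<And>s t. a - d < s \<Longrightarrow> s \<le> t \<Longrightarrow> t < a + d \<Longrightarrow> bij_path (string U :: 'k rep) s t" by auto
      show ?thesis
        by (intro exI[of _ d] conjI allI impI) (use d bij_path_string[OF d(2)] in auto)
    qed
  qed
  have "Inf U = u" using ue by simp
  moreover have "e \<in> U" using ue by simp
  ultimately have "e \<le> u + kappa Z u" using U(4) by auto
  then have "e \<le> nx u + 2 * pi" using kappa_L[OF ue(1)] by simp
  then show ?thesis using that ue g by (simp add: string_eq_strand)
qed

lemma C_rep: "C M \<Longrightarrow> is_rep M"
  by (simp add: C_iff Rep_kappa_def)

lemma C_cellwise: "C M \<Longrightarrow> cellwise M"
  by (simp add: C_iff)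

lemma cell_bij: "cellwise M \<Longrightarrow> w \<in> L \<Longrightarrow> w < s \<Longrightarrow> s \<le> t \<Longrightarrow> t \<le> nx w \<Longrightarrow> bij_path M s t"
  unfolding cellwise_def by blast

lemma acc_bij:
  "cellwise M \<Longrightarrow> a \<in> Acc \<Longrightarrow> \<exists>e>0. \<forall>s t. a - e < s \<and> s \<le> t \<and> t < a + e \<longrightarrow> bij_path M s t"
  unfolding cellwise_def by (rule bspec[OF conjunct2])

lemma bij_path_inj:
  "bij_path M s t \<Longrightarrow> v \<in> ob M s \<Longrightarrow> w \<in> ob M s \<Longrightarrow> pth M s t v = pth M s t w \<Longrightarrow> v = w"
  unfolding bij_path_def bij_betw_def by (blast dest: inj_onD)

lemma bij_path_surj:
  assumes "bij_path M s t" "v \<in> ob M t"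
  obtains u where "u \<in> ob M s" "v = pth M s t u"
  using assms unfolding bij_path_def bij_betw_def by blast

lemma bij_path_zero:
  "bij_path M s t \<Longrightarrow> is_rep M \<Longrightarrow> v \<in> ob M s \<Longrightarrow> pth M s t v = 0 \<Longrightarrow> v = 0"
  using bij_path_inj[of M s t v 0] ob_zero[of M s] pth_0[of M s t] by simp

text \<open>A summand can only appear at a point of \<open>L\<close>, since elsewhere a representation of \<open>C\<close> is
  locally constant; bisection over one turn therefore bounds their number.\<close>

lemma finite_summands:
  assumes M: "is_rep M" "pointwise_finite M" "cellwise M" and sum: "direct_sum M \<N> (\<lambda>N. N)"
    and nz: "\<And>N. N \<in> \<N> \<Longrightarrow> \<exists>x. N x \<noteq> {0}"
  shows "finite \<N>"
proof -
  interpret direct_sum_rep M \<N> "\<lambda>N. N" by unfold_locales (fact M sum)+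
  have fin: "finite {N \<in> \<N>. N x \<noteq> {0}}" for x
  proof -
    obtain B where "finite B" "obj M x = rf.span B" using M(2) unfolding pointwise_finite_def by blast
    then show ?thesis by (rule finite_nonzero_summands)
  qed
  have propag: "N (cov t) \<noteq> {0}" if N: "N \<in> \<N>" and b: "bij_path M r t" and n: "N (cov r) \<noteq> {0}" for N r t
  proof
    assume z: "N (cov t) = {0}"
    have bN: "bij_path (restrict_rep M N) r t" by (rule summand_bij_path[OF N b])
    have rN: "is_rep (restrict_rep M N)" by (rule is_rep_restrict[OF M(1) summand_subrep[OF N]])
    have "v = 0" if "v \<in> N (cov r)" for v
    proof (rule bij_path_zero[OF bN rN])
      show "v \<in> ob (restrict_rep M N) r" using that by simp
      then show "pth (restrict_rep M N) r t v = 0" using pth_in[OF rN, of v r t] z by simp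
    qed
    then show False using n rf.subspace_0[OF summand_subspace[OF N, of "cov r"]] by blast
  qed
  let ?S = "\<lambda>s t. {N \<in> \<N>. \<exists>r. s \<le> r \<and> r \<le> t \<and> N (cov r) \<noteq> {0}}"
  have "0 \<le> 2 * pi" by simp
  then have "finite (?S 0 (2 * pi))"
  proof (induction rule: cell_induct[where R = "\<lambda>s t. finite (?S s t)"])
    case (trans r s t)
    have "?S r t \<subseteq> ?S r s \<union> ?S s t"
    proof
      fix N assume "N \<in> ?S r t"
      then obtain q where "N \<in> \<N>" "r \<le> q" "q \<le> t" "N (cov q) \<noteq> {0}" by blast
      then show "N \<in> ?S r s \<union> ?S s t" by (cases "q \<le> s") auto
    qed
    then show ?case by (rule finite_subset) (use trans in simp)
  next
    case (cell w s t)
    have "?S s t \<subseteq> {N \<in> \<N>. N (cov t) \<noteq> {0}}"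
    proof
      fix N assume "N \<in> ?S s t"
      then obtain q where q: "N \<in> \<N>" "s \<le> q" "q \<le> t" "N (cov q) \<noteq> {0}" by blast
      have "bij_path M q t" by (rule cell_bij[OF M(3) cell(1)]) (use q cell in auto)
      then show "N \<in> {N \<in> \<N>. N (cov t) \<noteq> {0}}" using propag[OF q(1) _ q(4)] q(1) by simp
    qed
    then show ?case by (rule finite_subset) (rule fin)
  next
    case (cross w t)
    have "?S w t \<subseteq> {N \<in> \<N>. N (cov w) \<noteq> {0}} \<union> {N \<in> \<N>. N (cov t) \<noteq> {0}}"
    proof
      fix N assume "N \<in> ?S w t"
      then obtain q where q: "N \<in> \<N>" "w \<le> q" "q \<le> t" "N (cov q) \<noteq> {0}" by blast
      show "N \<in> {N \<in> \<N>. N (cov w) \<noteq> {0}} \<union> {N \<in> \<N>. N (cov t) \<noteq> {0}}"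
      proof (cases "q = w")
        case False
        have "bij_path M q t" by (rule cell_bij[OF M(3) cross(1)]) (use q cross False in auto)
        then show ?thesis using propag[OF q(1) _ q(4)] q(1) by simp
      next
        case True
        then have "N (cov w) \<noteq> {0}" using q(4) by simp
        then show ?thesis using q(1) by blast
      qed
    qed
    then show ?case by (rule finite_subset) (simp add: fin)
  next
    case (acc a)
    obtain e where e: "0 < e" "\<forall>s t. a - e < s \<and> s \<le> t \<and> t < a + e \<longrightarrow> bij_path M s t"
      using acc_bij[OF M(3) acc] by blast
    show ?case
    proof (intro exI[of _ e] conjI allI impI)
      fix s t assume st: "a - e < s \<and> s \<le> t \<and> t < a + e"
      have "?S s t \<subseteq> {N \<in> \<N>. N (cov t) \<noteq> {0}}"
      proof
        fix N assume "N \<in> ?S s t"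
        then obtain q where q: "N \<in> \<N>" "s \<le> q" "q \<le> t" "N (cov q) \<noteq> {0}" by blast
        have "bij_path M q t" by (rule e(2)[rule_format]) (use q st in auto)
        then show "N \<in> {N \<in> \<N>. N (cov t) \<noteq> {0}}" using propag[OF q(1) _ q(4)] q(1) by simp
      qed
      then show "finite (?S s t)" by (rule finite_subset) (rule fin)
    qed (rule e(1))
  qed
  moreover have "\<N> \<subseteq> ?S 0 (2 * pi)"
  proof
    fix N assume N: "N \<in> \<N>"
    from nz[OF N] obtain x where x: "N x \<noteq> {0}" by (rule exE)
    have "ang x \<in> {0..<2 * pi}" by (rule ang)
    then have "0 \<le> ang x" "ang x \<le> 2 * pi" "N (cov (ang x)) \<noteq> {0}" using x by auto
    then have "\<exists>r. 0 \<le> r \<and> r \<le> 2 * pi \<and> N (cov r) \<noteq> {0}" by (intro exI conjI)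
    with N show "N \<in> ?S 0 (2 * pi)" by (intro CollectI conjI)
  qed
  ultimately show ?thesis by (rule rev_finite_subset)
qed

text \<open>Shifting the strings of a decomposition by multiples of four turns places them into
  pairwise disjoint blocks of the line, with room for extending each of them by one turn.\<close>

theorem C_decompose:
  assumes CM: "C (M :: 'k::field rep)"
  obtains F f where "separated (2 * pi) F" "good F" "is_iso M (strand F) f"
proof -
  have M: "is_rep M" "pointwise_finite M" "cellwise M"
    using CM by (auto simp: C_iff Rep_kappa_def)
  obtain \<N> where sum: "direct_sum M \<N> (\<lambda>N. N)" and str: "\<And>N. N \<in> \<N> \<Longrightarrow> \<exists>U. U \<noteq> {} \<and> bounded U \<and>
      is_interval U \<and> U \<subseteq> {Inf U..Inf U + kappa Z (Inf U)} \<and> rep_iso (restrict_rep M N) (string U)"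
    using CM unfolding C_iff Rep_kappa_def by blast
  interpret direct_sum_rep M \<N> "\<lambda>N. N" by unfold_locales (fact M sum)+
  have rN: "is_rep (restrict_rep M N)" if "N \<in> \<N>" for N
    by (rule is_rep_restrict[OF M(1) summand_subrep[OF that]])
  have cN: "cellwise (restrict_rep M N)" if "N \<in> \<N>" for N
    using M(3) summand_bij_path[OF that] unfolding cellwise_def by meson
  let ?Q = "\<lambda>N q. fst (fst q) \<in> L \<and> snd (fst q) \<in> L \<and> fst (fst q) < snd (fst q) \<and>
    snd (fst q) \<le> nx (fst (fst q)) + 2 * pi \<and> is_iso (restrict_rep M N) (strand {fst q}) (snd q)"
  have "\<forall>N\<in>\<N>. \<exists>q. ?Q N q"
  proof
    fix N assume N: "N \<in> \<N>"
    from str[OF N] obtain U where U: "U \<noteq> {}" "bounded U" "is_interval U"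
      "U \<subseteq> {Inf U..Inf U + kappa Z (Inf U)}" "rep_iso (restrict_rep M N) (string U)" by blast
    obtain u e g where "u \<in> L" "e \<in> L" "u < e" "e \<le> nx u + 2 * pi"
      "is_iso (restrict_rep M N) (strand {(u, e)}) g"
      using summand_string[OF U(5) rN[OF N] cN[OF N] U(1-4)] .
    then show "\<exists>q. ?Q N q" by (intro exI[of _ "((u, e), g)"]) simp
  qed
  from bchoice[OF this] obtain q where q: "\<forall>N\<in>\<N>. ?Q N (q N)" by blast
  define u e g where "u N = fst (fst (q N))" and "e N = snd (fst (q N))" and "g N = snd (q N)" for N
  have ueg: "u N \<in> L" "e N \<in> L" "u N < e N" "e N \<le> nx (u N) + 2 * pi"
    "is_iso (restrict_rep M N) (strand {(u N, e N)}) (g N)" if "N \<in> \<N>" for N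
    using q that by (auto simp: u_def e_def g_def)
  have fin: "finite \<N>"
  proof (rule finite_summands[OF M sum])
    fix N assume N: "N \<in> \<N>"
    let ?e = "basis_vec (e N) :: 'k rfun" and ?x = "cov (e N)"
    note nz = strand_single_nonzero[OF ueg(3)[OF N], where 'k = 'k]
    have "iso_inv (restrict_rep M N) (g N) ?x ?e \<in> N ?x"
      using iso_inv_in[OF ueg(5)[OF N] nz(1)] by simp
    moreover have "iso_inv (restrict_rep M N) (g N) ?x ?e \<noteq> 0"
    proof
      assume "iso_inv (restrict_rep M N) (g N) ?x ?e = 0"
      then have "?e = 0"
        using iso_inv_right[OF ueg(5)[OF N] nz(1)] rep_hom_0[OF is_iso_hom[OF ueg(5)[OF N]] rN[OF N], of ?x]
        by simp
      then show False using nz(2) by blast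
    qed
    ultimately show "\<exists>x. N x \<noteq> {0}" by blast
  qed
  obtain idx :: "(circle \<Rightarrow> 'k rfun set) \<Rightarrow> nat" where idx: "inj_on idx \<N>"
    using finite_imp_inj_to_nat_seg[OF fin] by blast
  \<comment> \<open>The interval at \<open>u\<close> has length less than two turns, so that blocks of four turns leave a gap.\<close>
  define k where "k N = 4 * int (idx N) - \<lfloor>u N / (2 * pi)\<rfloor>" for N
  define a b where "a N = u N + 2 * pi * of_int (k N)" and "b N = e N + 2 * pi * of_int (k N)" for N
  define h where "h N = hom_comp (\<lambda>x v t. v (t - 2 * pi * of_int (k N))) (g N)" for N
  have ab: "a N \<in> L" "b N \<in> L" "a N < b N" "b N \<le> nx (a N) + 2 * pi" if "N \<in> \<N>" for N
    using ueg[OF that] L_shift nx_shift[of "u N" "k N"] by (auto simp: a_def b_def)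
  have h: "is_iso (restrict_rep M N) (strand {(a N, b N)}) (h N)" if "N \<in> \<N>" for N
    unfolding h_def a_def b_def
    by (rule is_iso_comp[OF ueg(5)[OF that] strand_shift[OF ueg(3)[OF that]]])
  have pos: "8 * pi * real (idx N) \<le> a N" "a N < 8 * pi * real (idx N) + 2 * pi" for N
  proof -
    have "of_int \<lfloor>u N / (2 * pi)\<rfloor> * (2 * pi) \<le> u N" by (rule floor_divide_lower) simp
    moreover have "u N < (of_int \<lfloor>u N / (2 * pi)\<rfloor> + 1) * (2 * pi)" by (rule floor_divide_upper) simp
    moreover have "a N = u N - of_int \<lfloor>u N / (2 * pi)\<rfloor> * (2 * pi) + 8 * pi * real (idx N)"
      by (simp add: a_def k_def algebra_simps)
    ultimately show "8 * pi * real (idx N) \<le> a N" "a N < 8 * pi * real (idx N) + 2 * pi"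
      by (simp_all add: algebra_simps)
  qed
  have before: "b N + 2 * pi \<le> a N'" if N: "N \<in> \<N>" "idx N < idx N'" for N N'
  proof -
    have "b N < 8 * pi * real (idx N) + 6 * pi"
      using ab(4)[OF N(1)] nx_lt[OF ab(1)[OF N(1)]] pos(2)[of N] by linarith
    moreover have "8 * pi * (real (idx N) + 1) \<le> 8 * pi * real (idx N')"
      using N(2) by (intro mult_left_mono) auto
    ultimately show ?thesis using pos(1)[of N'] by (simp add: algebra_simps)
  qed
  define F where "F = (\<lambda>N. (a N, b N)) ` \<N>"
  have sep: "separated (2 * pi) F"
    unfolding separated_def
  proof (intro conjI ballI impI)
    show "finite F" using fin by (simp add: F_def)
    show "fst p < snd p" if "p \<in> F" for p using that ab(3) by (auto simp: F_def)
    fix p p' assume "p \<in> F" "p' \<in> F" "p \<noteq> p'"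
    then obtain N N' where N: "N \<in> \<N>" "N' \<in> \<N>" "p = (a N, b N)" "p' = (a N', b N')" "N \<noteq> N'"
      by (auto simp: F_def)
    then have "idx N \<noteq> idx N'" using inj_onD[OF idx] by blast
    then consider "idx N < idx N'" | "idx N' < idx N" by linarith
    then show "snd p + 2 * pi \<le> fst p' \<or> snd p' + 2 * pi \<le> fst p"
      using before[OF N(1), of N'] before[OF N(2), of N] N(3,4) by cases auto
  qed
  have F0: "separated 0 F" by (rule separated_mono[OF sep]) simp
  have gd: "good F" unfolding good_def using F0 ab by (auto simp: F_def)
  have uniq: "N = N'" if "N \<in> \<N>" "N' \<in> \<N>" "a N < t" "t \<le> b N" "a N' < t" "t \<le> b N'" for N N' t
  proof (rule ccontr)
    assume "N \<noteq> N'"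
    then have "idx N \<noteq> idx N'" using inj_onD[OF idx] that by blast
    then consider "idx N < idx N'" | "idx N' < idx N" by linarith
    then show False
      using before[OF that(1), of N'] before[OF that(2), of N] that pi_gt_zero by cases auto
  qed
  have GF: "{(a N, b N)} \<subseteq> F" if "N \<in> \<N>" for N using that by (auto simp: F_def)
  define c where "c N x v = component \<N> (\<lambda>N. N) N x v" for N x v
  define \<Phi> where "\<Phi> x v = (\<Sum>N\<in>\<N>. h N x (c N x v))" for x v
  have cin: "c N x v \<in> N x" if "v \<in> obj M x" "N \<in> \<N>" for N x v
    unfolding c_def by (rule component_in[OF that])
  have hin: "h N x w \<in> obj (strand {(a N, b N)}) x" if "w \<in> N x" "N \<in> \<N>" for N x w
    using rep_hom_in[OF is_iso_hom[OF h[OF that(2)]], of w x] that(1) by simp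
  have ev: "(\<Sum>N\<in>\<N>. w N) t = w N t"
    if w: "\<And>N. N \<in> \<N> \<Longrightarrow> w N \<in> obj (strand {(a N, b N)}) x" and N: "N \<in> \<N>" "a N < t" "t \<le> b N"
    for w :: "(circle \<Rightarrow> 'k rfun set) \<Rightarrow> 'k rfun" and x N t
  proof -
    have "w N' t = 0" if "N' \<in> \<N>" "N' \<noteq> N" for N'
    proof (rule ccontr)
      assume "w N' t \<noteq> 0"
      then have "a N' < t" "t \<le> b N'" using strand_supp[OF w[OF that(1)]] by (auto simp: tot_def)
      then show False using uniq[OF that(1) N(1)] N(2,3) that(2) by blast
    qed
    then have "(\<Sum>N'\<in>\<N>. w N' t) = (\<Sum>N'\<in>\<N>. if N' = N then w N t else 0)"
      by (intro sum.cong) auto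
    then show ?thesis using N(1) fin by (simp add: sum_rfun_apply)
  qed
  have \<Phi>in: "\<Phi> x v \<in> obj (strand F) x" if "v \<in> obj M x" for x v
    unfolding \<Phi>_def
  proof (rule rf.subspace_sum[OF subspace_strand])
    fix N assume N: "N \<in> \<N>"
    show "h N x (c N x v) \<in> obj (strand F) x"
      by (rule obj_strand_mono[OF GF[OF N] hin[OF cin[OF that N] N]])
  qed
  have lin: "linear_between (obj M x) (obj (strand F) x) (\<Phi> x)" for x
  proof (rule linear_betweenI)
    fix v w assume v: "v \<in> obj M x" and w: "w \<in> obj M x"
    have "h N x (c N x (v + w)) = h N x (c N x v) + h N x (c N x w)" if N: "N \<in> \<N>" for N
    proof -
      have "c N x (v + w) = c N x v + c N x w"
        unfolding c_def by (rule linear_between_add[OF component_linear[OF N] v w])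
      moreover have "c N x v \<in> obj (restrict_rep M N) x" "c N x w \<in> obj (restrict_rep M N) x"
        using cin N v w by auto
      ultimately show ?thesis using linear_between_add[OF rep_hom_linear[OF is_iso_hom[OF h[OF N]]]] by simp
    qed
    then show "\<Phi> x (v + w) = \<Phi> x v + \<Phi> x w" unfolding \<Phi>_def by (simp add: sum.distrib)
  next
    fix r v assume v: "v \<in> obj M x"
    have "h N x (c N x (rscale r v)) = rscale r (h N x (c N x v))" if N: "N \<in> \<N>" for N
    proof -
      have "c N x (rscale r v) = rscale r (c N x v)"
        unfolding c_def by (rule linear_between_scale[OF component_linear[OF N] v])
      moreover have "c N x v \<in> obj (restrict_rep M N) x" using cin N v by auto
      ultimately show ?thesis using linear_between_scale[OF rep_hom_linear[OF is_iso_hom[OF h[OF N]]]] by simp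
    qed
    then show "\<Phi> x (rscale r v) = rscale r (\<Phi> x v)"
      unfolding \<Phi>_def by (simp only: rf.scale_sum_right cong: sum.cong)
  qed (rule \<Phi>in)
  have hom: "rep_hom M (strand F) \<Phi>"
  proof (rule rep_homI[OF lin])
    fix s t v assume st: "s \<le> t" and v: "v \<in> ob M s"
    have "h N (cov t) (c N (cov t) (pth M s t v)) = pth (strand F) s t (h N (cov s) (c N (cov s) v))"
      if N: "N \<in> \<N>" for N
    proof -
      have "c N (cov s) v \<in> ob (restrict_rep M N) s" using cin N v by auto
      moreover have "c N (cov t) (pth M s t v) = pth (restrict_rep M N) s t (c N (cov s) v)"
        unfolding c_def using component_pth[OF N v] by simp
      ultimately have "h N (cov t) (c N (cov t) (pth M s t v)) =
          pth (strand {(a N, b N)}) s t (h N (cov s) (c N (cov s) v))"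
        using rep_hom_pth[OF is_iso_hom[OF h[OF N]]] by simp
      then show ?thesis using pth_strand_subset[OF F0 GF[OF N] hin[OF cin[OF v N] N]] by simp
    qed
    then have "\<Phi> (cov t) (pth M s t v) = (\<Sum>N\<in>\<N>. pth (strand F) s t (h N (cov s) (c N (cov s) v)))"
      unfolding \<Phi>_def by (simp cong: sum.cong)
    also have "\<dots> = pth (strand F) s t (\<Phi> (cov s) v)"
      unfolding \<Phi>_def
      by (rule linear_between_sum[OF pth_linear[OF is_rep_strand[OF F0]] subspace_strand, symmetric])
        (rule obj_strand_mono[OF GF hin[OF cin[OF v]]])
    finally show "\<Phi> (cov t) (pth M s t v) = pth (strand F) s t (\<Phi> (cov s) v)" .
  qed
  have "bij_betw (\<Phi> x) (obj M x) (obj (strand F) x)" for x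
    unfolding bij_betw_def
  proof
    show "inj_on (\<Phi> x) (obj M x)"
    proof (rule linear_between_inj_onI[OF lin is_rep_subspace[OF M(1)]])
      fix v assume v: "v \<in> obj M x" "\<Phi> x v = 0"
      have "c N x v = 0" if N: "N \<in> \<N>" for N
      proof -
        have hi: "h N' x (c N' x v) \<in> obj (strand {(a N', b N')}) x" if "N' \<in> \<N>" for N'
          by (rule hin[OF cin[OF v(1) that] that])
        have "h N x (c N x v) t = 0" for t
        proof (rule ccontr)
          assume nz: "h N x (c N x v) t \<noteq> 0"
          then have "a N < t" "t \<le> b N" using strand_supp[OF hi[OF N]] by (auto simp: tot_def)
          then have "\<Phi> x v t = h N x (c N x v) t" unfolding \<Phi>_def by (intro ev[OF hi N]) auto
          then show False using nz v(2) by simp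
        qed
        then have "h N x (c N x v) = h N x 0"
          using rep_hom_0[OF is_iso_hom[OF h[OF N]] rN[OF N]] by (intro ext) simp
        then show ?thesis
          using is_iso_inj[OF h[OF N], of "c N x v" x 0] cin[OF v(1) N] rf.subspace_0[OF summand_subspace[OF N]]
          by simp
      qed
      then have "{N. component \<N> (\<lambda>N. N) N x v \<noteq> 0} = {}"
        using component_outside[OF v(1)] unfolding c_def by blast
      then show "v = 0" using component_sum[OF v(1)] by simp
    qed
    show "\<Phi> x ` obj M x = obj (strand F) x"
    proof (intro equalityI subsetI)
      fix w :: "'k rfun" assume w: "w \<in> obj (strand F) x"
      define wN where "wN N t = (if a N < t \<and> t \<le> b N then w t else 0)" for N t
      have wN: "wN N \<in> obj (strand {(a N, b N)}) x" for N
        using w unfolding obj_strand wN_def by (auto simp: tot_def)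
      define d where "d N = (if N \<in> \<N> then iso_inv (restrict_rep M N) (h N) x (wN N) else 0)" for N
      have din: "d N \<in> N x" "h N x (d N) = wN N" if "N \<in> \<N>" for N
        using iso_inv_in[OF h[OF that] wN] iso_inv_right[OF h[OF that] wN] that by (auto simp: d_def)
      define v where "v = (\<Sum>N\<in>\<N>. d N)"
      have dM: "d N \<in> obj M x" if "N \<in> \<N>" for N using summand_sub[OF that din(1)[OF that]] .
      have v: "v \<in> obj M x" unfolding v_def by (rule rf.subspace_sum[OF is_rep_subspace[OF M(1)] dM])
      have "decomposition \<N> (\<lambda>N. N) x v d"
        by (rule decompositionI[OF din(1) _ fin]) (auto simp: d_def v_def split: if_splits)
      then have "c N x v = d N" for N unfolding c_def by (rule component_unique[OF v])
      then have \<Phi>v: "\<Phi> x v = (\<Sum>N\<in>\<N>. wN N)" unfolding \<Phi>_def using din(2) by (simp cong: sum.cong)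
      have "\<Phi> x v t = w t" for t
      proof (cases "\<exists>N\<in>\<N>. a N < t \<and> t \<le> b N")
        case True
        then obtain N where N: "N \<in> \<N>" "a N < t" "t \<le> b N" by blast
        then show ?thesis unfolding \<Phi>v using ev[OF wN N] by (simp add: wN_def)
      next
        case False
        then have "t \<notin> tot F" by (auto simp: tot_def F_def)
        then have "w t = 0" using strand_supp[OF w] by blast
        moreover have "(\<Sum>N\<in>\<N>. wN N t) = 0" using False by (intro sum.neutral) (auto simp: wN_def)
        ultimately show ?thesis unfolding \<Phi>v by (simp add: sum_rfun_apply)
      qed
      then have "\<Phi> x v = w" by (intro ext)
      then show "w \<in> \<Phi> x ` obj M x" using v by blast
    qed (use \<Phi>in in blast)
  qed
  then have "is_iso M (strand F) \<Phi>" using hom by (simp add: is_iso_def)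
  then show ?thesis using that sep gd by blast
qed

lemma C_nilpotent: "C M \<Longrightarrow> nilpotent M"
  using C_decompose nilpotent_strand C_rep by metis

section \<open>Generation by the top and detection by the socle\<close>

text \<open>Shifting a point of \<open>L\<close> by full turns reaches any part of the line.\<close>

lemma L_below: obtains a where "a \<in> L" "nx a + 2 * pi \<le> t"
proof -
  have "1 \<in> {1..m}" using m_pos by simp
  obtain f :: "int \<Rightarrow> real" where f: "strict_mono f" "range f = Zs 1" using Zs_enum[OF \<open>1 \<in> {1..m}\<close>] .
  from range_in_Z[OF \<open>1 \<in> {1..m}\<close> f(2)] have "f 0 \<in> L" by (rule Z_in_L)
  define k where "k = \<lceil>(nx (f 0) + 2 * pi - t) / (2 * pi)\<rceil>"
  have "(nx (f 0) + 2 * pi - t) / (2 * pi) \<le> of_int k" by (simp add: k_def)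
  then have "nx (f 0) + 2 * pi - t \<le> of_int k * (2 * pi)" by (simp only: pos_divide_le_eq pi_gt_zero mult_pos_pos zero_less_numeral)
  moreover have "nx (f 0 + 2 * pi * of_int (- k)) = nx (f 0) + 2 * pi * of_int (- k)"
    by (rule nx_shift[OF \<open>f 0 \<in> L\<close>])
  ultimately show ?thesis
    using that[of "f 0 + 2 * pi * of_int (- k)"] \<open>f 0 \<in> L\<close> L_shift[of "f 0" "- k"]
    by (simp add: mult.commute)
qed

lemma L_above: obtains a where "a \<in> L" "t \<le> a"
proof -
  obtain a where a: "a \<in> L" "nx a + 2 * pi \<le> - t" by (rule L_below)
  define k where "k = \<lceil>(t - a) / (2 * pi)\<rceil>"
  have "(t - a) / (2 * pi) \<le> of_int k" by (simp add: k_def)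
  then have "t - a \<le> of_int k * (2 * pi)" by (simp only: pos_divide_le_eq pi_gt_zero mult_pos_pos zero_less_numeral)
  then show ?thesis using that[of "a + 2 * pi * of_int k"] a L_shift by (simp add: mult.commute)
qed

text \<open>Nakayama's lemma: if the image of \<open>f\<close> and the images of the steps of \<open>Z\<close> generate \<open>B\<close>, then
  every element of \<open>B\<close> is, modulo the image of \<open>f\<close>, in the image of arbitrarily long paths; and
  sufficiently long paths act by zero.\<close>

lemma nakayama_top:
  assumes A: "is_rep A" "cellwise A" and B: "is_rep B" "cellwise B" "nilpotent B" and f: "rep_hom A B f"
    and gen: "\<And>w v. w \<in> L \<Longrightarrow> v \<in> ob B (nx w) \<Longrightarrow>
      \<exists>a\<in>ob A (nx w). \<exists>u\<in>ob B w. v = f (cov (nx w)) a + pth B w (nx w) u"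
  shows "f x ` obj A x = obj B x"
proof -
  let ?R = "\<lambda>s t. \<forall>v\<in>ob B t. \<exists>a\<in>ob A t. \<exists>u\<in>ob B s. v = f (cov t) a + pth B s t u"
  have bijR: "?R s t" if b: "bij_path B s t" for s t
  proof
    fix v assume "v \<in> ob B t"
    then obtain u where "u \<in> ob B s" "v = pth B s t u" using bij_path_surj[OF b] by blast
    then show "\<exists>a\<in>ob A t. \<exists>u\<in>ob B s. v = f (cov t) a + pth B s t u"
      using ob_zero[OF A(1), of t] rep_hom_0[OF f A(1), of "cov t"] by (metis add_0)
  qed
  have R: "?R s t" if "s \<le> t" for s t
    using that
  proof (induction rule: cell_induct[where R = ?R])
    case (trans r s t)
    show ?case
    proof
      fix v assume "v \<in> ob B t"
      then obtain a u where au: "a \<in> ob A t" "u \<in> ob B s" "v = f (cov t) a + pth B s t u"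
        using trans(2) by blast
      obtain a' u' where au': "a' \<in> ob A s" "u' \<in> ob B r" "u = f (cov s) a' + pth B r s u'"
        using trans(1) au(2) by blast
      have "pth B s t u = pth B s t (f (cov s) a') + pth B s t (pth B r s u')"
        unfolding au'(3) by (rule pth_add[OF B(1) rep_hom_in[OF f au'(1)] pth_in[OF B(1) au'(2)]])
      also have "\<dots> = f (cov t) (pth A s t a') + pth B r t u'"
        using rep_hom_pth[OF f au'(1)] pth_comp[OF B(1) trans(3,4) au'(2)] by simp
      finally have "v = f (cov t) (a + pth A s t a') + pth B r t u'"
        unfolding au(3) using linear_between_add[OF rep_hom_linear[OF f] au(1) pth_in[OF A(1) au'(1)]]
        by (simp add: add.assoc)
      then show "\<exists>a\<in>ob A t. \<exists>u\<in>ob B r. v = f (cov t) a + pth B r t u"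
        using rf.subspace_add[OF is_rep_subspace[OF A(1)] au(1) pth_in[OF A(1) au'(1)]] au'(2) by blast
    qed
  next
    case (cell w s t)
    then show ?case using bijR cell_bij[OF B(2)] by blast
  next
    case (acc a)
    then show ?case using bijR B(2) unfolding cellwise_def by meson
  next
    case (cross w t)
    have bA: "bij_path A t (nx w)" and bB: "bij_path B t (nx w)"
      using cell_bij[OF A(2) cross] cell_bij[OF B(2) cross] by auto
    show ?case
    proof
      fix v assume v: "v \<in> ob B t"
      obtain a u where au: "a \<in> ob A (nx w)" "u \<in> ob B w"
          "pth B t (nx w) v = f (cov (nx w)) a + pth B w (nx w) u"
        using gen[OF cross(1) pth_in[OF B(1) v]] by blast
      obtain a' where a': "a' \<in> ob A t" "a = pth A t (nx w) a'" using bij_path_surj[OF bA au(1)] .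
      have fa: "f (cov t) a' \<in> ob B t" by (rule rep_hom_in[OF f a'(1)])
      have pu: "pth B w t u \<in> ob B t" by (rule pth_in[OF B(1) au(2)])
      have "pth B t (nx w) (f (cov t) a' + pth B w t u) = pth B t (nx w) v"
        unfolding pth_add[OF B(1) fa pu] au(3) a'(2)
        using rep_hom_pth[OF f a'(1)] pth_comp[OF B(1) _ cross(3) au(2)] cross(2) by simp
      then have "v = f (cov t) a' + pth B w t u"
        using bij_path_inj[OF bB v rf.subspace_add[OF is_rep_subspace[OF B(1)] fa pu]] by simp
      then show "\<exists>a\<in>ob A t. \<exists>u\<in>ob B w. v = f (cov t) a + pth B w t u" using a'(1) au(2) by blast
    qed
  qed
  have surj: "v \<in> f (cov t) ` ob A t" if v: "v \<in> ob B t" for v t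
  proof -
    obtain a where a: "a \<in> L" "nx a + 2 * pi \<le> t" by (rule L_below)
    have le: "a \<le> nx a + 2 * pi" using nx_gt[OF a(1)] pi_gt_zero by linarith
    obtain y u where yu: "y \<in> ob A t" "u \<in> ob B a" "v = f (cov t) y + pth B a t u"
      using R[of a t] v le a(2) by fastforce
    have "pth B a t u = pth B (nx a + 2 * pi) t (pth B a (nx a + 2 * pi) u)"
      using pth_comp[OF B(1) le a(2) yu(2)] by simp
    also have "\<dots> = 0" using B(3) a(1) yu(2) pth_0[OF B(1)] by (simp add: nilpotent_def)
    finally show ?thesis using yu by simp
  qed
  show ?thesis using surj[of _ "ang x"] rep_hom_in[OF f] by auto
qed

lemma nakayama_socle:
  assumes A: "is_rep A" "cellwise A" "nilpotent A" and B: "is_rep B" and f: "rep_hom A B f"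
    and soc: "\<And>w v. w \<in> L \<Longrightarrow> v \<in> ob A w \<Longrightarrow> f (cov w) v = 0 \<Longrightarrow> pth A w (nx w) v = 0 \<Longrightarrow> v = 0"
  shows "inj_on (f x) (obj A x)"
proof -
  let ?R = "\<lambda>s t. \<forall>v\<in>ob A s. f (cov s) v = 0 \<and> pth A s t v = 0 \<longrightarrow> v = 0"
  have bijR: "?R s t" if "bij_path A s t" for s t using bij_path_zero[OF that A(1)] by blast
  have R: "?R s t" if "s \<le> t" for s t
    using that
  proof (induction rule: cell_induct[where R = ?R])
    case (trans r s t)
    show ?case
    proof (intro ballI impI)
      fix v assume v: "v \<in> ob A r" "f (cov r) v = 0 \<and> pth A r t v = 0"
      have u: "pth A r s v \<in> ob A s" by (rule pth_in[OF A(1) v(1)])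
      have "f (cov s) (pth A r s v) = 0" using rep_hom_pth[OF f v(1), of s] v(2) pth_0[OF B] by simp
      moreover have "pth A s t (pth A r s v) = 0" using pth_comp[OF A(1) trans(3,4) v(1)] v(2) by simp
      ultimately have "pth A r s v = 0" using trans(2) u by blast
      then show "v = 0" using trans(1) v by blast
    qed
  next
    case (cell w s t)
    then show ?case using bijR cell_bij[OF A(2)] by blast
  next
    case (acc a)
    then show ?case using bijR A(2) unfolding cellwise_def by meson
  next
    case (cross w t)
    show ?case
    proof (intro ballI impI)
      fix v assume v: "v \<in> ob A w" "f (cov w) v = 0 \<and> pth A w t v = 0"
      have "pth A w (nx w) v = 0"
        using pth_comp[OF A(1) _ cross(3) v(1)] cross(2) v(2) pth_0[OF A(1)] by (metis less_imp_le)
      then show "v = 0" using soc[OF cross(1)] v by blast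
    qed
  qed
  have z: "v = 0" if v: "v \<in> ob A t" "f (cov t) v = 0" for v t
  proof -
    obtain a where a: "a \<in> L" "t \<le> a" by (rule L_above)
    have le: "a \<le> nx a + 2 * pi" using nx_gt[OF a(1)] pi_gt_zero by linarith
    have "pth A t (nx a + 2 * pi) v = pth A a (nx a + 2 * pi) (pth A t a v)"
      using pth_comp[OF A(1) a(2) le v(1)] by simp
    also have "\<dots> = 0" using A(3) a(1) pth_in[OF A(1) v(1)] by (simp add: nilpotent_def)
    finally show ?thesis using R[of t "nx a + 2 * pi"] a(2) le v by fastforce
  qed
  show ?thesis
    by (rule linear_between_inj_onI[OF rep_hom_linear[OF f] is_rep_subspace[OF A(1)]])
      (use z[of _ "ang x"] in auto)
qed

end

section \<open>Homomorphisms to and from direct sums of strings\<close>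

definition ivl :: "(real \<times> real) set \<Rightarrow> real \<Rightarrow> real \<times> real" where
  "ivl F t = (THE p. p \<in> F \<and> fst p < t \<and> t \<le> snd p)"

lemma ivl_eq: "separated 0 F \<Longrightarrow> p \<in> F \<Longrightarrow> fst p < t \<Longrightarrow> t \<le> snd p \<Longrightarrow> ivl F t = p"
  unfolding ivl_def by (rule the_equality) (simp, metis separated_unique)

text \<open>A homomorphism to a string is determined by what it does at the last point of the string,
  where it is an arbitrary functional that vanishes on everything coming from before the first point.\<close>

definition to_strand ::
  "'k::field rep \<Rightarrow> (real \<times> real) set \<Rightarrow> (real \<times> real \<Rightarrow> 'k rfun \<Rightarrow> 'k) \<Rightarrow> 'k nat_trans" where
  "to_strand M F \<phi> = (\<lambda>x v t.
     if cov t = x \<and> t \<in> tot F then \<phi> (ivl F t) (pth M t (snd (ivl F t)) v) else 0)"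

lemma to_strand_apply:
  "separated 0 F \<Longrightarrow> p \<in> F \<Longrightarrow> fst p < t \<Longrightarrow> t \<le> snd p \<Longrightarrow>
   to_strand M F \<phi> (cov t) v t = \<phi> p (pth M t (snd p) v)"
  by (simp add: to_strand_def ivl_eq totI)

lemma hom_to_strand:
  assumes M: "is_rep M" and F: "separated 0 F" and \<phi>: "\<And>p. p \<in> F \<Longrightarrow> functional (\<phi> p)"
    and kill: "\<And>p s v. p \<in> F \<Longrightarrow> s \<le> fst p \<Longrightarrow> v \<in> ob M s \<Longrightarrow> \<phi> p (pth M s (snd p) v) = 0"
  shows "rep_hom M (strand F) (to_strand M F \<phi>)"
proof (rule rep_homI)
  have into: "to_strand M F \<phi> x v \<in> obj (strand F) x" for x v
    unfolding obj_strand to_strand_def by simp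
  have \<phi>t: "functional (\<phi> (ivl F t))" if "t \<in> tot F" for t
  proof -
    obtain p where "p \<in> F" "fst p < t" "t \<le> snd p" using \<open>t \<in> tot F\<close> by (rule totE)
    then show ?thesis using ivl_eq[OF F, of p t] \<phi>[of p] by simp
  qed
  show "linear_between (ob M s) (ob (strand F) s) (to_strand M F \<phi> (cov s))" for s
  proof (rule linear_betweenI)
    fix v w assume v: "v \<in> ob M s" and w: "w \<in> ob M s"
    show "to_strand M F \<phi> (cov s) (v + w) = to_strand M F \<phi> (cov s) v + to_strand M F \<phi> (cov s) w"
    proof (rule ext)
      fix t
      have "pth M t r (v + w) = pth M t r v + pth M t r w" if "cov t = cov s" for r
        using pth_add[OF M, of v t w r] v w that by simp
      then show "to_strand M F \<phi> (cov s) (v + w) t =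
          (to_strand M F \<phi> (cov s) v + to_strand M F \<phi> (cov s) w) t"
        using functional_add[OF \<phi>t, of t] by (simp add: to_strand_def)
    qed
  next
    fix v c assume v: "v \<in> ob M s"
    show "to_strand M F \<phi> (cov s) (rscale c v) = rscale c (to_strand M F \<phi> (cov s) v)"
    proof (rule ext)
      fix t
      have "pth M t r (rscale c v) = rscale c (pth M t r v)" if "cov t = cov s" for r
        using linear_between_scale[OF pth_linear[OF M, of t r], of v c] v that by simp
      then show "to_strand M F \<phi> (cov s) (rscale c v) t = rscale c (to_strand M F \<phi> (cov s) v) t"
        using functional_scale[OF \<phi>t, of t] by (simp add: to_strand_def)
    qed
  qed (rule into)
  fix s t v assume st: "s \<le> t" and v: "v \<in> ob M s"
  show "to_strand M F \<phi> (cov t) (pth M s t v) = pth (strand F) s t (to_strand M F \<phi> (cov s) v)"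
  proof (rule ext)
    fix u
    define s' where "s' = u - (t - s)"
    show "to_strand M F \<phi> (cov t) (pth M s t v) u = pth (strand F) s t (to_strand M F \<phi> (cov s) v) u"
    proof (cases "cov u = cov t \<and> u \<in> tot F")
      case False
      then have n: "\<not> (cov u = cov t \<and> same F (u - (t - s)) u)"
        using st same_sub[of F "u - (t - s)" u u u] unfolding tot_iff_same by auto
      have "to_strand M F \<phi> (cov t) (pth M s t v) u = 0" using False by (auto simp: to_strand_def)
      also have "0 = pth (strand F) s t (to_strand M F \<phi> (cov s) v) u"
        unfolding pth_strand[OF F into st] by (rule if_not_P[OF n, symmetric])
      finally show ?thesis .
    next
      case True
      then obtain p where p: "p \<in> F" "fst p < u" "u \<le> snd p" by (auto elim: totE)
      have cs: "cov s' = cov s" using cov_diff_cong[of u t "t - s"] True by (simp add: s'_def)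
      have v': "v \<in> ob M s'" using v cs by simp
      have le: "s' \<le> u" using st by (simp add: s'_def)
      have "pth M s t = pth M s' u" by (rule pth_cong) (use cs in \<open>simp_all add: s'_def\<close>)
      then have lhs: "to_strand M F \<phi> (cov t) (pth M s t v) u = \<phi> p (pth M s' (snd p) v)"
        using to_strand_apply[OF F p, of M \<phi> "pth M s t v"] True pth_comp[OF M le p(3) v'] by simp
      show ?thesis
      proof (cases "fst p < s'")
        case True
        then have "same F s' u" using p unfolding same_def by blast
        moreover have "to_strand M F \<phi> (cov s) v s' = \<phi> p (pth M s' (snd p) v)"
          using to_strand_apply[OF F p(1) True, of M \<phi> v] p(3) le cs by simp
        ultimately show ?thesis
          unfolding pth_strand[OF F into st] lhs using \<open>cov u = cov t \<and> u \<in> tot F\<close> by (simp add: s'_def)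
      next
        case False
        have "\<not> same F s' u"
        proof
          assume "same F s' u"
          then obtain q where q: "q \<in> F" "fst q < s'" "u \<le> snd q" unfolding same_def by blast
          have "q = p" by (rule separated_unique[OF F q(1) p(1), of u]) (use q p le in auto)
          then show False using q(2) False by simp
        qed
        moreover have "\<phi> p (pth M s' (snd p) v) = 0" using kill[OF p(1) _ v'] False by simp
        ultimately show ?thesis unfolding pth_strand[OF F into st] lhs by (simp add: s'_def)
      qed
    qed
  qed
qed

text \<open>Dually, a homomorphism from a direct sum of strings is the choice of a vector \<open>\<mu> t\<close> at each
  point \<open>t\<close> of the strings, compatible with the paths.\<close>

definition from_strand :: "(real \<times> real) set \<Rightarrow> (real \<Rightarrow> 'k::field rfun) \<Rightarrow> 'k nat_trans" where
  "from_strand F \<mu> = (\<lambda>x v. \<Sum>t\<in>pts F x. rscale (v t) (\<mu> t))"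

lemma from_strand_basis_vec:
  assumes "finite F" "t \<in> tot F"
  shows "from_strand F \<mu> (cov t) (basis_vec t) = \<mu> t"
proof -
  have "t \<in> pts F (cov t)" using assms(2) by (simp add: pts_def)
  moreover have "from_strand F \<mu> (cov t) (basis_vec t) = (\<Sum>u\<in>pts F (cov t). if u = t then \<mu> t else 0)"
    unfolding from_strand_def by (intro sum.cong refl) (simp add: basis_vec_apply)
  ultimately show ?thesis using finite_pts[OF assms(1), of "cov t"] by simp
qed

lemma hom_from_strand:
  assumes M: "is_rep (M :: 'k::field rep)" and F: "separated 0 F" and \<mu>: "\<And>t. t \<in> tot F \<Longrightarrow> \<mu> t \<in> ob M t"
    and move: "\<And>s t. s \<in> tot F \<Longrightarrow> s \<le> t \<Longrightarrow> pth M s t (\<mu> s) = (if same F s t then \<mu> t else 0)"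
  shows "rep_hom (strand F) M (from_strand F \<mu>)"
proof (rule rep_homI)
  have fin: "finite (pts F x)" for x by (rule finite_pts[OF separated_finite[OF F]])
  have \<mu>x: "rscale c (\<mu> t) \<in> obj M x" if "t \<in> pts F x" for c t x
    using that \<mu>[of t] rf.subspace_scale[OF is_rep_subspace[OF M]] by (auto simp: pts_def)
  show "linear_between (ob (strand F) s) (ob M s) (from_strand F \<mu> (cov s))" for s
  proof (rule linear_betweenI)
    show "from_strand F \<mu> (cov s) v \<in> ob M s" for v
      unfolding from_strand_def by (intro rf.subspace_sum[OF is_rep_subspace[OF M]] \<mu>x)
    show "from_strand F \<mu> (cov s) (v + w) = from_strand F \<mu> (cov s) v + from_strand F \<mu> (cov s) w" for v w
      unfolding from_strand_def by (simp only: plus_fun_apply rf.scale_left_distrib sum.distrib)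
    show "from_strand F \<mu> (cov s) (rscale c v) = rscale c (from_strand F \<mu> (cov s) v)" for c v
      unfolding from_strand_def by (simp only: rscale_apply rf.scale_sum_right rf.scale_scale)
  qed
  fix s t and v :: "'k rfun" assume st: "s \<le> t" and v: "v \<in> ob (strand F) s"
  define d where "d = t - s"
  let ?A = "{r \<in> pts F (cov s). same F r (r + d)}" and ?B = "{u \<in> pts F (cov t). same F (u - d) u}"
  have d: "0 \<le> d" using st by (simp add: d_def)
  have "pth M s t (from_strand F \<mu> (cov s) v) = (\<Sum>r\<in>pts F (cov s). pth M s t (rscale (v r) (\<mu> r)))"
    unfolding from_strand_def by (rule linear_between_sum[OF pth_linear[OF M] is_rep_subspace[OF M] \<mu>x])
  also have "\<dots> = (\<Sum>r\<in>pts F (cov s). if same F r (r + d) then rscale (v r) (\<mu> (r + d)) else 0)"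
  proof (rule sum.cong[OF refl])
    fix r assume r: "r \<in> pts F (cov s)"
    then have c: "cov r = cov s" "r \<in> tot F" by (auto simp: pts_def)
    have "\<mu> r \<in> ob M s" using \<mu>[OF c(2)] c(1) by simp
    moreover have "pth M s t = pth M r (r + d)" by (rule pth_cong) (use c in \<open>simp_all add: d_def\<close>)
    ultimately show "pth M s t (rscale (v r) (\<mu> r)) =
        (if same F r (r + d) then rscale (v r) (\<mu> (r + d)) else 0)"
      using linear_between_scale[OF pth_linear[OF M, of s t]] move[OF c(2), of "r + d"] d by simp
  qed
  also have "\<dots> = (\<Sum>r\<in>?A. rscale (v r) (\<mu> (r + d)))"
    by (rule sum.inter_filter[OF fin, symmetric])
  also have "\<dots> = (\<Sum>u\<in>?B. rscale (v (u - d)) (\<mu> u))"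
  proof (rule sum.reindex_bij_witness[where i = "\<lambda>u. u - d" and j = "\<lambda>r. r + d"])
    show "u - d \<in> ?A" if "u \<in> ?B" for u
    proof -
      have "cov (u - d) = cov s" using cov_diff_cong[of u t d] that by (simp add: pts_def d_def)
      moreover have "u - d \<in> tot F" using that d same_sub[of F "u - d" u "u - d" "u - d"]
        unfolding tot_iff_same by simp
      ultimately show ?thesis using that by (simp add: pts_def)
    qed
    show "r + d \<in> ?B" if "r \<in> ?A" for r
    proof -
      have "cov (r + d) = cov t" using cov_add_cong[of r s d] that by (simp add: pts_def d_def)
      moreover have "r + d \<in> tot F" using that d same_sub[of F r "r + d" "r + d" "r + d"]
        unfolding tot_iff_same by simp
      ultimately show ?thesis using that by (simp add: pts_def)
    qed
  qed simp_all
  also have "\<dots> = (\<Sum>u\<in>pts F (cov t). if same F (u - d) u then rscale (v (u - d)) (\<mu> u) else 0)"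
    by (rule sum.inter_filter[OF fin])
  also have "\<dots> = from_strand F \<mu> (cov t) (pth (strand F) s t v)"
    unfolding from_strand_def
    by (rule sum.cong[OF refl]) (simp add: pth_strand[OF F v st] pts_def d_def)
  finally show "from_strand F \<mu> (cov t) (pth (strand F) s t v) = pth M s t (from_strand F \<mu> (cov s) v)"
    by (rule sym)
qed

lemma hom_strand_eq:
  assumes M: "is_rep (M :: 'k::field rep)" and F: "separated 0 F" and f: "rep_hom (strand F) M f" and g: "rep_hom (strand F) M g"
    and eq: "\<And>t. t \<in> tot F \<Longrightarrow> f (cov t) (basis_vec t) = g (cov t) (basis_vec t)"
  shows "hom_eq (strand F) f g"
  unfolding hom_eq_def
proof (intro allI ballI)
  fix x and v :: "'k rfun" assume v: "v \<in> obj (strand F) x"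
  have fin: "finite (pts F x)" by (rule finite_pts[OF separated_finite[OF F]])
  have ex: "v = (\<Sum>t\<in>pts F x. rscale (v t) (basis_vec t))"
    using strand_supp[OF v] by (intro expand_finite[OF fin]) (auto simp: pts_def)
  have bv: "basis_vec t \<in> obj (strand F) x" if "t \<in> pts F x" for t
    using that basis_vec_in_strand[of t F] by (auto simp: pts_def)
  have *: "h x v = (\<Sum>t\<in>pts F x. rscale (v t) (h x (basis_vec t)))" if h: "rep_hom (strand F) M h" for h
  proof -
    have "h x v = h x (\<Sum>t\<in>pts F x. rscale (v t) (basis_vec t))" using ex by simp
    also have "\<dots> = (\<Sum>t\<in>pts F x. h x (rscale (v t) (basis_vec t)))"
      by (rule rep_hom_sum[OF h is_rep_strand[OF F] rf.subspace_scale[OF subspace_strand bv]])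
    also have "\<dots> = (\<Sum>t\<in>pts F x. rscale (v t) (h x (basis_vec t)))"
      by (intro sum.cong refl linear_between_scale[OF rep_hom_linear[OF h] bv])
    finally show ?thesis .
  qed
  have "f x (basis_vec t) = g x (basis_vec t)" if "t \<in> pts F x" for t
    using eq[of t] that by (simp add: pts_def)
  then show "f x v = g x v" unfolding *[OF f] *[OF g] by (intro sum.cong refl) simp
qed

context circle_cells
begin

text \<open>Because representations of \<open>C\<close> are constant on cells, a homomorphism from a string is
  determined by the image of its generator in the first cell of the string.\<close>

lemma hom_from_generators:
  assumes M: "is_rep M" "cellwise M" and F: "good F"
    and w: "\<And>p. p \<in> F \<Longrightarrow> w p \<in> ob M (nx (fst p))"
    and kill: "\<And>p t. p \<in> F \<Longrightarrow> snd p < t \<Longrightarrow> pth M (nx (fst p)) t (w p) = 0"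
  obtains g where "rep_hom (strand F) M g"
    "\<And>p. p \<in> F \<Longrightarrow> g (cov (nx (fst p))) (basis_vec (nx (fst p))) = w p"
proof -
  have F0: "separated 0 F" by (rule good_separated[OF F])
  have nxp: "fst p < nx (fst p)" "nx (fst p) \<le> snd p" "fst p \<in> L" if "p \<in> F" for p
    using goodD[OF F that] nx_gt nx_le separated_less[OF F0 that] by auto
  let ?P = "\<lambda>p t v. v \<in> ob M t \<and> (if nx (fst p) \<le> t then v = pth M (nx (fst p)) t (w p)
      else pth M t (nx (fst p)) v = w p)"
  have bij: "bij_path M t (nx (fst p))" if "p \<in> F" "fst p < t" "t \<le> nx (fst p)" for p t
    by (rule cell_bij[OF M(2) nxp(3)[OF that(1)] that(2,3)]) simp
  have ex: "\<exists>v. ?P p t v" if p: "p \<in> F" "fst p < t" for p t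
  proof (cases "nx (fst p) \<le> t")
    case True
    then show ?thesis using pth_in[OF M(1) w[OF p(1)]] by auto
  next
    case False
    obtain v where "v \<in> ob M t" "w p = pth M t (nx (fst p)) v"
      using bij_path_surj[OF bij[OF p] w[OF p(1)]] False by auto
    then show ?thesis using False by auto
  qed
  define \<mu> where "\<mu> t = (SOME v. ?P (ivl F t) t v)" for t
  have \<mu>: "?P p t (\<mu> t)" if p: "p \<in> F" "fst p < t" "t \<le> snd p" for p t
    unfolding \<mu>_def ivl_eq[OF F0 p] by (rule someI_ex[OF ex[OF p(1,2)]])
  have \<mu>in: "\<mu> t \<in> ob M t" if "t \<in> tot F" for t
    using totE[OF that] \<mu> by metis
  have move1: "pth M s t (\<mu> s) = \<mu> t" if p: "p \<in> F" "fst p < s" "s \<le> t" "t \<le> snd p" for p s t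
  proof -
    have s: "?P p s (\<mu> s)" and t: "?P p t (\<mu> t)" using \<mu> p by auto
    show ?thesis
    proof (cases "nx (fst p) \<le> t")
      case True
      then have \<mu>t: "\<mu> t = pth M (nx (fst p)) t (w p)" using t by simp
      show ?thesis
      proof (cases "nx (fst p) \<le> s")
        case True
        then show ?thesis using s \<mu>t pth_comp[OF M(1) True p(3) w[OF p(1)]] by simp
      next
        case False
        then have "pth M s (nx (fst p)) (\<mu> s) = w p" using s by simp
        then show ?thesis
          using \<mu>t pth_comp[OF M(1) _ \<open>nx (fst p) \<le> t\<close>, of s "\<mu> s"] s False by simp
      qed
    next
      case False
      then have b: "bij_path M t (nx (fst p))" using bij[of p t] p by simp
      have "\<not> nx (fst p) \<le> s" using False p(3) by simp
      then have "pth M s (nx (fst p)) (\<mu> s) = w p" using s by simp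
      then have "pth M t (nx (fst p)) (pth M s t (\<mu> s)) = w p"
        using pth_comp[OF M(1) p(3), of "nx (fst p)" "\<mu> s"] s False by simp
      moreover have "pth M t (nx (fst p)) (\<mu> t) = w p" using t False by simp
      ultimately show ?thesis using bij_path_inj[OF b pth_in[OF M(1), of "\<mu> s" s t]] s t by simp
    qed
  qed
  have move: "pth M s t (\<mu> s) = (if same F s t then \<mu> t else 0)" if s: "s \<in> tot F" and st: "s \<le> t" for s t
  proof -
    obtain p where p: "p \<in> F" "fst p < s" "s \<le> snd p" using s by (rule totE)
    show ?thesis
    proof (cases "t \<le> snd p")
      case True
      then have "same F s t" using p unfolding same_def by blast
      then show ?thesis using move1[OF p(1,2) st True] by simp
    next
      case False
      have "\<not> same F s t"
      proof
        assume "same F s t"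
        then obtain q where q: "q \<in> F" "fst q < s" "t \<le> snd q" unfolding same_def by blast
        have "q = p" by (rule separated_unique[OF F0 q(1) p(1), of s]) (use q p st in auto)
        then show False using q False by simp
      qed
      moreover have "pth M s t (\<mu> s) = 0"
      proof -
        have "pth M s (snd p) (\<mu> s) = \<mu> (snd p)" by (rule move1[OF p order_refl])
        also have "\<dots> = pth M (nx (fst p)) (snd p) (w p)"
          using \<mu>[OF p(1), of "snd p"] nxp[OF p(1)] by simp
        finally have "pth M s t (\<mu> s) = pth M (snd p) t (pth M (nx (fst p)) (snd p) (w p))"
          using pth_comp[OF M(1) p(3) _ \<mu>in[OF s], of t] False by simp
        also have "\<dots> = 0"
          using pth_comp[OF M(1) nxp(2)[OF p(1)] _ w[OF p(1)], of t] kill[OF p(1), of t] False by simp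
        finally show ?thesis .
      qed
      ultimately show ?thesis by simp
    qed
  qed
  show ?thesis
  proof (rule that)
    show "rep_hom (strand F) M (from_strand F \<mu>)" by (rule hom_from_strand[OF M(1) F0 \<mu>in move])
    fix p assume p: "p \<in> F"
    have "\<mu> (nx (fst p)) = w p" using \<mu>[OF p nxp(1,2)[OF p]] pth_refl[OF M(1) w[OF p]] by simp
    then show "from_strand F \<mu> (cov (nx (fst p))) (basis_vec (nx (fst p))) = w p"
      by (simp add: from_strand_basis_vec[OF separated_finite[OF F0] totI[OF p nxp(1,2)[OF p]]])
  qed
qed

text \<open>The generator determines the values after it by naturality, and those before it because the paths
  of its cell act injectively on \<open>M\<close>.\<close>

lemma hom_generators_eq:
  assumes M: "is_rep (M :: 'k::field rep)" "cellwise M" and F: "good F"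
    and f: "rep_hom (strand F) M f" and g: "rep_hom (strand F) M g"
    and eq: "\<And>p. p \<in> F \<Longrightarrow> f (cov (nx (fst p))) (basis_vec (nx (fst p))) = g (cov (nx (fst p))) (basis_vec (nx (fst p)))"
  shows "hom_eq (strand F) f g"
proof (rule hom_strand_eq[OF M(1) good_separated[OF F] f g])
  have F0: "separated 0 F" by (rule good_separated[OF F])
  fix t assume t: "t \<in> tot F"
  then obtain p where p: "p \<in> F" "fst p < t" "t \<le> snd p" by (rule totE)
  let ?a = "nx (fst p)"
  have a: "fst p < ?a" "?a \<le> snd p" "fst p \<in> L"
    using goodD[OF F p(1)] nx_gt nx_le separated_less[OF F0 p(1)] by auto
  have at: "?a \<in> tot F" by (rule totI[OF p(1) a(1,2)])
  show "f (cov t) (basis_vec t) = g (cov t) (basis_vec t)"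
  proof (cases "?a \<le> t")
    case True
    have "same F ?a t" using p a unfolding same_def by blast
    then have "(basis_vec t :: 'k rfun) = pth (strand F) ?a t (basis_vec ?a)" using \<open>same F ?a t\<close> by (simp add: pth_basis_vec[OF F0 at True])
    then show ?thesis
      using rep_hom_pth[OF f basis_vec_in_strand[OF at], of t]
        rep_hom_pth[OF g basis_vec_in_strand[OF at], of t] eq[OF p(1)] by simp
  next
    case False
    have "same F t ?a" using p a unfolding same_def by blast
    then have "(basis_vec ?a :: 'k rfun) = pth (strand F) t ?a (basis_vec t)" using \<open>same F t ?a\<close> False by (simp add: pth_basis_vec[OF F0 t])
    then have "pth M t ?a (f (cov t) (basis_vec t)) = pth M t ?a (g (cov t) (basis_vec t))"
      using rep_hom_pth[OF f basis_vec_in_strand[OF t], of ?a]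
        rep_hom_pth[OF g basis_vec_in_strand[OF t], of ?a] eq[OF p(1)] by simp
    moreover have "bij_path M t ?a" by (rule cell_bij[OF M(2) a(3) p(2)]) (use False in auto)
    ultimately show ?thesis
      using bij_path_inj rep_hom_in[OF f basis_vec_in_strand[OF t]] rep_hom_in[OF g basis_vec_in_strand[OF t]]
      by blast
  qed
qed

section \<open>Epimorphisms and monomorphisms\<close>

lemma hom_eq_comp: "hom_eq M (hom_comp g f) (hom_comp h f) \<longleftrightarrow> (\<forall>x. \<forall>v\<in>obj M x. g x (f x v) = h x (f x v))"
  by (simp add: hom_eq_def hom_comp_def)

lemma rep_hom_zero: "is_rep N \<Longrightarrow> is_rep M \<Longrightarrow> rep_hom M N (\<lambda>x v. 0)"
  by (intro rep_homI linear_betweenI) (simp_all add: ob_zero pth_0)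

lemma epi_if_surj:
  assumes "C A" "C B" "rep_hom A B f" "\<And>x. f x ` obj A x = obj B x"
  shows "epi C A B f"
  unfolding epi_def hom_eq_comp
proof (intro conjI allI impI)
  fix X g h assume a: "C X \<and> rep_hom B X g \<and> rep_hom B X h \<and> (\<forall>x. \<forall>v\<in>obj A x. g x (f x v) = h x (f x v))"
  show "hom_eq B g h"
    unfolding hom_eq_def
  proof (intro allI ballI)
    fix x v assume "v \<in> obj B x"
    then have "v \<in> f x ` obj A x" using assms(4) by simp
    then show "g x v = h x v" using a by auto
  qed
qed (use assms in auto)

lemma monic_if_inj:
  assumes "C A" "C B" "rep_hom A B f" "\<And>x. inj_on (f x) (obj A x)"
  shows "monic C A B f"
  unfolding monic_def
proof (intro conjI allI impI)
  fix X g h assume a: "C X \<and> rep_hom X A g \<and> rep_hom X A h \<and> hom_eq X (hom_comp f g) (hom_comp f h)"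
  show "hom_eq X g h"
    unfolding hom_eq_def
  proof (intro allI ballI)
    fix x v assume v: "v \<in> obj X x"
    then have "f x (g x v) = f x (h x v)" using a by (simp add: hom_eq_def hom_comp_def)
    moreover have "g x v \<in> obj A x" "h x v \<in> obj A x" using a v rep_hom_in by blast+
    ultimately show "g x v = h x v" using inj_onD[OF assms(4)] by blast
  qed
qed (use assms in auto)

text \<open>If \<open>f\<close> is not surjective then its cokernel has a nonzero top, hence a nonzero homomorphism to
  a simple string.\<close>

lemma epi_surj:
  assumes e: "epi C A B (f :: 'k::field nat_trans)"
  shows "f x ` obj A x = obj B x"
proof -
  have AB: "C A" "C B" and f: "rep_hom A B f" using e by (auto simp: epi_def)
  note A = C_rep[OF AB(1)] and B = C_rep[OF AB(2)]
  show ?thesis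
  proof (rule nakayama_top[OF A C_cellwise[OF AB(1)] B C_cellwise[OF AB(2)] C_nilpotent[OF AB(2)] f], rule ccontr)
    fix w v assume w: "w \<in> L" and v: "v \<in> ob B (nx w)"
      and no: "\<not> (\<exists>a\<in>ob A (nx w). \<exists>u\<in>ob B w. v = f (cov (nx w)) a + pth B w (nx w) u)"
    define W where "W = {x + y | x y. x \<in> f (cov (nx w)) ` ob A (nx w) \<and> y \<in> pth B w (nx w) ` ob B w}"
    have sW: "rf.subspace W"
      unfolding W_def
      by (intro rf.subspace_sums linear_between_image_subspace[OF rep_hom_linear[OF f] is_rep_subspace[OF A]]
          linear_between_image_subspace[OF pth_linear[OF B] is_rep_subspace[OF B]])
    have "v \<notin> W" using no unfolding W_def by blast
    then obtain \<phi> where \<phi>: "functional \<phi>" "\<phi> v = 1" "\<And>y. y \<in> W \<Longrightarrow> \<phi> y = 0"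
      using functional_separation[OF sW] by blast
    have fW: "f (cov (nx w)) a \<in> W" if "a \<in> ob A (nx w)" for a
    proof -
      have "f (cov (nx w)) a + pth B w (nx w) 0 \<in> W" using that ob_zero[OF B, of w] unfolding W_def by blast
      then show ?thesis using pth_0[OF B] by simp
    qed
    have pW: "pth B w (nx w) u \<in> W" if "u \<in> ob B w" for u
    proof -
      have "f (cov (nx w)) 0 + pth B w (nx w) u \<in> W" using that ob_zero[OF A, of "nx w"] unfolding W_def by blast
      then show ?thesis using rep_hom_0[OF f A] by simp
    qed
    let ?F = "{(w, nx w)}"
    have lt: "w < nx w" by (rule nx_gt[OF w])
    have F: "good ?F" by (rule good_single[OF w nx_in[OF w] lt]) simp
    have F0: "separated 0 ?F" by (rule good_separated[OF F])
    define g where "g = to_strand B ?F (\<lambda>p. \<phi>)"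
    have g: "rep_hom B (strand ?F) g"
      unfolding g_def
    proof (rule hom_to_strand[OF B F0])
      fix p s y assume p: "p \<in> ?F" "s \<le> fst p" "y \<in> ob B s"
      then have "pth B s (nx w) y = pth B w (nx w) (pth B s w y)" using pth_comp[OF B, of s w "nx w" y] lt by simp
      then show "\<phi> (pth B s (snd p) y) = 0" using p pW[OF pth_in[OF B p(3)]] \<phi>(3) by simp
    qed (rule \<phi>(1))
    have "g y (f y a) = 0" if a: "a \<in> obj A y" for y a
    proof (rule ext)
      fix t
      show "g y (f y a) t = 0 t"
      proof (cases "cov t = y \<and> t \<in> tot ?F")
        case True
        then have t: "w < t" "t \<le> nx w" "cov t = y" by (auto simp: tot_def)
        have "g y (f y a) t = \<phi> (pth B t (nx w) (f y a))"
          unfolding g_def using to_strand_apply[OF F0, of "(w, nx w)" t B "\<lambda>p. \<phi>" "f y a"] t by simp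
        also have "pth B t (nx w) (f y a) = f (cov (nx w)) (pth A t (nx w) a)"
          using rep_hom_pth[OF f, of a t "nx w"] a t(3) by simp
        also have "\<phi> \<dots> = 0" using \<phi>(3) fW pth_in[OF A, of a t "nx w"] a t(3) by simp
        finally show ?thesis by simp
      next
        case False
        then show ?thesis unfolding g_def to_strand_def by auto
      qed
    qed
    then have "hom_eq A (hom_comp g f) (hom_comp (\<lambda>x v. 0) f)" by (simp add: hom_eq_comp)
    then have "hom_eq B g (\<lambda>x v. 0)"
      using e g C_strand[OF F] rep_hom_zero[OF is_rep_strand[OF F0] B] unfolding epi_def by blast
    then have "g (cov (nx w)) v (nx w) = 0" using v by (simp add: hom_eq_def)
    moreover have "g (cov (nx w)) v (nx w) = \<phi> v"
      unfolding g_def using to_strand_apply[OF F0, of "(w, nx w)" "nx w" B "\<lambda>p. \<phi>" v] lt pth_refl[OF B v] by simp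
    ultimately show False using \<phi>(2) by simp
  qed
qed

text \<open>Dually, a nonzero kernel has a nonzero socle, which is the image of a simple string.\<close>

lemma monic_inj:
  assumes e: "monic C A B (f :: 'k::field nat_trans)"
  shows "inj_on (f x) (obj A x)"
proof -
  have AB: "C A" "C B" and f: "rep_hom A B f" using e by (auto simp: monic_def)
  note A = C_rep[OF AB(1)] and B = C_rep[OF AB(2)]
  show ?thesis
  proof (rule nakayama_socle[OF A C_cellwise[OF AB(1)] C_nilpotent[OF AB(1)] B f])
    fix w v assume w: "w \<in> L" and v: "v \<in> ob A w" "f (cov w) v = 0" "pth A w (nx w) v = 0"
    define a where "a = pr w"
    have a: "a \<in> L" "nx a = w" using pr_in[OF w] nx_pr[OF w] by (auto simp: a_def)
    have lt: "a < w" using nx_gt[OF a(1)] a(2) by simp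
    let ?F = "{(a, w)}"
    have F: "good ?F" using good_single[OF a(1) w lt] a(2) pi_gt_zero by simp
    have F0: "separated 0 ?F" by (rule good_separated[OF F])
    have kill: "pth A w t v = 0" if t: "w < t" for t
    proof (cases "nx w \<le> t")
      case True
      then have "pth A w t v = pth A (nx w) t (pth A w (nx w) v)"
        using pth_comp[OF A _ True v(1)] nx_gt[OF w] by simp
      then show ?thesis using v(3) pth_0[OF A] by simp
    next
      case False
      have b: "bij_path A t (nx w)" by (rule cell_bij[OF C_cellwise[OF AB(1)] w t]) (use False in auto)
      have "pth A t (nx w) (pth A w t v) = 0" using pth_comp[OF A _ _ v(1), of t "nx w"] t False v(3) by simp
      then show ?thesis by (rule bij_path_zero[OF b A pth_in[OF A v(1)]])
    qed
    have w1: "v \<in> ob A (nx (fst p))" if "p \<in> ?F" for p using that v(1) a(2) by simp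
    have w2: "pth A (nx (fst p)) t v = 0" if "p \<in> ?F" "snd p < t" for p t
      using that kill a(2) by simp
    obtain g where g: "rep_hom (strand ?F) A g"
      "\<And>p. p \<in> ?F \<Longrightarrow> g (cov (nx (fst p))) (basis_vec (nx (fst p))) = v"
      using hom_from_generators[OF A C_cellwise[OF AB(1)] F, of "\<lambda>p. v"] w1 w2 by blast
    have z: "rep_hom (strand ?F) A (\<lambda>x v. 0)" by (rule rep_hom_zero[OF A is_rep_strand[OF F0]])
    have "hom_eq (strand ?F) (hom_comp f g) (hom_comp f (\<lambda>x v. 0))"
    proof (rule hom_generators_eq[OF B C_cellwise[OF AB(2)] F rep_hom_comp[OF g(1) f] rep_hom_comp[OF z f]])
      fix p assume p: "p \<in> ?F"
      then have "f (cov (nx (fst p))) v = f (cov (nx (fst p))) 0"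
        using v(2) a(2) rep_hom_0[OF f A] by simp
      then show "hom_comp f g (cov (nx (fst p))) (basis_vec (nx (fst p))) =
          hom_comp f (\<lambda>x v. 0) (cov (nx (fst p))) (basis_vec (nx (fst p)))"
        using g(2)[OF p] by (simp add: hom_comp_def)
    qed
    then have "hom_eq (strand ?F) g (\<lambda>x v. 0)"
      using e g(1) z C_strand[OF F] unfolding monic_def by blast
    moreover have "(basis_vec w :: 'k rfun) \<in> ob (strand ?F) w" by (rule strand_single_nonzero(1)[OF lt])
    ultimately have "g (cov w) (basis_vec w) = 0" by (simp add: hom_eq_def)
    then show "v = 0" using g(2)[of "(a, w)"] a(2) by simp
  qed
qed

section \<open>Projectives and injectives\<close>

text \<open>The vector \<open>v\<close> lives at the end of the cell after \<open>a\<close>.  It dies at the end of the cell in which the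
  path has made a full turn, and so it dies already at the beginning of that cell.\<close>

lemma nilpotent_beyond:
  assumes M: "is_rep M" "cellwise M" "nilpotent M" and a: "a \<in> L" and v: "v \<in> ob M (nx a)" and t: "nx a + 2 * pi < t"
  shows "pth M (nx a) t v = 0"
proof -
  define b where "b = nx a"
  have b: "b \<in> L" "b + 2 * pi \<in> L" using nx_in[OF a] L_shift[of "nx a" 1] by (auto simp: b_def)
  have nb: "nx (b + 2 * pi) = nx b + 2 * pi" using nx_shift[OF b(1), of 1] by simp
  have z: "pth M b (nx b + 2 * pi) v = 0" using M(3) b(1) v by (simp add: nilpotent_def b_def)
  have vb: "v \<in> ob M b" using v by (simp add: b_def)
  have le: "b \<le> nx b + 2 * pi" using nx_gt[OF b(1)] pi_gt_zero by linarith
  have bt: "b \<le> t" using t pi_gt_zero unfolding b_def by linarith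
  have "pth M b t v = 0"
  proof (cases "nx b + 2 * pi \<le> t")
    case True
    then show ?thesis using pth_comp[OF M(1) le True vb] z pth_0[OF M(1)] by simp
  next
    case False
    have "bij_path M t (nx b + 2 * pi)"
      by (rule cell_bij[OF M(2) b(2)]) (use t False nb in \<open>auto simp: b_def\<close>)
    moreover have "pth M t (nx b + 2 * pi) (pth M b t v) = 0"
      using pth_comp[OF M(1) bt _ vb, of "nx b + 2 * pi"] False z by simp
    ultimately show ?thesis using bij_path_zero[OF _ M(1) pth_in[OF M(1) vb]] by blast
  qed
  then show ?thesis by (simp add: b_def)
qed

text \<open>These sums of strings of maximal length are both the projective and the injective ones.\<close>

definition full :: "(real \<times> real) set \<Rightarrow> bool" where
  "full F \<longleftrightarrow> good F \<and> (\<forall>p\<in>F. snd p = nx (fst p) + 2 * pi)"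

text \<open>The generator of a full string may be sent anywhere, since the path that must kill its image
  acts by zero on all of \<open>C\<close>.\<close>

lemma projective_full:
  assumes F: "full F"
  shows "projective C (strand F :: 'k::field rep)"
  unfolding projective_def
proof (intro conjI allI impI)
  have gF: "good F" using F by (simp add: full_def)
  have F0: "separated 0 F" by (rule good_separated[OF gF])
  show "C (strand F :: 'k rep)" by (rule C_strand[OF gF])
  fix A B :: "'k rep" and p f assume a: "epi C A B p \<and> rep_hom (strand F) B f"
  then have AB: "C A" "C B" and p: "rep_hom A B p" and f: "rep_hom (strand F) B f" by (auto simp: epi_def)
  note A = C_rep[OF AB(1)] and B = C_rep[OF AB(2)]
  have surj: "p x ` obj A x = obj B x" for x using epi_surj a by blast
  let ?b = "\<lambda>q. nx (fst q)"
  have bin: "?b q \<in> tot F" if "q \<in> F" for q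
    using goodD[OF gF that] nx_gt nx_le separated_less[OF F0 that] by (intro totI[OF that]) auto
  have "\<forall>q\<in>F. \<exists>w. w \<in> ob A (?b q) \<and> p (cov (?b q)) w = f (cov (?b q)) (basis_vec (?b q))"
  proof
    fix q assume "q \<in> F"
    then have "f (cov (?b q)) (basis_vec (?b q)) \<in> p (cov (?b q)) ` ob A (?b q)"
      using rep_hom_in[OF f basis_vec_in_strand[OF bin]] surj by simp
    then show "\<exists>w. w \<in> ob A (?b q) \<and> p (cov (?b q)) w = f (cov (?b q)) (basis_vec (?b q))" by auto
  qed
  from bchoice[OF this] obtain w where
    w: "\<forall>q\<in>F. w q \<in> ob A (?b q) \<and> p (cov (?b q)) (w q) = f (cov (?b q)) (basis_vec (?b q))" by blast
  have w1: "w q \<in> ob A (?b q)" if "q \<in> F" for q using w that by blast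
  have w2: "pth A (?b q) t (w q) = 0" if "q \<in> F" "snd q < t" for q t
    using F that goodD[OF gF that(1)] w1[OF that(1)]
    by (intro nilpotent_beyond[OF A C_cellwise[OF AB(1)] C_nilpotent[OF AB(1)]]) (auto simp: full_def)
  obtain g where g: "rep_hom (strand F) A g" "\<And>q. q \<in> F \<Longrightarrow> g (cov (?b q)) (basis_vec (?b q)) = w q"
    using hom_from_generators[OF A C_cellwise[OF AB(1)] gF, of w] w1 w2 by blast
  have "hom_eq (strand F) (hom_comp p g) f"
    by (rule hom_generators_eq[OF B C_cellwise[OF AB(2)] gF rep_hom_comp[OF g(1) p] f])
      (use g(2) w in \<open>simp add: hom_comp_def\<close>)
  then show "\<exists>g. rep_hom (strand F) A g \<and> hom_eq (strand F) (hom_comp p g) f" using g(1) by blast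
qed

text \<open>A functional at the last point of a full string extends along a monomorphism.  The extension
  defines a homomorphism to the string, because the path between the two ends of its
  interval acts by zero on all of \<open>C\<close>.\<close>

lemma injective_full:
  assumes F: "full F"
  shows "injective C (strand F :: 'k::field rep)"
  unfolding injective_def
proof (intro conjI allI impI)
  have gF: "good F" using F by (simp add: full_def)
  have F0: "separated 0 F" by (rule good_separated[OF gF])
  show "C (strand F :: 'k rep)" by (rule C_strand[OF gF])
  fix A B :: "'k rep" and i f assume a: "monic C A B i \<and> rep_hom A (strand F) f"
  then have AB: "C A" "C B" and i: "rep_hom A B i" and f: "rep_hom A (strand F) f" by (auto simp: monic_def)
  note A = C_rep[OF AB(1)] and B = C_rep[OF AB(2)]
  have inj: "inj_on (i x) (obj A x)" for x using monic_inj a by blast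
  have ex: "\<exists>\<phi>. functional \<phi> \<and> (\<forall>v\<in>ob A (snd q). \<phi> (i (cov (snd q)) v) = f (cov (snd q)) v (snd q))" for q
  proof -
    obtain \<phi> where "functional \<phi>" "\<And>v. v \<in> ob A (snd q) \<Longrightarrow> \<phi> (i (cov (snd q)) v) = f (cov (snd q)) v (snd q)"
    proof (rule functional_extension[OF rep_hom_linear[OF i] is_rep_subspace[OF A] inj,
          of "cov (snd q)" "\<lambda>v. f (cov (snd q)) v (snd q)"])
      show "f (cov (snd q)) (v + w) (snd q) = f (cov (snd q)) v (snd q) + f (cov (snd q)) w (snd q)"
        if "v \<in> ob A (snd q)" "w \<in> ob A (snd q)" for v w
        using linear_between_add[OF rep_hom_linear[OF f] that] by simp
      show "f (cov (snd q)) (rscale c v) (snd q) = c * f (cov (snd q)) v (snd q)"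
        if "v \<in> ob A (snd q)" for c v
        using linear_between_scale[OF rep_hom_linear[OF f] that] by simp
    qed blast
    then show ?thesis by blast
  qed
  define \<phi> where "\<phi> q = (SOME \<phi>. functional \<phi> \<and>
    (\<forall>v\<in>ob A (snd q). \<phi> (i (cov (snd q)) v) = f (cov (snd q)) v (snd q)))" for q :: "real \<times> real"
  have \<phi>: "functional (\<phi> q)" "\<And>v. v \<in> ob A (snd q) \<Longrightarrow> \<phi> q (i (cov (snd q)) v) = f (cov (snd q)) v (snd q)" for q
    using someI_ex[OF ex[of q]] unfolding \<phi>_def[symmetric] by blast+
  define g where "g = to_strand B F \<phi>"
  have g: "rep_hom B (strand F) g"
    unfolding g_def
  proof (rule hom_to_strand[OF B F0 \<phi>(1)])
    fix q s v assume q: "q \<in> F" "s \<le> fst q" "v \<in> ob B s"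
    have "fst q \<le> snd q" using separated_less[OF F0 q(1)] by simp
    then have "pth B s (snd q) v = pth B (fst q) (snd q) (pth B s (fst q) v)"
      using pth_comp[OF B q(2) _ q(3)] by simp
    also have "\<dots> = 0"
      using C_nilpotent[OF AB(2)] goodD[OF gF q(1)] pth_in[OF B q(3)] F q(1)
      by (simp add: nilpotent_def full_def)
    finally show "\<phi> q (pth B s (snd q) v) = 0" using functional_0[OF \<phi>(1)] by simp
  qed
  have "hom_eq A (hom_comp g i) f"
    unfolding hom_eq_def hom_comp_def comp_def
  proof (intro allI ballI ext)
    fix x v t assume v: "v \<in> obj A x"
    have fv: "f x v \<in> obj (strand F) x" by (rule rep_hom_in[OF f v])
    show "g x (i x v) t = f x v t"
    proof (cases "cov t = x \<and> t \<in> tot F")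
      case False
      then have "f x v t = 0" using strand_supp[OF fv, of t] by blast
      then show ?thesis using False by (auto simp: g_def to_strand_def)
    next
      case True
      then obtain q where q: "q \<in> F" "fst q < t" "t \<le> snd q" by (auto elim: totE)
      have v': "v \<in> ob A t" and fv': "f x v \<in> ob (strand F) t" using v fv True by auto
      have "g x (i x v) t = \<phi> q (pth B t (snd q) (i x v))"
        using to_strand_apply[OF F0 q, of B \<phi> "i x v"] True by (simp add: g_def)
      also have "pth B t (snd q) (i x v) = i (cov (snd q)) (pth A t (snd q) v)"
        using rep_hom_pth[OF i v', of "snd q"] True by simp
      also have "\<phi> q \<dots> = f (cov (snd q)) (pth A t (snd q) v) (snd q)" by (rule \<phi>(2)[OF pth_in[OF A v']])
      also have "\<dots> = pth (strand F) t (snd q) (f x v) (snd q)"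
        using rep_hom_pth[OF f v', of "snd q"] True by simp
      also have "\<dots> = f x v t"
      proof -
        have "same F t (snd q)" using q unfolding same_def by blast
        then show ?thesis using pth_strand[OF F0 fv' q(3), of "snd q"] by simp
      qed
      finally show ?thesis .
    qed
  qed
  then show "\<exists>g. rep_hom B (strand F) g \<and> hom_eq A (hom_comp g i) f" using g by blast
qed

section \<open>Covers and envelopes\<close>

definition proj_ext :: "(real \<times> real) set \<Rightarrow> (real \<times> real) set" where
  "proj_ext F = (\<lambda>p. (fst p, nx (fst p) + 2 * pi)) ` F"

definition inj_ext :: "(real \<times> real) set \<Rightarrow> (real \<times> real) set" where
  "inj_ext F = (\<lambda>p. (pr (snd p) - 2 * pi, snd p)) ` F"

lemma L_plus: "w \<in> L \<Longrightarrow> w + 2 * pi \<in> L" and L_minus: "w \<in> L \<Longrightarrow> w - 2 * pi \<in> L"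
  using L_shift[of w 1] L_shift[of w "-1"] by auto

lemma nx_minus: "w \<in> L \<Longrightarrow> nx (w - 2 * pi) = nx w - 2 * pi"
  using nx_shift[of w "-1"] by simp

lemma full_proj_ext:
  assumes sep: "separated (2 * pi) F" and F: "good F"
  shows "full (proj_ext F)"
proof -
  have g: "fst p \<in> L" "snd p \<in> L" "snd p \<le> nx (fst p) + 2 * pi" "fst p < snd p" if "p \<in> F" for p
    using goodD[OF F that] separated_less[OF sep that] by auto
  have le: "nx (fst p) + 2 * pi \<le> snd p + 2 * pi" if "p \<in> F" for p
    using nx_le g[OF that] by simp
  have "separated 0 (proj_ext F)"
    unfolding separated_def
  proof (intro conjI ballI impI)
    show "finite (proj_ext F)" using separated_finite[OF sep] by (simp add: proj_ext_def)
    show "fst q < snd q" if q: "q \<in> proj_ext F" for q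
    proof -
      obtain p where p: "p \<in> F" "q = (fst p, nx (fst p) + 2 * pi)" using q by (auto simp: proj_ext_def)
      have "fst p < nx (fst p) + 2 * pi" using nx_gt[OF g(1)[OF p(1)]] pi_gt_zero by linarith
      then show ?thesis using p(2) by simp
    qed
    fix q q' assume "q \<in> proj_ext F" "q' \<in> proj_ext F" "q \<noteq> q'"
    then obtain p p' where p: "p \<in> F" "p' \<in> F" "p \<noteq> p'"
      "q = (fst p, nx (fst p) + 2 * pi)" "q' = (fst p', nx (fst p') + 2 * pi)"
      by (auto simp: proj_ext_def)
    have "snd p + 2 * pi \<le> fst p' \<or> snd p' + 2 * pi \<le> fst p"
      using sep p(1-3) unfolding separated_def by blast
    then show "snd q + 0 \<le> fst q' \<or> snd q' + 0 \<le> fst q"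
      using le[OF p(1)] le[OF p(2)] p(4,5) by auto
  qed
  moreover have "fst q \<in> L \<and> snd q \<in> L \<and> snd q = nx (fst q) + 2 * pi" if q: "q \<in> proj_ext F" for q
  proof -
    obtain p where p: "p \<in> F" "q = (fst p, nx (fst p) + 2 * pi)" using q by (auto simp: proj_ext_def)
    then show ?thesis using g(1)[OF p(1)] L_plus[OF nx_in] by simp
  qed
  ultimately show ?thesis unfolding full_def good_def by (metis order_refl)
qed

lemma full_inj_ext:
  assumes sep: "separated (2 * pi) F" and F: "good F"
  shows "full (inj_ext F)"
proof -
  have g: "fst p \<in> L" "snd p \<in> L" "snd p \<le> nx (fst p) + 2 * pi" "fst p < snd p" if "p \<in> F" for p
    using goodD[OF F that] separated_less[OF sep that] by auto
  have le: "fst p - 2 * pi \<le> pr (snd p) - 2 * pi" if "p \<in> F" for p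
  proof -
    have "\<not> pr (snd p) < fst p"
      using nx_le[OF pr_in g(1), of "snd p" p] nx_pr[of "snd p"] g[OF that] that by auto
    then show ?thesis by simp
  qed
  have lt: "pr (snd p) < snd p" if "p \<in> F" for p
    using nx_gt[OF pr_in[OF g(2)[OF that]]] nx_pr[OF g(2)[OF that]] by simp
  have "separated 0 (inj_ext F)"
    unfolding separated_def
  proof (intro conjI ballI impI)
    show "finite (inj_ext F)" using separated_finite[OF sep] by (simp add: inj_ext_def)
    show "fst q < snd q" if q: "q \<in> inj_ext F" for q
    proof -
      obtain p where p: "p \<in> F" "q = (pr (snd p) - 2 * pi, snd p)" using q by (auto simp: inj_ext_def)
      have "pr (snd p) - 2 * pi < snd p" using lt[OF p(1)] pi_gt_zero by linarith
      then show ?thesis using p(2) by simp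
    qed
    fix q q' assume "q \<in> inj_ext F" "q' \<in> inj_ext F" "q \<noteq> q'"
    then obtain p p' where p: "p \<in> F" "p' \<in> F" "p \<noteq> p'"
      "q = (pr (snd p) - 2 * pi, snd p)" "q' = (pr (snd p') - 2 * pi, snd p')"
      by (auto simp: inj_ext_def)
    have "snd p + 2 * pi \<le> fst p' \<or> snd p' + 2 * pi \<le> fst p"
      using sep p(1-3) unfolding separated_def by blast
    then show "snd q + 0 \<le> fst q' \<or> snd q' + 0 \<le> fst q"
      using le[OF p(1)] le[OF p(2)] p(4,5) by auto
  qed
  moreover have "fst q \<in> L \<and> snd q \<in> L \<and> snd q = nx (fst q) + 2 * pi" if q: "q \<in> inj_ext F" for q
  proof -
    obtain p where p: "p \<in> F" "q = (pr (snd p) - 2 * pi, snd p)" using q by (auto simp: inj_ext_def)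
    then show ?thesis
      using g(2)[OF p(1)] L_minus[OF pr_in] nx_minus[OF pr_in] nx_pr by simp
  qed
  ultimately show ?thesis unfolding full_def good_def by (metis order_refl)
qed

text \<open>The cover prolongs each string of \<open>M\<close> to the right.  A basis vector that is killed lies beyond the end
  of the original string, hence in the image of the step before it.  So the kernel does not meet the
  top, and minimality follows from Nakayama's lemma.\<close>

lemma projective_cover_strand:
  assumes CM: "C (M :: 'k::field rep)" and sep: "separated (2 * pi) F" and F: "good F"
    and f: "is_iso M (strand F) f"
  shows "\<exists>p. projective_cover C M (strand (proj_ext F)) p"
proof -
  let ?P = "proj_ext F"
  have full: "full ?P" by (rule full_proj_ext[OF sep F])
  have gP: "good ?P" using full by (simp add: full_def)
  have P0: "separated 0 ?P" by (rule good_separated[OF gP])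
  have F0: "separated 0 F" by (rule good_separated[OF F])
  have M: "is_rep M" by (rule C_rep[OF CM])
  have CP: "C (strand ?P :: 'k rep)" by (rule C_strand[OF gP])
  have FP: "\<exists>q\<in>?P. fst q = fst p \<and> snd p \<le> snd q" if "p \<in> F" for p
    using goodD[OF F that] that unfolding proj_ext_def by auto
  have PF: "\<exists>p\<in>F. fst q = fst p \<and> snd p \<le> snd q \<and> snd p \<in> L \<and> fst p < snd p" if q: "q \<in> ?P" for q
  proof -
    obtain p where p: "p \<in> F" "q = (fst p, nx (fst p) + 2 * pi)" using q by (auto simp: proj_ext_def)
    then show ?thesis using goodD[OF F p(1)] separated_less[OF F0 p(1)] by auto
  qed
  define r :: "'k nat_trans" where "r = (\<lambda>x v t. if t \<in> tot F then v t else 0)"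
  have sub: "v \<in> obj (strand ?P) x" if "v \<in> obj (strand F) x" for v :: "'k rfun" and x
  proof -
    have "tot F \<subseteq> tot ?P"
    proof
      fix t assume "t \<in> tot F"
      then obtain p where p: "p \<in> F" "fst p < t" "t \<le> snd p" by (rule totE)
      then show "t \<in> tot ?P" using FP[OF p(1)] by (auto intro: totI)
    qed
    then show ?thesis using that unfolding obj_strand by blast
  qed
  have rid: "r x v = v" if "v \<in> obj (strand F) x" for x v
    using that unfolding obj_strand r_def by (intro ext) auto
  have r: "rep_hom (strand ?P) (strand F) r" unfolding r_def by (rule strand_restriction[OF P0 F0 FP])
  have rin: "r x v \<in> obj (strand F) x" if "v \<in> obj (strand ?P) x" for x v
    by (rule rep_hom_in[OF r that])
  define p where "p = hom_comp (iso_inv M f) r"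
  have ii: "is_iso (strand F) M (iso_inv M f)" by (rule is_iso_inv[OF f M])
  have p: "rep_hom (strand ?P) M p" unfolding p_def by (rule rep_hom_comp[OF r is_iso_hom[OF ii]])
  have psurj: "p x ` obj (strand ?P) x = obj M x" for x
  proof (intro equalityI subsetI)
    fix v assume v: "v \<in> obj M x"
    have "f x v \<in> obj (strand F) x" by (rule rep_hom_in[OF is_iso_hom[OF f] v])
    then have "p x (f x v) = v" "f x v \<in> obj (strand ?P) x"
      using rid sub iso_inv_left[OF f v] by (auto simp: p_def hom_comp_def)
    then show "v \<in> p x ` obj (strand ?P) x" by force
  qed (use rep_hom_in[OF p] in auto)
  have ker: "\<exists>u\<in>ob (strand ?P) w. v = pth (strand ?P) w (nx w) u"
    if w: "w \<in> L" and v: "v \<in> ob (strand ?P) (nx w)" and rv: "r (cov (nx w)) v = 0"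
    for w and v :: "'k rfun"
  proof -
    define d where "d = nx w - w"
    have wd: "w \<le> nx w" using nx_gt[OF w] by simp
    have key: "\<exists>q\<in>?P. fst q < t - d \<and> t \<le> snd q" "cov (t - d) = cov w" if nz: "v t \<noteq> 0" for t
    proof -
      have t: "cov t = cov (nx w)" "t \<in> tot ?P" using strand_supp[OF v nz] by auto
      show c: "cov (t - d) = cov w" using cov_diff_cong[OF t(1), of d] by (simp add: d_def)
      have td: "t - d \<in> L" "nx (t - d) = t" using L_cong[OF c] nx_cong[OF w c[symmetric]] w by (auto simp: d_def)
      have "r (cov (nx w)) v t = 0" using rv by simp
      then have nF: "t \<notin> tot F" using nz by (auto simp: r_def)
      obtain q where q: "q \<in> ?P" "fst q < t" "t \<le> snd q" using t(2) by (rule totE)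
      obtain p where p: "p \<in> F" "fst q = fst p" "snd p \<in> L" "fst p < snd p" using PF[OF q(1)] by blast
      have "snd p < t" using nF p q by (auto simp: not_less intro: totI)
      then have "snd p \<le> t - d" using nx_le[OF td(1) p(3)] td(2) by linarith
      then show "\<exists>q\<in>?P. fst q < t - d \<and> t \<le> snd q" using p(2,4) q(1,3) by (intro bexI[of _ q]) auto
    qed
    define u where "u t = v (t + d)" for t
    have u: "u \<in> ob (strand ?P) w"
      unfolding obj_strand
    proof (intro allI impI)
      fix t assume "u t \<noteq> 0"
      then have *: "\<exists>q\<in>?P. fst q < t \<and> t + d \<le> snd q" "cov t = cov w" using key[of "t + d"] by (auto simp: u_def)
      then obtain q where "q \<in> ?P" "fst q < t" "t + d \<le> snd q" by blast
      then have "t \<in> tot ?P" using wd by (intro totI[of q]) (auto simp: d_def)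
      then show "cov t = cov w \<and> t \<in> tot ?P" using * by blast
    qed
    have "pth (strand ?P) w (nx w) u t = v t" for t
    proof (cases "v t = 0")
      case True
      then show ?thesis unfolding pth_strand[OF P0 u wd] by (simp add: u_def d_def)
    next
      case False
      then have "same ?P (t - d) t" "cov t = cov (nx w)"
        using key(1)[OF False] strand_supp[OF v False] unfolding same_def by auto
      then show ?thesis unfolding pth_strand[OF P0 u wd] by (simp add: u_def d_def)
    qed
    then have "v = pth (strand ?P) w (nx w) u" by (intro ext) simp
    then show ?thesis using u by blast
  qed
  have "projective_cover C M (strand ?P) p"
    unfolding projective_cover_def
  proof (intro conjI allI impI)
    show "projective C (strand ?P :: 'k rep)" by (rule projective_full[OF full])
    show "epi C (strand ?P) M p" by (rule epi_if_surj[OF CP CM p psurj])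
    fix X g assume a: "C X \<and> rep_hom X (strand ?P) g \<and> epi C X M (hom_comp p g)"
    then have X: "C X" and g: "rep_hom X (strand ?P) g" by auto
    have s: "hom_comp p g x ` obj X x = obj M x" for x using epi_surj a by blast
    show "epi C X (strand ?P) g"
    proof (rule epi_if_surj[OF X CP g])
      show "g x ` obj X x = obj (strand ?P) x" for x
      proof (rule nakayama_top[OF C_rep[OF X] C_cellwise[OF X] C_rep[OF CP] C_cellwise[OF CP] C_nilpotent[OF CP] g])
        fix w and v :: "'k rfun" assume w: "w \<in> L" and v: "v \<in> ob (strand ?P) (nx w)"
        let ?x = "cov (nx w)"
        have "p ?x v \<in> hom_comp p g ?x ` ob X (nx w)" using s rep_hom_in[OF p v] by simp
        then obtain b where b: "b \<in> ob X (nx w)" "p ?x v = p ?x (g ?x b)" by (auto simp: hom_comp_def)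
        have gb: "g ?x b \<in> ob (strand ?P) (nx w)" by (rule rep_hom_in[OF g b(1)])
        have d: "v - g ?x b \<in> ob (strand ?P) (nx w)" by (rule rf.subspace_diff[OF subspace_strand v gb])
        have "r ?x v = r ?x (g ?x b)"
          using b(2) is_iso_inj[OF ii rin[OF v] rin[OF gb]] by (simp add: p_def hom_comp_def)
        then have "r ?x (v - g ?x b) = 0" using rep_hom_diff[OF r is_rep_strand[OF P0] v gb] by simp
        then obtain u where u: "u \<in> ob (strand ?P) w" "v - g ?x b = pth (strand ?P) w (nx w) u"
          using ker[OF w d] by blast
        have "v = g ?x b + pth (strand ?P) w (nx w) u" unfolding u(2)[symmetric] by simp
        then show "\<exists>a\<in>ob X (nx w). \<exists>u\<in>ob (strand ?P) w. v = g ?x a + pth (strand ?P) w (nx w) u"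
          using b(1) u(1) by blast
      qed
    qed
  qed
  then show ?thesis by blast
qed

text \<open>The envelope prolongs each string of \<open>M\<close> to the left.  Its socle is spanned by the basis vectors at the
  right ends, all of which lie in \<open>M\<close>; so a homomorphism that is injective on \<open>M\<close> has no kernel.\<close>

lemma injective_envelope_strand:
  assumes CM: "C (M :: 'k::field rep)" and sep: "separated (2 * pi) F" and F: "good F"
    and f: "is_iso M (strand F) f"
  shows "\<exists>i. injective_envelope C M (strand (inj_ext F)) i"
proof -
  let ?J = "inj_ext F"
  have full: "full ?J" by (rule full_inj_ext[OF sep F])
  have gJ: "good ?J" using full by (simp add: full_def)
  have J0: "separated 0 ?J" by (rule good_separated[OF gJ])
  have F0: "separated 0 F" by (rule good_separated[OF F])
  have M: "is_rep M" by (rule C_rep[OF CM])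
  have CJ: "C (strand ?J :: 'k rep)" by (rule C_strand[OF gJ])
  have FJ: "\<exists>q\<in>?J. snd q = snd p \<and> fst q \<le> fst p" if p: "p \<in> F" for p
  proof -
    note g = goodD[OF F p]
    have "pr (snd p) - 2 * pi \<le> fst p"
    proof (rule ccontr)
      assume "\<not> ?thesis"
      then have "fst p + 2 * pi < pr (snd p)" by simp
      then have "nx (fst p) + 2 * pi \<le> pr (snd p)"
        using nx_le[OF L_plus pr_in, of "fst p" "snd p"] nx_shift[of "fst p" 1] g by simp
      then show False using g nx_gt[OF pr_in, of "snd p"] nx_pr[of "snd p"] by simp
    qed
    then show ?thesis using p unfolding inj_ext_def by (auto intro!: bexI[of _ p])
  qed
  have incl: "rep_hom (strand F) (strand ?J) (\<lambda>x (v :: 'k rfun). v)"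
    by (rule strand_inclusion[OF J0 F0 FJ])
  define i where "i = hom_comp (\<lambda>x v. v) f"
  have i_apply: "i x v = f x v" for x v by (simp add: i_def hom_comp_def)
  have i: "rep_hom M (strand ?J) i" unfolding i_def by (rule rep_hom_comp[OF is_iso_hom[OF f] incl])
  have iinj: "inj_on (i x) (obj M x)" for x
    unfolding i_apply[abs_def] using is_iso_inj[OF f] by (intro inj_onI) blast
  have soc: "v \<in> ob (strand F) w"
    if w: "w \<in> L" and v: "v \<in> ob (strand ?J) w" "pth (strand ?J) w (nx w) v = 0" for w and v :: "'k rfun"
    unfolding obj_strand
  proof (intro allI impI)
    fix t assume nz: "v t \<noteq> 0"
    have t: "cov t = cov w" "t \<in> tot ?J" using strand_supp[OF v(1) nz] by auto
    have tL: "t \<in> L" "nx t = nx w + (t - w)" using L_cong[OF t(1)] nx_cong[OF w t(1)[symmetric]] w by auto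
    have wn: "w \<le> nx w" using nx_gt[OF w] by simp
    obtain q where q: "q \<in> ?J" "fst q < t" "t \<le> snd q" using t(2) by (rule totE)
    obtain p where p: "p \<in> F" "snd q = snd p" using q(1) by (auto simp: inj_ext_def)
    have "t = snd q"
    proof (rule ccontr)
      assume "t \<noteq> snd q"
      then have "nx t \<le> snd q" using nx_le[OF tL(1), of "snd q"] q goodD[OF gJ q(1)] by simp
      then have "same ?J t (nx t)" using q unfolding same_def by blast
      moreover have "cov (nx t) = cov (nx w)"
      proof -
        have "nx t = t + (nx w - w)" "nx w = w + (nx w - w)" using tL(2) by simp_all
        then show ?thesis using cov_add_cong[OF t(1), of "nx w - w"] by (simp only:)
      qed
      moreover have "nx t - (nx w - w) = t" using tL(2) by simp
      ultimately have "pth (strand ?J) w (nx w) v (nx t) = v t" using pth_strand[OF J0 v(1) wn, of "nx t"] by simp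
      then show False using nz v(2) by simp
    qed
    then show "cov t = cov w \<and> t \<in> tot F"
      using t(1) p separated_less[OF F0 p(1)] by (auto intro!: totI[of p])
  qed
  have "injective_envelope C M (strand ?J) i"
    unfolding injective_envelope_def
  proof (intro conjI allI impI)
    show "injective C (strand ?J :: 'k rep)" by (rule injective_full[OF full])
    show "monic C M (strand ?J) i" by (rule monic_if_inj[OF CM CJ i iinj])
    fix X g assume a: "C X \<and> rep_hom (strand ?J) X g \<and> monic C M X (hom_comp g i)"
    then have X: "C X" and g: "rep_hom (strand ?J) X g" by auto
    have s: "inj_on (hom_comp g i x) (obj M x)" for x using monic_inj a by blast
    show "monic C (strand ?J) X g"
    proof (rule monic_if_inj[OF CJ X g])
      show "inj_on (g x) (obj (strand ?J) x)" for x
      proof (rule nakayama_socle[OF C_rep[OF CJ] C_cellwise[OF CJ] C_nilpotent[OF CJ] C_rep[OF X] g])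
        fix w and v :: "'k rfun"
        assume w: "w \<in> L" and v: "v \<in> ob (strand ?J) w" "g (cov w) v = 0" "pth (strand ?J) w (nx w) v = 0"
        have vF: "v \<in> ob (strand F) w" by (rule soc[OF w v(1,3)])
        define y where "y = iso_inv M f (cov w) v"
        have y: "y \<in> ob M w" "f (cov w) y = v"
          using iso_inv_in[OF f vF] iso_inv_right[OF f vF] by (auto simp: y_def)
        have f0: "f (cov w) 0 = 0" by (rule rep_hom_0[OF is_iso_hom[OF f] M])
        have "hom_comp g i (cov w) y = hom_comp g i (cov w) 0"
          using v(2) y(2) f0 rep_hom_0[OF g C_rep[OF CJ]] by (simp add: hom_comp_def i_apply)
        then have "y = 0" using inj_onD[OF s _ y(1) ob_zero[OF M]] by blast
        then show "v = 0" using y(2) f0 by simp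
      qed
    qed
  qed
  then show ?thesis by blast
qed

end

section \<open>Subobjects of strings\<close>

lemma subrep_image:
  assumes M: "is_rep M" and f: "is_iso M S f" and N: "subrep M N"
  shows "subrep S (\<lambda>x. f x ` N x)" "is_iso (restrict_rep M N) (restrict_rep S (\<lambda>x. f x ` N x)) f"
proof -
  have sub: "v \<in> obj M x" if "v \<in> N x" for v x using subrep_sub[OF N] that by blast
  have linN: "linear_between (N x) (obj S x) (f x)" for x
    using rep_hom_linear[OF is_iso_hom[OF f], of x] sub by (auto simp: linear_between_def)
  have step: "pth S s t (f (cov s) v) = f (cov t) (pth M s t v)" if "v \<in> N (cov s)" for s t v
    using rep_hom_pth[OF is_iso_hom[OF f] sub[OF that]] by simp
  show "subrep S (\<lambda>x. f x ` N x)"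
  proof (rule subrepI)
    show "rf.subspace (f x ` N x)" for x
      by (rule linear_between_image_subspace[OF linN subrep_subspace[OF N]])
    show "f x ` N x \<subseteq> obj S x" for x using linear_between_in[OF linN] by blast
    show "pth S s t v \<in> f (cov t) ` N (cov t)" if "v \<in> f (cov s) ` N (cov s)" for s t v
      using that step subrep_pth[OF N] by auto
  qed
  show "is_iso (restrict_rep M N) (restrict_rep S (\<lambda>x. f x ` N x)) f"
    unfolding is_iso_def
  proof (intro conjI allI)
    show "rep_hom (restrict_rep M N) (restrict_rep S (\<lambda>x. f x ` N x)) f"
    proof (rule rep_homI)
      show "linear_between (ob (restrict_rep M N) s) (ob (restrict_rep S (\<lambda>x. f x ` N x)) s) (f (cov s))" for s
        using linN[of "cov s"] by (auto simp: linear_between_def)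
    qed (use step in auto)
    show "bij_betw (f x) (obj (restrict_rep M N) x) (obj (restrict_rep S (\<lambda>x. f x ` N x)) x)" for x
      unfolding bij_betw_def using is_iso_inj[OF f sub sub] by (simp add: inj_on_def)
  qed
qed

context circle_cells
begin

text \<open>Over a point of the circle a string has at most two basis vectors, and going once round the
  circle maps the first to the second.  Hence a subrepresentation contains with any vector all basis
  vectors in its support, so that it is given by a final segment of the interval; and constancy on
  cells forces that segment to start at a point of \<open>L\<close>.\<close>

lemma strand_subrep:
  assumes ab: "good {(a, b)}" and N: "subrep (strand {(a, b)} :: 'k::field rep) N"
    and cw: "cellwise (restrict_rep (strand {(a, b)} :: 'k rep) N)"
  shows "N = (\<lambda>x. {0}) \<or> (\<exists>w\<in>L. a \<le> w \<and> w < b \<and> N = obj (strand {(w, b)}))"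
proof -
  let ?S = "strand {(a, b)} :: 'k rep"
  have S0: "separated 0 {(a, b)}" by (rule good_separated[OF ab])
  have S: "is_rep ?S" by (rule is_rep_strand[OF S0])
  have aL: "a \<in> L" "b \<in> L" "b \<le> nx a + 2 * pi" "a < b"
    using goodD[OF ab, of "(a, b)"] separated_less[OF S0, of "(a, b)"] by auto
  have tot: "t \<in> tot {(a, b)} \<longleftrightarrow> a < t \<and> t \<le> b" for t by (auto simp: tot_def)
  have sm: "same {(a, b)} s t \<longleftrightarrow> a < s \<and> t \<le> b" for s t by (auto simp: same_def)
  note sN = subrep_subspace[OF N]
  have NS: "v \<in> obj ?S x" if "v \<in> N x" for v x using subrep_sub[OF N] that by blast
  define U where "U = {t. a < t \<and> t \<le> b \<and> (basis_vec t :: 'k rfun) \<in> N (cov t)}"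
  have Ub: "a < t" "t \<le> b" if "t \<in> U" for t using that by (auto simp: U_def)
  have up: "t' \<in> U" if t: "t \<in> U" "t \<le> t'" "t' \<le> b" for t t'
  proof -
    have "pth ?S t t' (basis_vec t) \<in> N (cov t')" using t(1) by (intro subrep_pth[OF N]) (simp add: U_def)
    moreover have "pth ?S t t' (basis_vec t :: 'k rfun) = basis_vec t'"
      using pth_basis_vec[OF S0 _ t(2), where 'a = 'k] Ub[OF t(1)] t(3) by (simp add: tot sm)
    ultimately show ?thesis using Ub[OF t(1)] t by (simp add: U_def)
  qed
  have unscale: "(basis_vec t :: 'k rfun) \<in> N x" if "rscale c (basis_vec t) \<in> N x" "c \<noteq> 0" for t x c
  proof -
    have "rscale (inverse c) (rscale c (basis_vec t)) \<in> N x" by (rule rf.subspace_scale[OF sN that(1)])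
    then show ?thesis using that(2) by simp
  qed
  \<comment> \<open>The interval is shorter than two turns; so after subtracting what a full turn produces from \<open>v\<close>,
    only the first basis vector in the support of \<open>v\<close> is left.\<close>
  have first: "t \<in> U" if v: "v \<in> N (cov t)" "v t \<noteq> 0" and low: "\<And>r. r < t \<Longrightarrow> v r = 0" for v t
  proof -
    have t: "a < t" "t \<le> b" using strand_supp[OF NS[OF v(1)] v(2)] by (auto simp: tot)
    have t4: "b < t + 4 * pi" using aL nx_lt[OF aL(1)] t by linarith
    have supp: "r = t \<or> r = t + 2 * pi" if nz: "v r \<noteq> 0" for r
    proof -
      have r: "cov r = cov t" "r \<le> b" using strand_supp[OF NS[OF v(1)] nz] by (auto simp: tot)
      then obtain k :: int where k: "r = t + 2 * pi * of_int k" using cov_eq_iff[of t r] by auto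
      have "t \<le> r" using low[of r] nz by (meson not_less)
      then have "0 \<le> 2 * pi * (of_int k :: real)" using k by simp
      then have "0 \<le> k \<or> pi \<le> 0" by (auto simp: zero_le_mult_iff)
      then have "0 \<le> k" using pi_gt_zero by linarith
      have "2 * pi * (of_int k :: real) < 2 * pi * 2" using k r(2) t4 by linarith
      then have "(of_int k :: real) < 2" by (subst (asm) mult_less_cancel_left_pos) simp_all
      then have "k = 0 \<or> k = 1" using \<open>0 \<le> k\<close> by linarith
      then show ?thesis using k by auto
    qed
    have ex: "v = rscale (v t) (basis_vec t) + rscale (v (t + 2 * pi)) (basis_vec (t + 2 * pi))"
    proof (rule ext)
      fix r
      show "v r = (rscale (v t) (basis_vec t) + rscale (v (t + 2 * pi)) (basis_vec (t + 2 * pi))) r"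
        using supp[of r] by (cases "v r = 0") (auto simp: basis_vec_apply)
    qed
    have "rscale (v t) (basis_vec t) \<in> N (cov t)"
    proof (cases "v (t + 2 * pi) = 0")
      case True
      then show ?thesis using ex v(1) by simp
    next
      case False
      have ct: "cov (t + 2 * pi) = cov t" using cov_shift[of t 1] by simp
      have t2: "t + 2 * pi \<le> b" using strand_supp[OF NS[OF v(1)] False] by (simp add: tot)
      have tt: "t \<le> t + 2 * pi" by simp
      have "pth ?S t (t + 2 * pi) v = rscale (v t) (basis_vec (t + 2 * pi))"
      proof (rule ext)
        fix u
        show "pth ?S t (t + 2 * pi) v u = rscale (v t) (basis_vec (t + 2 * pi)) u"
        proof (cases "u = t + 2 * pi")
          case True
          then show ?thesis unfolding pth_strand[OF S0 NS[OF v(1)] tt] using t t2 by (simp add: sm basis_vec_apply)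
        next
          case False
          have "v (u - 2 * pi) = 0 \<or> b < u"
            using supp[of "u - 2 * pi"] False t4 by (cases "v (u - 2 * pi) = 0") auto
          then show ?thesis unfolding pth_strand[OF S0 NS[OF v(1)] tt]
            using False by (auto simp: sm basis_vec_apply)
        qed
      qed
      then have "rscale (v t) (basis_vec (t + 2 * pi)) \<in> N (cov t)"
        using subrep_pth[OF N v(1), of "t + 2 * pi"] ct by simp
      then have "(basis_vec (t + 2 * pi) :: 'k rfun) \<in> N (cov t)" by (rule unscale[OF _ v(2)])
      then have "v - rscale (v (t + 2 * pi)) (basis_vec (t + 2 * pi)) \<in> N (cov t)"
        by (intro rf.subspace_diff[OF sN v(1)] rf.subspace_scale[OF sN])
      moreover have "v - rscale (v (t + 2 * pi)) (basis_vec (t + 2 * pi)) = rscale (v t) (basis_vec t)"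
        unfolding diff_eq_eq by (rule ex)
      ultimately show ?thesis by simp
    qed
    then have "(basis_vec t :: 'k rfun) \<in> N (cov t)" by (rule unscale[OF _ v(2)])
    then show ?thesis using t by (simp add: U_def)
  qed
  have supp: "t \<in> U" if v: "v \<in> N x" "v t \<noteq> 0" for v x t
  proof -
    let ?T = "{r. v r \<noteq> 0}"
    have "?T \<subseteq> pts {(a, b)} x" using strand_supp[OF NS[OF v(1)]] by (auto simp: pts_def)
    then have fin: "finite ?T" by (rule finite_subset) (simp add: finite_pts)
    define m where "m = Min ?T"
    have m: "v m \<noteq> 0" using Min_in[OF fin] v(2) by (auto simp: m_def)
    have le: "m \<le> r" if "v r \<noteq> 0" for r using Min_le[OF fin] that by (simp add: m_def)
    have "cov m = x" using strand_supp[OF NS[OF v(1)] m] by simp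
    then have "m \<in> U" by (intro first[of v]) (use v m le in force)+
    moreover have "t \<le> b" using strand_supp[OF NS[OF v(1)] v(2)] by (simp add: tot)
    ultimately show ?thesis using up le[OF v(2)] by blast
  qed
  have NU: "v \<in> N x \<longleftrightarrow> (\<forall>t. v t \<noteq> 0 \<longrightarrow> cov t = x \<and> t \<in> U)" for v x
  proof
    assume "v \<in> N x"
    then show "\<forall>t. v t \<noteq> 0 \<longrightarrow> cov t = x \<and> t \<in> U" using supp strand_supp[OF NS] by blast
  next
    assume *: "\<forall>t. v t \<noteq> 0 \<longrightarrow> cov t = x \<and> t \<in> U"
    let ?T = "{t \<in> pts {(a, b)} x. t \<in> U}"
    have "finite ?T" using finite_pts[of "{(a, b)}" x] by simp
    then have "v = (\<Sum>t\<in>?T. rscale (v t) (basis_vec t))"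
      using * Ub by (intro expand_finite) (auto simp: pts_def tot)
    also have "\<dots> \<in> N x"
      by (intro rf.subspace_sum[OF sN] rf.subspace_scale[OF sN]) (auto simp: U_def pts_def)
    finally show "v \<in> N x" .
  qed
  show ?thesis
  proof (cases "U = {}")
    case True
    have "v \<in> N x \<longleftrightarrow> v = 0" for v x unfolding NU True by (auto simp: fun_eq_iff)
    then have "N = (\<lambda>x. {0})" by blast
    then show ?thesis by simp
  next
    case False
    have interval: "is_interval U"
      unfolding is_interval_1 using up Ub by (meson order_trans)
    have bounded: "bounded U"
      by (rule bounded_subset[of "{a..b}"]) (use less_imp_le[OF Ub(1)] Ub(2) in auto)
    have sat: "s \<in> U \<longleftrightarrow> t \<in> U"
      if st: "s \<le> t" and b1: "bij_path ?S s t" and b2: "bij_path (restrict_rep ?S N) s t" for s t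
    proof -
      have e: "a < s \<and> s \<le> b \<longleftrightarrow> a < t \<and> t \<le> b"
        using bij_path_string[of "{a<..b}" s t, where 'k = 'k] b1 st by (simp add: string_eq_strand)
      show ?thesis
      proof
        assume "s \<in> U"
        then show "t \<in> U" using up[OF _ st] e Ub by blast
      next
        assume t: "t \<in> U"
        then have bt: "(basis_vec t :: 'k rfun) \<in> ob (restrict_rep ?S N) t" by (simp add: U_def)
        obtain u where u: "u \<in> N (cov s)" "basis_vec t = pth ?S s t u"
          using bij_path_surj[OF b2 bt] by auto
        have s: "a < s" "s \<le> b" using e Ub[OF t] by auto
        have "pth ?S s t u t = u s"
          unfolding pth_strand[OF S0 NS[OF u(1)] st] using s Ub[OF t] by (simp add: sm)
        then have "u s \<noteq> 0" using u(2)[symmetric] by (simp add: basis_vec_apply)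
        then show "s \<in> U" by (rule supp[OF u(1)])
      qed
    qed
    obtain u e where ue: "u \<in> L" "e \<in> L" "u < e" "U = {u<..e}"
    proof (rule saturated_interval[OF False bounded interval])
      have cS: "cellwise ?S" by (rule cellwise_strand[OF ab])
      show "s \<in> U \<longleftrightarrow> t \<in> U" if "w \<in> L" "w < s" "s \<le> t" "t \<le> nx w" for w s t
        using sat[OF that(3) cell_bij[OF cS that] cell_bij[OF cw that]] .
      show "\<exists>d>0. \<forall>s t. p - d < s \<and> s \<le> t \<and> t < p + d \<longrightarrow> (s \<in> U \<longleftrightarrow> t \<in> U)" if p: "p \<in> Acc" for p
      proof -
        obtain d1 where d1: "0 < d1" "\<forall>s t. p - d1 < s \<and> s \<le> t \<and> t < p + d1 \<longrightarrow> bij_path ?S s t"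
          using acc_bij[OF cS p] by blast
        obtain d2 where d2: "0 < d2" "\<forall>s t. p - d2 < s \<and> s \<le> t \<and> t < p + d2 \<longrightarrow> bij_path (restrict_rep ?S N) s t"
          using acc_bij[OF cw p] by blast
        show ?thesis
        proof (intro exI[of _ "min d1 d2"] conjI allI impI)
          fix s t assume st: "p - min d1 d2 < s \<and> s \<le> t \<and> t < p + min d1 d2"
          have "p - d1 < s" "t < p + d1" "p - d2 < s" "t < p + d2" "s \<le> t"
            using st by (auto simp: min_def split: if_splits)
          then show "s \<in> U \<longleftrightarrow> t \<in> U" using d1(2) d2(2) by (intro sat) simp_all
        qed (use d1 d2 in simp)
      qed
    qed
    have "e = b"
    proof -
      have "e \<in> U" using ue by simp
      then have "b \<in> U" "e \<le> b" using up[of e b] Ub[of e] by auto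
      then show ?thesis using ue(4) by simp
    qed
    moreover have "a \<le> u"
    proof (rule ccontr)
      assume "\<not> a \<le> u"
      then have "a \<in> U" using ue(4) aL(4) \<open>e = b\<close> by simp
      then show False using Ub(1)[of a] by simp
    qed
    moreover have "N = obj (strand {(u, b)})"
    proof (intro ext set_eqI)
      fix x v
      show "v \<in> N x \<longleftrightarrow> v \<in> obj (strand {(u, b)}) x"
        unfolding NU obj_strand using ue(4) \<open>e = b\<close> by (simp add: tot_def)
    qed
    ultimately show ?thesis using ue by blast
  qed
qed

definition tail :: "'k::field rep \<Rightarrow> 'k nat_trans \<Rightarrow> real \<Rightarrow> real \<Rightarrow> circle \<Rightarrow> 'k rfun set" where
  "tail M f b w = part M f {(w, b)}"

end

text \<open>Arguing about an object isomorphic to a string, rather than about the string itself, covers all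
  indecomposable objects at once.\<close>

locale string_object = circle_cells +
  fixes M :: "'k::field rep" and f :: "'k nat_trans" and a b :: real
  assumes M: "is_rep M" and ab: "good {(a, b)}" and f: "is_iso M (strand {(a, b)}) f"
begin

lemma ends: "a \<in> L" "b \<in> L" "a < b" "b \<le> nx a + 2 * pi"
  using goodD[OF ab, of "(a, b)"] separated_less[OF good_separated[OF ab], of "(a, b)"] by auto

lemma C_M: "C M"
  by (rule C_intro[OF M f ab])

lemma good_tail: "w \<in> L \<Longrightarrow> a \<le> w \<Longrightarrow> w < b \<Longrightarrow> good {(w, b)}"
  using ends nx_mono[of a w] by (intro good_single) auto

lemma incl_tail: "a \<le> w \<Longrightarrow> w < b \<Longrightarrow> rep_hom (strand {(w, b)}) (strand {(a, b)}) (\<lambda>x (v :: 'k rfun). v)"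
  using ends by (intro strand_inclusion) (auto intro: separated_single)

lemma tail_iso: "a \<le> w \<Longrightarrow> w < b \<Longrightarrow> is_iso (restrict_rep M (tail M f b w)) (strand {(w, b)}) f"
  unfolding tail_def by (rule part_iso[OF incl_tail f])

lemma tail_subrep: "a \<le> w \<Longrightarrow> w < b \<Longrightarrow> subrep M (tail M f b w)"
  unfolding tail_def by (rule part_subrep[OF M incl_tail f separated_single])

lemma tail_subobject: "w \<in> L \<Longrightarrow> a \<le> w \<Longrightarrow> w < b \<Longrightarrow> subobject C M (tail M f b w)"
  unfolding subobject_def
  using tail_subrep C_intro[OF is_rep_restrict[OF M tail_subrep] tail_iso good_tail] by blast

lemma zero_subobject: "subobject C M (\<lambda>x. {0})"
  unfolding subobject_def
proof
  show s: "subrep M (\<lambda>x. {0})"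
    by (rule subrepI) (auto simp: rf.subspace_0[OF is_rep_subspace[OF M]] pth_0[OF M])
  have e: "obj (strand {} :: 'k rep) x = {0}" for x
    unfolding strand_def by (auto simp: tot_def fun_eq_iff)
  have S: "separated 0 {}" "good {}" by (auto simp: separated_def good_def)
  have "is_iso (restrict_rep M (\<lambda>x. {0})) (strand {}) (\<lambda>x v. v)"
    unfolding is_iso_def
  proof (intro conjI allI)
    show "rep_hom (restrict_rep M (\<lambda>x. {0})) (strand {}) (\<lambda>x v. v)"
      by (rule rep_homI)
        (auto simp: e linear_between_def pth_0[OF M] pth_0[OF is_rep_strand[OF S(1)]])
  qed (simp add: e bij_betw_def)
  then show "C (restrict_rep M (\<lambda>x. {0}))" by (rule C_intro[OF is_rep_restrict[OF M s] _ S(2)])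
qed

lemma subobject_cases:
  assumes N: "subobject C M N"
  shows "N = (\<lambda>x. {0}) \<or> (\<exists>w\<in>L. a \<le> w \<and> w < b \<and> N = tail M f b w)"
proof -
  have sN: "subrep M N" and CN: "C (restrict_rep M N)" using N by (auto simp: subobject_def)
  let ?N = "\<lambda>x. f x ` N x"
  note im = subrep_image[OF M f sN]
  have "cellwise (restrict_rep (strand {(a, b)}) ?N)"
    using cellwise_iso[OF im(2) is_rep_restrict[OF M sN]] C_cellwise[OF CN] by simp
  from strand_subrep[OF ab im(1) this] have cases: "?N = (\<lambda>x. {0}) \<or>
      (\<exists>w\<in>L. a \<le> w \<and> w < b \<and> ?N = obj (strand {(w, b)}))" .
  have mem: "v \<in> N x \<longleftrightarrow> v \<in> obj M x \<and> f x v \<in> ?N x" for v x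
    using is_iso_inj[OF f] subrep_sub[OF sN] by blast
  have f0: "f x 0 = 0" for x by (rule rep_hom_0[OF is_iso_hom[OF f] M])
  from cases show ?thesis
  proof
    assume z: "?N = (\<lambda>x. {0})"
    have "v \<in> N x \<longleftrightarrow> v = 0" for v x
    proof
      assume "v \<in> N x"
      moreover from this have "f x v \<in> ?N x" by (rule imageI)
      then have "f x v = f x 0" using fun_cong[OF z, of x] f0[of x] by simp
      moreover have "v \<in> obj M x" using mem[of v x] calculation(1) by simp
      ultimately have "v \<in> obj M x" "f x v = f x 0" by simp_all
      then show "v = 0"
        using is_iso_inj[OF f, of v x 0] rf.subspace_0[OF is_rep_subspace[OF M], of x] by simp
    next
      assume "v = 0"
      then show "v \<in> N x" using rf.subspace_0[OF subrep_subspace[OF sN]] by simp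
    qed
    then show ?thesis by blast
  next
    assume "\<exists>w\<in>L. a \<le> w \<and> w < b \<and> ?N = obj (strand {(w, b)})"
    then obtain w where w: "w \<in> L" "a \<le> w" "w < b" "?N = obj (strand {(w, b)})" by blast
    have "v \<in> N x \<longleftrightarrow> v \<in> tail M f b w x" for v x
      using mem[of v x] fun_cong[OF w(4), of x] by (auto simp: tail_def part_def)
    then have "N = tail M f b w" by blast
    then show ?thesis using w by blast
  qed
qed

lemma subobjects: "{N. subobject C M N} = insert (\<lambda>x. {0}) {tail M f b w | w. w \<in> L \<and> a \<le> w \<and> w < b}"
  using subobject_cases zero_subobject tail_subobject by blast

lemma tail_mono: "w \<le> w' \<Longrightarrow> tail M f b w' \<le> tail M f b w"
  by (auto simp: le_fun_def tail_def part_def obj_strand tot_def)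

lemma zero_le: "subobject C M N \<Longrightarrow> (\<lambda>x. {0}) \<le> N"
  using rf.subspace_0[OF subrep_subspace] by (auto simp: le_fun_def subobject_def)

lemma chain: "subobject C M N \<Longrightarrow> subobject C M K \<Longrightarrow> N \<le> K \<or> K \<le> N"
proof -
  assume N: "subobject C M N" and K: "subobject C M K"
  show "N \<le> K \<or> K \<le> N"
  proof (cases "N = (\<lambda>x. {0}) \<or> K = (\<lambda>x. {0})")
    case True
    then show ?thesis using zero_le[OF N] zero_le[OF K] by (elim disjE) simp_all
  next
    case False
    then obtain w w' where "N = tail M f b w" "K = tail M f b w'"
      using subobject_cases[OF N] subobject_cases[OF K] by blast
    then show ?thesis using tail_mono[of w w'] tail_mono[of w' w] by (cases "w \<le> w'") simp_all
  qed
qed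

text \<open>With this convention the next smaller subobject after the tail at \<open>w\<close> is the tail at \<open>nx w\<close>,
  even if \<open>w\<close> is the last point before \<open>b\<close>.\<close>

lemma tail_b: "tail M f b b = (\<lambda>x. {0})"
proof (intro ext set_eqI)
  fix x v
  have "obj (strand {(b, b)}) x = {0 :: 'k rfun}" by (auto simp: strand_def tot_def fun_eq_iff)
  then show "v \<in> tail M f b b x \<longleftrightarrow> v \<in> {0}"
    using is_iso_inj[OF f, of v x 0] rep_hom_0[OF is_iso_hom[OF f] M, of x] rf.subspace_0[OF is_rep_subspace[OF M], of x]
    by (auto simp: tail_def part_def)
qed

lemma tail_neq:
  assumes "w \<in> L" "a \<le> w" "w < b" "w < w'"
  shows "\<not> tail M f b w \<le> tail M f b w'"
proof
  assume le: "tail M f b w \<le> tail M f b w'"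
  let ?t = "min w' b" let ?e = "basis_vec ?t :: 'k rfun"
  have e: "?e \<in> ob (strand {(w, b)}) ?t" "?e \<in> ob (strand {(a, b)}) ?t"
    using assms by (auto intro!: basis_vec_in_strand simp: tot_def)
  then have "iso_inv M f (cov ?t) ?e \<in> tail M f b w (cov ?t)"
    using iso_inv_in[OF f e(2)] iso_inv_right[OF f e(2)] by (simp add: tail_def part_def)
  then have "iso_inv M f (cov ?t) ?e \<in> tail M f b w' (cov ?t)" using le by (auto simp: le_fun_def)
  then have "?e \<in> ob (strand {(w', b)}) ?t" using iso_inv_right[OF f e(2)] by (simp add: tail_def part_def)
  then have "?t \<in> tot {(w', b)}" using strand_supp[of ?e "{(w', b)}" "cov ?t" ?t] by (simp add: basis_vec_apply)
  then show False by (auto simp: tot_def)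
qed

lemma full_tail: "tail M f b a = obj M"
  using rep_hom_in[OF is_iso_hom[OF f]] by (auto simp: tail_def part_def fun_eq_iff)

lemma tail_quotient:
  assumes w: "w \<in> L" "a \<le> w" "w < b"
  shows "is_quotient M (tail M f b w) (tail M f b (nx w)) (strand {(w, nx w)})"
  unfolding is_quotient_def
proof
  have nw: "w < nx w" "nx w \<le> b" using nx_gt[OF w(1)] nx_le[OF w(1) ends(2) w(3)] .
  have S: "separated 0 {(w, nx w)}" "separated 0 {(w, b)}" using nw w by (auto intro: separated_single)
  show "is_rep (strand {(w, nx w)} :: 'k rep)" by (rule is_rep_strand[OF S(1)])
  define r where "r = (\<lambda>(x :: circle) (v :: 'k rfun) t. if t \<in> tot {(w, nx w)} then v t else 0)"
  have r: "rep_hom (strand {(w, b)}) (strand {(w, nx w)}) r"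
    unfolding r_def by (rule strand_restriction[OF S(2,1)]) (use nw in auto)
  define p where "p = hom_comp r f"
  have T: "is_iso (restrict_rep M (tail M f b w)) (strand {(w, b)}) f" by (rule tail_iso[OF w(2,3)])
  have p: "rep_hom (restrict_rep M (tail M f b w)) (strand {(w, nx w)}) p"
    unfolding p_def by (rule rep_hom_comp[OF is_iso_hom[OF T] r])
  have im: "p x ` tail M f b w x = obj (strand {(w, nx w)}) x" for x
  proof (intro equalityI subsetI)
    fix q :: "'k rfun" assume q: "q \<in> obj (strand {(w, nx w)}) x"
    have q': "q \<in> obj (strand {(w, b)}) x" using q nw by (auto simp: obj_strand tot_def)
    have "r x q = q" using q unfolding r_def obj_strand by (intro ext) auto
    then have "p x (iso_inv (restrict_rep M (tail M f b w)) f x q) = q"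
      using iso_inv_right[OF T q'] by (simp add: p_def hom_comp_def)
    moreover have "iso_inv (restrict_rep M (tail M f b w)) f x q \<in> tail M f b w x"
      using iso_inv_in[OF T q'] by simp
    ultimately show "q \<in> p x ` tail M f b w x" by force
  next
    fix q assume "q \<in> p x ` tail M f b w x"
    then show "q \<in> obj (strand {(w, nx w)}) x" using rep_hom_in[OF p, of _ x] by auto
  qed
  have ker: "{v \<in> tail M f b w x. p x v = 0} = tail M f b (nx w) x" for x
  proof -
    have "v \<in> tail M f b w x \<and> p x v = 0 \<longleftrightarrow> v \<in> tail M f b (nx w) x" for v
    proof
      assume v: "v \<in> tail M f b w x \<and> p x v = 0"
      have "cov t = x \<and> t \<in> tot {(nx w, b)}" if nz: "f x v t \<noteq> 0" for t
      proof -
        have fv: "f x v \<in> obj (strand {(w, b)}) x" using v by (simp add: tail_def part_def)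
        have "p x v t = 0" using v by simp
        then have "t \<notin> tot {(w, nx w)}" using nz by (auto simp: p_def hom_comp_def r_def)
        then show ?thesis using strand_supp[OF fv nz] by (auto simp: tot_def)
      qed
      then show "v \<in> tail M f b (nx w) x" using v by (simp add: tail_def part_def obj_strand)
    next
      assume v: "v \<in> tail M f b (nx w) x"
      then have "v \<in> tail M f b w x" using tail_mono[of w "nx w"] nw(1) by (auto simp: le_fun_def)
      moreover have "p x v = 0"
      proof (rule ext)
        fix t
        have "f x v t = 0" if "t \<in> tot {(w, nx w)}"
          using v that by (auto simp: tail_def part_def obj_strand tot_def)
        then show "p x v t = 0 t" by (simp add: p_def hom_comp_def r_def)
      qed
      ultimately show "v \<in> tail M f b w x \<and> p x v = 0" by blast
    qed
    then show ?thesis by blast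
  qed
  show "\<exists>p. rep_hom (restrict_rep M (tail M f b w)) (strand {(w, nx w)}) p \<and>
      (\<forall>x. p x ` tail M f b w x = obj (strand {(w, nx w)}) x \<and>
        {v \<in> tail M f b w x. p x v = 0} = tail M f b (nx w) x)"
    using p im ker by blast
qed

end

context circle_cells
begin

lemma string_objectI: "good {(a, b)} \<Longrightarrow> string_object m \<theta> Zs (strand {(a, b)} :: 'k::field rep) (\<lambda>x v. v) a b"
  by unfold_locales (auto intro: is_rep_strand good_separated is_iso_id)

lemma strand_not_zero:
  assumes "a < b"
  shows "\<not> zero_rep (strand {(a, b)} :: 'k::field rep)"
  using strand_single_nonzero[OF assms, where 'k = 'k] unfolding zero_rep_def by blast

lemma simple_string:
  assumes w: "w \<in> L"
  shows "simple_object C (strand {(w, nx w)} :: 'k::field rep)"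
  unfolding simple_object_def
proof (intro conjI allI impI)
  have g: "good {(w, nx w)}" using good_single[OF w nx_in[OF w] nx_gt[OF w]] by simp
  interpret string_object m \<theta> Zs "strand {(w, nx w)} :: 'k rep" "\<lambda>x v. v" w "nx w"
    by (rule string_objectI[OF g])
  show "C (strand {(w, nx w)} :: 'k rep)" by (rule C_M)
  show "\<not> zero_rep (strand {(w, nx w)} :: 'k rep)" by (rule strand_not_zero[OF nx_gt[OF w]])
  fix N :: "circle \<Rightarrow> 'k rfun set" assume N: "subobject C (strand {(w, nx w)}) N"
  from subobject_cases[OF N] show "N = (\<lambda>_. {0}) \<or> N = obj (strand {(w, nx w)})"
  proof
    assume "\<exists>w'\<in>L. w \<le> w' \<and> w' < nx w \<and> N = tail (strand {(w, nx w)}) (\<lambda>x v. v) (nx w) w'"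
    then obtain w' where w': "w' \<in> L" "w \<le> w'" "w' < nx w" "N = tail (strand {(w, nx w)}) (\<lambda>x v. v) (nx w) w'"
      by blast
    have "w' = w" using nx_le[OF w w'(1)] w'(2,3) by linarith
    then show ?thesis using w'(4) full_tail by simp
  qed blast
qed

end

context string_object
begin

text \<open>The subobject immediately below the tail at \<open>w\<close> is the tail at \<open>nx w\<close>, and the quotient is the simple
  string of the cell between them.\<close>

theorem composition_series_subobjects: "composition_series C M {N. subobject C M N}"
  unfolding composition_series_def
proof (intro conjI ballI allI impI)
  have "countable {w. w \<in> L \<and> a \<le> w \<and> w < b}" using countable_L by (rule countable_subset[rotated]) auto
  then have "countable (tail M f b ` {w. w \<in> L \<and> a \<le> w \<and> w < b})" by simp
  moreover have "tail M f b ` {w. w \<in> L \<and> a \<le> w \<and> w < b} = {tail M f b w | w. w \<in> L \<and> a \<le> w \<and> w < b}" by blast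
  ultimately show "countable {N. subobject C M N}" unfolding subobjects by simp
  show "(\<lambda>_. {0}) \<in> {N. subobject C M N}" using zero_subobject by simp
  show "obj M \<in> {N. subobject C M N}" using tail_subobject[OF ends(1) order_refl ends(3)] full_tail by simp
  show "N \<le> K \<or> K \<le> N" if "N \<in> {N. subobject C M N}" "K \<in> {N. subobject C M N}" for N K
    using chain that by simp
  fix K N assume K: "K \<in> {N. subobject C M N}" and N: "N \<in> {N. subobject C M N}"
    and cons: "K < N \<and> (\<nexists>K'. K' \<in> {N. subobject C M N} \<and> K < K' \<and> K' < N)"
  have "N \<noteq> (\<lambda>x. {0})" using cons zero_le[of K] K by auto
  then obtain w where w: "w \<in> L" "a \<le> w" "w < b" "N = tail M f b w" using subobject_cases N by blast
  have nw: "w < nx w" "nx w \<le> b" using nx_gt[OF w(1)] nx_le[OF w(1) ends(2) w(3)] .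
  let ?T = "tail M f b (nx w)"
  have T: "subobject C M ?T"
  proof (cases "nx w = b")
    case True
    then show ?thesis using tail_b zero_subobject by simp
  next
    case False
    then show ?thesis using tail_subobject[OF nx_in[OF w(1)]] nw w(2) by simp
  qed
  have TN: "?T < N"
    using tail_mono[of w "nx w"] tail_neq[OF w(1-3) nw(1)] nw(1) unfolding w(4) by (simp add: less_le_not_le)
  have "K \<le> ?T"
  proof (cases "K = (\<lambda>x. {0})")
    case True
    then show ?thesis using zero_le[OF T] by simp
  next
    case False
    then obtain w' where w': "w' \<in> L" "a \<le> w'" "w' < b" "K = tail M f b w'" using subobject_cases K by blast
    have "w < w'" using cons tail_mono[of w' w] unfolding w(4) w'(4) by (meson not_less less_le_not_le)
    then show ?thesis using nx_le[OF w(1) w'(1)] tail_mono w'(4) by simp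
  qed
  then have "K = ?T" using cons T TN by (metis mem_Collect_eq order_le_imp_less_or_eq)
  then show "\<exists>Q. is_quotient M N K Q \<and> simple_object C Q"
    using tail_quotient[OF w(1-3)] simple_string[OF w(1)] w(4) by blast
qed auto

text \<open>A composition series contains every subobject comparable with all of its terms, which here is
  every subobject.\<close>

theorem composition_series_unique:
  assumes "composition_series C M \<C>"
  shows "\<C> = {N. subobject C M N}"
proof
  have "\<forall>N\<in>\<C>. subobject C M N"
    using assms unfolding composition_series_def by (elim conjE)
  then show sub: "\<C> \<subseteq> {N. subobject C M N}" by blast
  have maximal: "\<forall>N. subobject C M N \<and> (\<forall>K\<in>\<C>. N \<le> K \<or> K \<le> N) \<longrightarrow> N \<in> \<C>"
    using assms unfolding composition_series_def by (elim conjE)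
  show "{N. subobject C M N} \<subseteq> \<C>"
  proof
    fix N assume N: "N \<in> {N. subobject C M N}"
    have "\<forall>K\<in>\<C>. N \<le> K \<or> K \<le> N"
    proof
      fix K assume "K \<in> \<C>"
      from subsetD[OF sub this] have "subobject C M K" by simp
      then show "N \<le> K \<or> K \<le> N" using chain[of N K] N by simp
    qed
    then show "N \<in> \<C>" using maximal N by simp
  qed
qed

end

section \<open>Indecomposable objects\<close>

lemma direct_sum_disjoint:
  assumes M: "is_rep M" and sum: "direct_sum M (UNIV :: bool set) (\<lambda>b. if b then A else B)"
    and v: "v \<in> A x" "v \<in> B x"
  shows "v = 0"
proof -
  interpret direct_sum_rep M "UNIV :: bool set" "\<lambda>b. if b then A else B" by unfold_locales (fact M sum)+
  let ?c = "component UNIV (\<lambda>b. if b then A else B) True x v"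
  have vM: "v \<in> obj M x" using summand_sub[of True v x] v(1) by simp
  have "0 \<in> A x" using rf.subspace_0[OF summand_subspace[of True x]] by simp
  then have "decomposition UNIV (\<lambda>b. if b then A else B) x v (\<lambda>i. if i = False then v else 0)"
    by (intro decompositionI[of _ _ _ _ "{False}"]) (use v in \<open>auto split: if_splits\<close>)
  then have "?c = 0" using component_unique[OF vM] by fastforce
  moreover have "?c = v" using component_self[of True v x] v(1) by simp
  ultimately show ?thesis by simp
qed

context circle_cells
begin

lemma indecomposable_string:
  assumes g: "good {(a, b)}"
  shows "indecomposable C (strand {(a, b)} :: 'k::field rep)"
  unfolding indecomposable_def
proof (intro conjI allI impI)
  interpret string_object m \<theta> Zs "strand {(a, b)} :: 'k rep" "\<lambda>x v. v" a b
    by (rule string_objectI[OF g])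
  show "C (strand {(a, b)} :: 'k rep)" by (rule C_M)
  show "\<not> zero_rep (strand {(a, b)} :: 'k rep)" by (rule strand_not_zero[OF ends(3)])
  fix A B :: "circle \<Rightarrow> 'k rfun set"
  assume h: "direct_sum (strand {(a, b)}) UNIV (\<lambda>b. if b then A else B) \<and>
      C (restrict_rep (strand {(a, b)}) A) \<and> C (restrict_rep (strand {(a, b)}) B)"
  have "subrep (strand {(a, b)}) (if i then A else B)" for i
    using h unfolding direct_sum_def by blast
  from this[of True] this[of False] have AB: "subobject C (strand {(a, b)}) A" "subobject C (strand {(a, b)}) B"
    using h by (auto simp: subobject_def)
  have disj: "v = 0" if "v \<in> A x" "v \<in> B x" for v x
    using direct_sum_disjoint[OF M] h that by blast
  have "A x = {0}" if "A \<le> B" for x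
    using disj le_funD[OF that, of x] le_funD[OF zero_le[OF AB(1)], of x] by blast
  moreover have "B x = {0}" if "B \<le> A" for x
    using disj le_funD[OF that, of x] le_funD[OF zero_le[OF AB(2)], of x] by blast
  ultimately show "zero_rep (restrict_rep (strand {(a, b)}) A) \<or> zero_rep (restrict_rep (strand {(a, b)}) B)"
    using chain[OF AB] by (auto simp: zero_rep_def)
qed

text \<open>One string of a decomposition splits off with a complement that is again a direct sum of strings of
  \<open>C\<close>; so the complement vanishes.\<close>

lemma indecomposable_is_string:
  assumes ind: "indecomposable C (M :: 'k::field rep)"
  obtains a b f where "string_object m \<theta> Zs M f a b"
proof -
  have CM: "C M" and nz: "\<not> zero_rep M" using ind by (auto simp: indecomposable_def)
  have M: "is_rep M" by (rule C_rep[OF CM])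
  obtain F f where F: "good F" and f: "is_iso M (strand F) f" using C_decompose[OF CM] by blast
  have F0: "separated 0 F" by (rule good_separated[OF F])
  have empty: "G = {}" if G: "G \<subseteq> F" and z: "zero_rep (restrict_rep M (part M f G))" for G
  proof (rule ccontr)
    assume "G \<noteq> {}"
    then obtain p where p: "p \<in> G" by blast
    let ?e = "basis_vec (snd p) :: 'k rfun" and ?x = "cov (snd p)"
    have lt: "fst p < snd p" using separated_less[OF F0] p G by blast
    have e: "?e \<in> obj (strand G) ?x" using lt p by (intro basis_vec_in_strand totI[of p]) auto
    have iso: "is_iso (restrict_rep M (part M f G)) (strand G) f" by (rule part_iso_subset[OF F0 G f])
    have "iso_inv (restrict_rep M (part M f G)) f ?x ?e = 0"
      using iso_inv_in[OF iso e] z by (simp add: zero_rep_def)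
    then have "?e = f ?x 0" using iso_inv_right[OF iso e] by simp
    then have "?e = 0" using rep_hom_0[OF is_iso_hom[OF f] M] by simp
    then show False using strand_single_nonzero(2)[OF lt, where 'k = 'k] by blast
  qed
  have "F \<noteq> {}"
  proof
    assume "F = {}"
    have "v = 0" if "v \<in> obj M x" for v x
    proof -
      have "f x v \<in> obj (strand {}) x" using rep_hom_in[OF is_iso_hom[OF f] that] \<open>F = {}\<close> by simp
      then have "f x v = f x 0"
        using rep_hom_0[OF is_iso_hom[OF f] M, of x] by (auto simp: obj_strand tot_def fun_eq_iff)
      then show ?thesis
        using is_iso_inj[OF f that rf.subspace_0[OF is_rep_subspace[OF M]]] by blast
    qed
    then have "zero_rep M" unfolding zero_rep_def using rf.subspace_0[OF is_rep_subspace[OF M]] by blast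
    then show False using nz by blast
  qed
  then obtain p where p: "p \<in> F" by blast
  let ?A = "part M f {p}" and ?B = "part M f (F - {p})"
  have "direct_sum M (UNIV :: bool set) (\<lambda>b. if b then ?A else ?B)"
    by (rule part_direct_sum[OF M F0 f, where G = "\<lambda>b. if b then {p} else F - {p}"]) (use p in auto)
  moreover have "C (restrict_rep M (part M f G))" if "G \<subseteq> F" for G
    by (rule C_intro[OF is_rep_restrict[OF M part_subrep_subset[OF M F0 that f]] part_iso_subset[OF F0 that f] good_subset[OF F that]])
  then have "C (restrict_rep M ?A)" "C (restrict_rep M ?B)" using p by auto
  ultimately have "zero_rep (restrict_rep M ?A) \<or> zero_rep (restrict_rep M ?B)"
    using ind unfolding indecomposable_def by blast
  then have "F - {p} = {}" using empty[of "{p}"] empty[of "F - {p}"] p by blast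
  then have "F = {(fst p, snd p)}" using p by auto
  then have "string_object m \<theta> Zs M f (fst p) (snd p)"
    using M F f by unfold_locales auto
  then show ?thesis using that by blast
qed

end

theorem theorem2:
  fixes m :: nat and \<theta> :: "nat \<Rightarrow> real" and Zs :: "nat \<Rightarrow> real set" and Z :: "real set"
    and C :: "'k::field rep \<Rightarrow> bool"
  assumes "m \<ge> 1" and "accumulating_copies m \<theta> Zs"
  defines "Z \<equiv> (\<Union>i\<in>{1..m}. Zs i)" and "C \<equiv> rep_Z m \<theta> Z"
  shows "(\<forall>M. C M \<longrightarrow> (\<exists>P p. projective_cover C M P p) \<and> (\<exists>J i. injective_envelope C M J i)) \<and>
    (\<forall>z\<in>Z. simple_object C (string {z<..next_pt Z z}) \<and>
       indecomposable C (string {z<..next_pt Z z + 2 * pi}) \<and>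
       projective C (string {z<..next_pt Z z + 2 * pi}) \<and>
       injective C (string {z<..next_pt Z z + 2 * pi}) \<and>
       (\<exists>p. projective_cover C (string {z<..next_pt Z z}) (string {z<..next_pt Z z + 2 * pi}) p) \<and>
       (\<exists>i. injective_envelope C (string {z<..next_pt Z z}) (string {z<..next_pt Z z + 2 * pi}) i)) \<and>
    (\<forall>M. indecomposable C M \<longrightarrow> (\<exists>!\<C>. composition_series C M \<C>)) \<and>
    (\<forall>u1\<in>Z. \<forall>u2\<in>Z. \<forall>h\<in>{0, 1 :: nat}.
       next_pt Z u1 \<le> u2 + 2 * real h * pi \<and> u2 + 2 * real h * pi \<le> next_pt Z u1 + 2 * pi \<longrightarrow>
       composition_series C (string {u1<..u2 + 2 * real h * pi})
         (string_series Z u1 (u2 + 2 * real h * pi)))"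
proof -
  interpret cc: circle_cells m \<theta> Zs by unfold_locales (use assms(1,2) in auto)
  have Z: "Z = cc.Z" by (simp add: Z_def cc.Z_def)
  have C: "C = cc.C" by (simp add: C_def Z)
  have nxZ: "next_pt Z z = cc.nx z" and ZL: "z \<in> cc.L" if "z \<in> Z" for z
    using that cc.nx_Z cc.Z_in_L by (auto simp: Z)
  show ?thesis
    unfolding C
  proof (intro conjI allI ballI impI)
    fix M :: "'k rep" assume M: "cc.C M"
    obtain F f where F: "separated (2 * pi) F" "cc.good F" "is_iso M (strand F) f"
      using cc.C_decompose[OF M] .
    show "\<exists>P p. projective_cover cc.C M P p"
      using cc.projective_cover_strand[OF M F] by blast
    show "\<exists>J i. injective_envelope cc.C M J i"
      using cc.injective_envelope_strand[OF M F] by blast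
  next
    fix z assume z: "z \<in> Z"
    let ?y = "cc.nx z"
    have zL: "z \<in> cc.L" and ny: "next_pt Z z = ?y" using ZL[OF z] nxZ[OF z] .
    have lt: "z < ?y" by (rule cc.nx_gt[OF zL])
    have lt2: "z < ?y + 2 * pi" using lt pi_gt_zero by linarith
    have gS: "cc.good {(z, ?y)}" using cc.good_single[OF zL cc.nx_in[OF zL] lt] by simp
    have gP: "cc.good {(z, ?y + 2 * pi)}" using cc.good_single[OF zL cc.L_plus[OF cc.nx_in[OF zL]] lt2] by simp
    have full: "cc.full {(z, ?y + 2 * pi)}" using gP by (simp add: cc.full_def)
    have CS: "cc.C (strand {(z, ?y)} :: 'k rep)" by (rule cc.C_strand[OF gS])
    show "simple_object cc.C (string {z<..next_pt Z z} :: 'k rep)"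
      unfolding ny string_eq_strand by (rule cc.simple_string[OF zL])
    show "indecomposable cc.C (string {z<..next_pt Z z + 2 * pi} :: 'k rep)"
      unfolding ny string_eq_strand by (rule cc.indecomposable_string[OF gP])
    show "projective cc.C (string {z<..next_pt Z z + 2 * pi} :: 'k rep)"
      unfolding ny string_eq_strand by (rule cc.projective_full[OF full])
    show "injective cc.C (string {z<..next_pt Z z + 2 * pi} :: 'k rep)"
      unfolding ny string_eq_strand by (rule cc.injective_full[OF full])
    have "cc.proj_ext {(z, ?y)} = {(z, ?y + 2 * pi)}" by (simp add: cc.proj_ext_def)
    then show "\<exists>p. projective_cover cc.C (string {z<..next_pt Z z} :: 'k rep) (string {z<..next_pt Z z + 2 * pi}) p"
      unfolding ny string_eq_strand
      using cc.projective_cover_strand[OF CS separated_single[OF lt] gS is_iso_id] by simp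
    \<comment> \<open>The envelope of \<open>(z, y]\<close> extends it to the left; after shifting the simple object by one
      turn, that extension is the string at \<open>z\<close>.\<close>
    let ?F = "{(z + 2 * pi, ?y + 2 * pi)}"
    have zL2: "z + 2 * pi \<in> cc.L" and ny2: "cc.nx (z + 2 * pi) = ?y + 2 * pi"
      using cc.L_plus[OF zL] cc.nx_shift[OF zL, of 1] by auto
    have gF: "cc.good ?F" using cc.good_single[OF zL2 cc.nx_in[OF zL2] cc.nx_gt[OF zL2]] ny2 by simp
    have iso: "is_iso (strand {(z, ?y)} :: 'k rep) (strand ?F) (\<lambda>x v t. v (t - 2 * pi))"
      using strand_shift[OF lt, of 1, where 'k = 'k] by simp
    have "cc.pr (?y + 2 * pi) = z + 2 * pi" using cc.pr_nx[OF zL2] ny2 by simp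
    then have "cc.inj_ext ?F = {(z, ?y + 2 * pi)}" by (simp add: cc.inj_ext_def)
    then show "\<exists>i. injective_envelope cc.C (string {z<..next_pt Z z} :: 'k rep) (string {z<..next_pt Z z + 2 * pi}) i"
      unfolding ny string_eq_strand
      using cc.injective_envelope_strand[OF CS separated_single gF iso] lt by simp
  next
    fix M :: "'k rep" assume "indecomposable cc.C M"
    then obtain a b f where so: "string_object m \<theta> Zs M f a b" by (rule cc.indecomposable_is_string)
    show "\<exists>!\<C>. composition_series cc.C M \<C>"
      using string_object.composition_series_subobjects[OF so] string_object.composition_series_unique[OF so]
      by (rule ex1I)
  next
    fix u1 u2 and h :: nat
    assume u: "u1 \<in> Z" "u2 \<in> Z" "h \<in> {0, 1}"
      and le: "next_pt Z u1 \<le> u2 + 2 * real h * pi \<and> u2 + 2 * real h * pi \<le> next_pt Z u1 + 2 * pi"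
    define e where "e = u2 + 2 * real h * pi"
    have eL: "e \<in> cc.L" using cc.L_shift[of u2 "int h"] ZL[OF u(2)] by (simp add: e_def mult.commute mult.left_commute)
    have lt: "u1 < e" using cc.nx_gt[OF ZL[OF u(1)]] le nxZ[OF u(1)] by (simp add: e_def)
    have g: "cc.good {(u1, e)}"
      using cc.good_single[OF ZL[OF u(1)] eL lt] le nxZ[OF u(1)] by (simp add: e_def)
    interpret string_object m \<theta> Zs "strand {(u1, e)} :: 'k rep" "\<lambda>x v. v" u1 e
      by (rule cc.string_objectI[OF g])
    have tl: "cc.tail (strand {(u1, e)} :: 'k rep) (\<lambda>x v. v) e w = obj (string {w<..e})"
      if "u1 \<le> w" "w < e" for w
      unfolding cc.tail_def part_def string_eq_strand
      using rep_hom_in[OF incl_tail[OF that]] by blast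
    have "(N = cc.tail (strand {(u1, e)} :: 'k rep) (\<lambda>x v. v) e w \<and> w \<in> cc.L \<and> u1 \<le> w \<and> w < e) \<longleftrightarrow>
        (N = obj (string {w<..e}) \<and> w rmod (2 * pi) \<in> Z \<and> u1 \<le> w \<and> w < e)" for N w
      using tl[of w] by (cases "u1 \<le> w \<and> w < e") (simp add: cc.L_def Z, blast)
    then have "string_series Z u1 e = {N. subobject cc.C (strand {(u1, e)} :: 'k rep) N}"
      unfolding subobjects string_series_def by (simp only:)
    then show "composition_series cc.C (string {u1<..u2 + 2 * real h * pi} :: 'k rep)
         (string_series Z u1 (u2 + 2 * real h * pi))"
      using composition_series_subobjects unfolding string_eq_strand e_def[symmetric] by simp
  qed
qed

end
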